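(* Let $0<q<1$, $\mu>0$, $z=q^\mu$, and let $I^{(q,z)}=\int_0^\infty q^{\zeta_s}\,ds$, where $\zeta_t=P^+_t-P^-_t$ and $P^+,P^-$ are independent Poisson processes with intensities $1$ and $z$ respectively. Then the following equality in law holds: $$I^{(q,z)}\ \stackrel{\mathcal{L}}{=}\ q^{-\sum_{n=0}^\infty G_{zq^n}}\,I^{(q)}=\frac{(1-q)^{-1}I^{(q)}}{R^{(q)}_z},$$ where $I^{(q)}$ and $R^{(q)}_z=(1-q)^{-1}q^{\sum_{n=0}^\infty G_{zq^n}}$ are independent random variables. In particular, for each $\mu>0$, as $q\to1^-$, $(1-q)^2 I^{(q,q^\mu)}$ converges in law to $\frac{1}{\gamma_\mu}$, where $\gamma_\mu$ is a gamma random variable with parameter $\mu$.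
   Context: $I^{(q)}=\sum_{n=0}^\infty q^n\varepsilon_n$, where $(\varepsilon_n)_{n\ge0}$ are i.i.d. standard exponential random variables (mean $1$). For $0\le a<1$, $G_a$ denotes a geometric random variable with parameter $a$, i.e. $\mathbb{P}(G_a=k)=(1-a)a^k$ for $k=0,1,2,\dots$. The variables $G_z,G_{zq},G_{zq^2},\dots$ are independent with the indicated parameters, and $R^{(q)}_a=(1-q)^{-1}q^{\sum_{n=0}^\infty G_{aq^n}}$ (a $q$-gamma random variable). A gamma random variable with parameter $\mu$ has density $\frac{1}{\Gamma(\mu)}x^{\mu-1}e^{-x}$ on $(0,\infty)$. *)

theory Defs
  imports "HOL-Probability.Probability"
begin

section \<open>Poisson processes\<close>

text \<open>
  A Poisson process of intensity \<open>r\<close> is a counting process: every sample path starts at 0, is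
  nondecreasing and right-continuous. Because paths are nondecreasing, the subtraction on \<open>nat\<close>
  in the increments never truncates. Only times \<open>t \<ge> 0\<close> matter.
\<close>

definition (in prob_space) poisson_process :: "real \<Rightarrow> (real \<Rightarrow> 'a \<Rightarrow> nat) \<Rightarrow> bool" where
  "poisson_process r P \<longleftrightarrow>
     (\<forall>t\<ge>0. random_variable (count_space UNIV) (P t)) \<and>
     (\<forall>\<omega>\<in>space M. P 0 \<omega> = 0 \<and> mono_on {0..} (\<lambda>t. P t \<omega>) \<and>
        (\<forall>t\<ge>0. continuous (at_right t) (\<lambda>s. P s \<omega>))) \<and>
     (\<forall>n (t :: nat \<Rightarrow> real). 0 \<le> t 0 \<and> (\<forall>i<n. t i \<le> t (Suc i)) \<longrightarrow>
        indep_vars (\<lambda>_. count_space UNIV) (\<lambda>i \<omega>. P (t (Suc i)) \<omega> - P (t i) \<omega>) {..<n}) \<and>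
     (\<forall>s t. 0 \<le> s \<and> s < t \<longrightarrow>
        distr M (count_space UNIV) (\<lambda>\<omega>. P t \<omega> - P s \<omega>) = measure_pmf (poisson_pmf (r * (t - s))))"

text \<open>
  Independence of two processes as random elements of the path space, i.e. independence of the
  sigma-algebras that they generate.
\<close>

definition (in prob_space) indep_processes ::
    "(real \<Rightarrow> 'a \<Rightarrow> nat) \<Rightarrow> (real \<Rightarrow> 'a \<Rightarrow> nat) \<Rightarrow> bool" where
  "indep_processes X Y \<longleftrightarrow>
     indep_var (PiM {0..} (\<lambda>_. count_space UNIV)) (\<lambda>\<omega>. \<lambda>t\<in>{0..}. X t \<omega>)
               (PiM {0..} (\<lambda>_. count_space UNIV)) (\<lambda>\<omega>. \<lambda>t\<in>{0..}. Y t \<omega>)"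

definition (in prob_space) indep_poisson_pair ::
    "real \<Rightarrow> real \<Rightarrow> (real \<Rightarrow> 'a \<Rightarrow> nat) \<Rightarrow> (real \<Rightarrow> 'a \<Rightarrow> nat) \<Rightarrow> bool" where
  "indep_poisson_pair r r' Pp Pm \<longleftrightarrow>
     poisson_process r Pp \<and> poisson_process r' Pm \<and> indep_processes Pp Pm"


section \<open>Exponential functionals\<close>

definition zeta :: "(real \<Rightarrow> 'a \<Rightarrow> nat) \<Rightarrow> (real \<Rightarrow> 'a \<Rightarrow> nat) \<Rightarrow> real \<Rightarrow> 'a \<Rightarrow> int" where
  "zeta Pp Pm t \<omega> = int (Pp t \<omega>) - int (Pm t \<omega>)"

definition exp_functional ::
    "real \<Rightarrow> (real \<Rightarrow> 'a \<Rightarrow> nat) \<Rightarrow> (real \<Rightarrow> 'a \<Rightarrow> nat) \<Rightarrow> 'a \<Rightarrow> real" where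
  "exp_functional q Pp Pm \<omega> = (LBINT s:{0..}. q powi zeta Pp Pm s \<omega>)"

definition I_q :: "real \<Rightarrow> (nat \<Rightarrow> 'a \<Rightarrow> real) \<Rightarrow> 'a \<Rightarrow> real" where
  "I_q q \<epsilon> \<omega> = (\<Sum>n. q ^ n * \<epsilon> n \<omega>)"

definition (in prob_space) iid_std_exponential :: "(nat \<Rightarrow> 'a \<Rightarrow> real) \<Rightarrow> bool" where
  "iid_std_exponential \<epsilon> \<longleftrightarrow>
     indep_vars (\<lambda>_. borel) \<epsilon> UNIV \<and>
     (\<forall>n. distributed M lborel (\<epsilon> n) (exponential_density 1))"


section \<open>Geometric sequences and q-gamma variables\<close>

text \<open>
  \<open>G n\<close> stands for $G_{a q^n}$. The parameter of \<^const>\<open>geometric_pmf\<close> is the success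
  probability, so the law $P(G_b = k) = (1 - b) b^k$ is \<open>geometric_pmf (1 - b)\<close>.
\<close>

definition (in prob_space) indep_geometric_seq :: "real \<Rightarrow> real \<Rightarrow> (nat \<Rightarrow> 'a \<Rightarrow> nat) \<Rightarrow> bool" where
  "indep_geometric_seq q a G \<longleftrightarrow>
     indep_vars (\<lambda>_. count_space UNIV) G UNIV \<and>
     (\<forall>n. distr M (count_space UNIV) (G n) = measure_pmf (geometric_pmf (1 - a * q ^ n)))"

text \<open>
  The series of the \<open>G n\<close> is a series in the discrete space \<open>nat\<close>: it is summable iff all but
  finitely many terms vanish.
\<close>

definition q_gamma :: "real \<Rightarrow> (nat \<Rightarrow> 'a \<Rightarrow> nat) \<Rightarrow> 'a \<Rightarrow> real" where
  "q_gamma q G \<omega> = inverse (1 - q) * q ^ (\<Sum>n. G n \<omega>)"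

definition gamma_density :: "real \<Rightarrow> real \<Rightarrow> real" where
  "gamma_density \<mu> x = (if 0 < x then x powr (\<mu> - 1) * exp (- x) / Gamma \<mu> else 0)"


section \<open>Convergence in law along a filter\<close>

text \<open>The library's \<^const>\<open>weak_conv_m\<close>, with an arbitrary filter in place of \<^const>\<open>sequentially\<close>.\<close>

definition weak_conv_along :: "('i \<Rightarrow> real measure) \<Rightarrow> real measure \<Rightarrow> 'i filter \<Rightarrow> bool" where
  "weak_conv_along L L' F \<longleftrightarrow>
     (\<forall>x. isCont (cdf L') x \<longrightarrow> ((\<lambda>i. cdf (L i) x) \<longlongrightarrow> cdf L' x) F)"

lemma weak_conv_along_sequentially: "weak_conv_along L L' sequentially \<longleftrightarrow> weak_conv_m L L'"
  by (simp add: weak_conv_along_def weak_conv_m_def weak_conv_def)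

end

theory Submission
  imports Defs "HOL-Real_Asymp.Real_Asymp"
begin

text \<open>
  Write \<open>z = q powr \<mu>\<close>. Both sides of the equality in law have a characteristic function \<open>\<phi>\<close> that solves
  \<open>(1 + z - \<i> t) \<phi>(t) = \<phi>(q t) + z \<phi>(t / q)\<close>, and a law is determined by this equation: the difference
  of two solutions vanishes at 0 and, because of the factor on the left, at infinity, so unless it is 0 its modulus
  attains its maximum at some \<open>t \<noteq> 0\<close>, where \<open>\<bar>1 + z - \<i> t\<bar> > 1 + z\<close> contradicts the equation
  (\<open>q_difference_equation_law_unique\<close>).

  For the exponential functional the equation expresses the Markov property of \<open>P\<^sup>+ - P\<^sup>-\<close> over a
  short time \<open>h\<close>, in which nothing happens with probability about \<open>1 - (1 + z) h\<close>, the path goes up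
  with probability about \<open>h\<close> and down with probability about \<open>z h\<close>. It is derived from
  Riemann sums: the sum with mesh \<open>h\<close> is a perpetuity in the independent
  increments over the grid, so its characteristic function solves an exact equation for every \<open>h\<close>
  (\<open>grid_char_equation\<close>). Dividing by \<open>h\<close> and letting \<open>h\<close> tend to 0 gives the equation
  (\<open>char_X_equation\<close>). The Riemann sums converge because paths are right-continuous and a summable
  majorant exists almost surely; the latter follows from a finite fractional moment of order
  \<open>\<alpha> < \<mu>\<close> (\<open>AE_summable_D\<close>).

  For the quotient, the characteristic function \<open>\<psi>\<close> of \<open>I_q\<close> is an infinite product, whence
  \<open>(1 - \<i> t) \<psi>(t) = \<psi>(q t)\<close>, and the sum \<open>S\<close> of the geometric variables satisfies
  \<open>E[(1 - q^S) f(S)] = z E[f(S + 1)]\<close> for bounded \<open>f\<close> (\<open>geometric_series_size_bias\<close>), which is the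
  relation \<open>P(q x) = (1 - z x) P(x)\<close> for its generating function. Using this identity twice
  gives the q-difference equation (\<open>char_quotient_equation\<close>).

  For the limit, \<open>(1 - q)\<^sup>2\<close> times the functional has the law of \<open>(1 - q) I_q / R\<close>. The numerator
  tends to 1. In terms of the q-gamma variable \<open>R\<close> the identity for \<open>S\<close> reads
  \<open>E[f(R)] - q^\<mu> E[f(q R)] = (1 - q) E[R f(R)]\<close>, a q-analogue of the Stein equation of the
  gamma law. With \<open>f(x) = exp(\<i> t x)\<close> it says that the characteristic function of \<open>R\<close> solves, up to an
  error that vanishes as \<open>q\<close> tends to 1, the linear differential equation of the function
  \<open>(1 - \<i> t) powr (- \<mu>)\<close>. So \<open>R\<close> converges in law to a gamma variable, and the ratio converges to
  its reciprocal.
\<close>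

section \<open>Laws determined by a q-difference equation\<close>

text \<open>
  A maximum principle: the right-hand side is at most \<open>1 + z\<close> times the supremum of the modulus, while
  the factor on the left has modulus greater than \<open>1 + z\<close> unless \<open>t = 0\<close>.
\<close>
lemma q_difference_equation_trivial_kernel:
  fixes d :: "real \<Rightarrow> complex"
  assumes z: "0 \<le> z" and cont: "\<And>t. isCont d t"
    and bdd: "\<And>t. cmod (d t) \<le> B" and d0: "d 0 = 0"
    and eq: "\<And>t. (of_real (1 + z) - \<i> * of_real t) * d t = d (q * t) + of_real z * d (t / q)"
  shows "d t = 0"
proof (rule ccontr)
  assume "d t \<noteq> 0"
  define e where "e = cmod (d t)"
  have e: "0 < e" using \<open>d t \<noteq> 0\<close> by (simp add: e_def)
  have B: "0 \<le> B" using bdd[of 0] norm_ge_zero order_trans by blast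
  have step: "cmod (of_real (1 + z) - \<i> * of_real s) * cmod (d s) \<le> (1 + z) * m"
    if "\<And>u. cmod (d u) \<le> m" for s m
  proof -
    have "cmod (of_real (1 + z) - \<i> * of_real s) * cmod (d s) = cmod (d (q * s) + of_real z * d (s / q))"
      using eq[of s] by (metis norm_mult)
    also have "\<dots> \<le> cmod (d (q * s)) + z * cmod (d (s / q))"
      using z norm_triangle_ineq[of "d (q * s)" "of_real z * d (s / q)"] by (simp add: norm_mult)
    also have "\<dots> \<le> m + z * m"
      using z that by (intro add_mono mult_left_mono) auto
    finally show ?thesis by (simp add: algebra_simps)
  qed
  \<comment> \<open>Beyond \<open>K\<close> the bound \<open>(1 + z) * B / \<bar>s\<bar>\<close> for \<open>cmod (d s)\<close> is below \<open>e\<close>, so the supremum is attained.\<close>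
  define K where "K = (1 + z) * B / e + \<bar>t\<bar> + 1"
  have Kt: "\<bar>t\<bar> \<le> K" and K0: "0 \<le> K" using e B z by (simp_all add: K_def)
  have far: "cmod (d s) < e" if "K < \<bar>s\<bar>" for s
  proof (rule ccontr)
    assume "\<not> cmod (d s) < e"
    have "\<bar>s\<bar> \<le> cmod (of_real (1 + z) - \<i> * of_real s)"
      using abs_Im_le_cmod[of "of_real (1 + z) - \<i> * of_real s"] by simp
    then have "\<bar>s\<bar> * e \<le> cmod (of_real (1 + z) - \<i> * of_real s) * cmod (d s)"
      using \<open>\<not> cmod (d s) < e\<close> e by (intro mult_mono) auto
    also have "\<dots> \<le> (1 + z) * B" by (rule step[OF bdd])
    finally have "\<bar>s\<bar> \<le> (1 + z) * B / e" using e by (simp add: field_simps)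
    with that show False by (simp add: K_def)
  qed
  have "continuous_on {-K..K} (\<lambda>s. cmod (d s))"
    by (intro continuous_on_norm continuous_at_imp_continuous_on ballI cont)
  then obtain s where s: "s \<in> {-K..K}" and max: "\<And>u. u \<in> {-K..K} \<Longrightarrow> cmod (d u) \<le> cmod (d s)"
    using continuous_attains_sup[of "{-K..K}" "\<lambda>s. cmod (d s)"] K0 by force
  have "e \<le> cmod (d s)" using max[of t] Kt by (auto simp: e_def abs_le_iff)
  then have "cmod (d u) \<le> cmod (d s)" for u
    using max[of u] far[of u] by (cases "K < \<bar>u\<bar>") (auto simp: abs_if not_less split: if_splits)
  from step[OF this, of s] \<open>e \<le> cmod (d s)\<close> e
  have "cmod (of_real (1 + z) - \<i> * of_real s) \<le> 1 + z"
    by (meson less_le_trans mult_le_cancel_right_pos)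
  then have "(cmod (of_real (1 + z) - \<i> * of_real s))\<^sup>2 \<le> (1 + z)\<^sup>2"
    by (intro power_mono) auto
  moreover have "(cmod (of_real (1 + z) - \<i> * of_real s))\<^sup>2 = (1 + z)\<^sup>2 + s\<^sup>2"
    by (simp add: cmod_def)
  ultimately have "s = 0" by simp
  with \<open>e \<le> cmod (d s)\<close> e d0 show False by simp
qed

lemma q_difference_equation_law_unique:
  fixes A B :: "real measure"
  assumes A: "real_distribution A" and B: "real_distribution B" and z: "0 \<le> z"
    and eqA: "\<And>t. (of_real (1 + z) - \<i> * of_real t) * char A t = char A (q * t) + of_real z * char A (t / q)"
    and eqB: "\<And>t. (of_real (1 + z) - \<i> * of_real t) * char B t = char B (q * t) + of_real z * char B (t / q)"
  shows "A = B"
proof (rule Levy_uniqueness[OF A B], rule ext)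
  interpret A: real_distribution A by fact
  interpret B: real_distribution B by fact
  fix t
  have "char A t - char B t = 0"
  proof (rule q_difference_equation_trivial_kernel[where d = "\<lambda>t. char A t - char B t" and B = 2, OF z])
    show "isCont (\<lambda>t. char A t - char B t) t" for t
      by (intro continuous_intros A.isCont_char B.isCont_char)
    show "cmod (char A t - char B t) \<le> 2" for t
      using norm_triangle_ineq4[of "char A t" "char B t"] A.cmod_char_le_1[of t] B.cmod_char_le_1[of t] by linarith
    show "char A 0 - char B 0 = 0" by (simp add: A.char_zero B.char_zero)
    show "(of_real (1 + z) - \<i> * of_real t) * (char A t - char B t)
      = char A (q * t) - char B (q * t) + of_real z * (char A (t / q) - char B (t / q))" for t
      using eqA[of t] eqB[of t] by (simp add: algebra_simps)
  qed
  then show "char A t = char B t" by simp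
qed

section \<open>Gamma and exponential laws\<close>

text \<open>
  Besides differentiability, the explicit remainder is needed later to bound, uniformly in \<open>q\<close>, the
  difference between a q-difference quotient and a derivative.
\<close>
lemma (in real_distribution) char_linear_approximation:
  assumes 1: "integrable M (\<lambda>x. x)" and 2: "integrable M (\<lambda>x. x\<^sup>2)"
  shows "cmod (char M (t + h) - char M t - h *\<^sub>R (CLINT x|M. \<i> * x * iexp (t * x)))
    \<le> h\<^sup>2 / 2 * expectation (\<lambda>x. x\<^sup>2)"
proof -
  have E: "integrable M (\<lambda>x. iexp (s * x))" for s
    by (intro integrable_iexp) auto
  have D: "integrable M (\<lambda>x. \<i> * x * iexp (t * x))"
    using 1 by (rule Bochner_Integration.integrable_bound) (auto simp: norm_mult)
  have "char M (t + h) - char M t - h *\<^sub>R (CLINT x|M. \<i> * x * iexp (t * x))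
    = (CLINT x|M. iexp ((t + h) * x) - iexp (t * x) - h *\<^sub>R (\<i> * x * iexp (t * x)))"
    unfolding char_def by (simp only: Bochner_Integration.integral_diff Bochner_Integration.integrable_diff
        integral_scaleR_right integrable_scaleR_right E D)
  also have "cmod \<dots> \<le> (\<integral>x. h\<^sup>2 / 2 * x\<^sup>2 \<partial>M)"
  proof (rule Bochner_Integration.integral_norm_bound_integral)
    show "integrable M (\<lambda>x. iexp ((t + h) * x) - iexp (t * x) - h *\<^sub>R (\<i> * x * iexp (t * x)))"
      by (simp only: Bochner_Integration.integrable_diff integrable_scaleR_right E D)
    show "integrable M (\<lambda>x. h\<^sup>2 / 2 * x\<^sup>2)" using 2 by simp
    fix x
    have "iexp ((t + h) * x) - iexp (t * x) - h *\<^sub>R (\<i> * x * iexp (t * x))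
      = iexp (t * x) * (iexp (h * x) - (\<Sum>k\<le>1. (\<i> * (h * x)) ^ k / fact k))"
      by (simp add: algebra_simps exp_add[symmetric] scaleR_conv_of_real)
    also have "cmod \<dots> \<le> \<bar>h * x\<bar> ^ Suc 1 / fact (Suc 1)"
      using iexp_approx1[of "h * x" 1] by (simp add: norm_mult)
    also have "\<dots> = h\<^sup>2 / 2 * x\<^sup>2"
      using power2_abs[of "h * x"] by (simp add: power_mult_distrib power2_eq_square abs_mult)
    finally show "cmod (iexp ((t + h) * x) - iexp (t * x) - h *\<^sub>R (\<i> * x * iexp (t * x))) \<le> h\<^sup>2 / 2 * x\<^sup>2" .
  qed
  finally show ?thesis by simp
qed

lemma (in real_distribution) has_vector_derivative_char:
  assumes 1: "integrable M (\<lambda>x. x)" and 2: "integrable M (\<lambda>x. x\<^sup>2)"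
  shows "(char M has_vector_derivative (CLINT x|M. \<i> * x * iexp (t * x))) (at t)"
  unfolding has_vector_derivative_def has_derivative_at
proof (intro conjI bounded_linear_scaleR_left)
  define D where "D = (CLINT x|M. \<i> * x * iexp (t * x))"
  show "(\<lambda>h. norm (char M (t + h) - char M t - h *\<^sub>R D) / norm h) \<midarrow>0\<rightarrow> 0"
  proof (rule Lim_null_comparison)
    show "\<forall>\<^sub>F h in at 0. norm (norm (char M (t + h) - char M t - h *\<^sub>R D) / norm h)
        \<le> \<bar>h\<bar> / 2 * expectation (\<lambda>x. x\<^sup>2)"
      unfolding eventually_at
    proof (intro exI[of _ 1] conjI ballI impI)
      fix h :: real assume "h \<noteq> 0 \<and> dist h 0 < 1"
      then show "norm (norm (char M (t + h) - char M t - h *\<^sub>R D) / norm h) \<le> \<bar>h\<bar> / 2 * expectation (\<lambda>x. x\<^sup>2)"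
        using char_linear_approximation[OF 1 2, of t h]
        by (simp add: D_def field_simps power2_eq_square)
    qed simp
    show "(\<lambda>h. \<bar>h\<bar> / 2 * expectation (\<lambda>x. x\<^sup>2)) \<midarrow>0\<rightarrow> 0"
      by (auto intro!: tendsto_eq_intros)
  qed
qed

text \<open>
  The function \<open>(1 - \<i> t) powr (- \<mu>)\<close> is the solution of the differential equation
  \<open>(1 - \<i> t) \<phi>' = \<i> \<mu> \<phi>\<close> with \<open>\<phi> 0 = 1\<close>. Multiplying an approximate solution by the integrating factor
  \<open>(1 - \<i> t) powr \<mu>\<close> leaves a function whose derivative is small. The case \<open>e = 0\<close> identifies the
  gamma law, and small \<open>e\<close> gives the limit of the q-gamma laws.
\<close>
lemma gamma_equation_stability:
  fixes \<phi> D :: "real \<Rightarrow> complex"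
  assumes \<mu>: "0 < \<mu>" and \<phi>0: "\<phi> 0 = 1"
    and der: "\<And>t. (\<phi> has_vector_derivative D t) (at t)"
    and close: "\<And>s. \<bar>s\<bar> \<le> \<bar>t\<bar> \<Longrightarrow> cmod ((1 - \<i> * s) * D s - \<i> * \<mu> * \<phi> s) \<le> e"
  shows "cmod ((1 - \<i> * t) powr of_real \<mu> * \<phi> t - 1) \<le> (1 + \<bar>t\<bar>) powr \<mu> * e * \<bar>t\<bar>"
proof -
  define h where "h s = (1 - \<i> * of_real s) powr of_real \<mu> * \<phi> s" for s :: real
  define h' where "h' s = (1 - \<i> * of_real s) powr of_real (\<mu> - 1) * ((1 - \<i> * s) * D s - \<i> * \<mu> * \<phi> s)" for s :: real
  have ne: "1 - \<i> * of_real s \<noteq> 0" for s :: real by (simp add: complex_eq_iff)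
  have dh: "(h has_vector_derivative h' s) (at s)" for s
  proof -
    have "((\<lambda>w. w powr of_real \<mu>) has_field_derivative
        of_real \<mu> * (1 - \<i> * of_real s) powr (of_real \<mu> - 1)) (at (1 - \<i> * of_real s))"
      by (rule has_field_derivative_powr) (simp add: complex_nonpos_Reals_iff)
    moreover have "((\<lambda>w. 1 - \<i> * w) has_field_derivative (- \<i>)) (at (of_real s))"
      by (auto intro!: derivative_eq_intros)
    ultimately have "((\<lambda>w. (1 - \<i> * w) powr of_real \<mu>) has_field_derivative
        (of_real \<mu> * (1 - \<i> * of_real s) powr (of_real \<mu> - 1) * (- \<i>))) (at (of_real s))"
      by (rule DERIV_chain2[where f = "\<lambda>w. w powr of_real \<mu>" and g = "\<lambda>w. 1 - \<i> * w"])
    then have "((\<lambda>s. (1 - \<i> * of_real s) powr of_real \<mu>) has_vector_derivative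
        (of_real \<mu> * (1 - \<i> * of_real s) powr (of_real \<mu> - 1) * (- \<i>))) (at s)"
      by (rule has_vector_derivative_real_field)
    from has_vector_derivative_mult[OF this der[of s]]
    have "(h has_vector_derivative ((1 - \<i> * of_real s) powr of_real \<mu> * D s
        + of_real \<mu> * (1 - \<i> * of_real s) powr (of_real \<mu> - 1) * (- \<i>) * \<phi> s)) (at s)"
      unfolding h_def[abs_def] .
    moreover have "(1 - \<i> * of_real s) powr of_real \<mu>
        = (1 - \<i> * of_real s) * (1 - \<i> * of_real s) powr (of_real \<mu> - 1)"
      using ne[of s] by (simp add: powr_diff)
    ultimately show ?thesis by (simp add: h'_def algebra_simps)
  qed
  have e: "0 \<le> e" using order_trans[OF norm_ge_zero close[of 0]] by simp
  have bound: "norm (h' s) \<le> (1 + \<bar>t\<bar>) powr \<mu> * e" if s: "\<bar>s\<bar> \<le> \<bar>t\<bar>" for s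
  proof -
    have le: "1 \<le> cmod (1 - \<i> * of_real s)" "cmod (1 - \<i> * of_real s) \<le> 1 + \<bar>t\<bar>"
      using abs_Re_le_cmod[of "1 - \<i> * of_real s"] norm_triangle_ineq4[of 1 "\<i> * of_real s"] s
      by (auto simp: norm_mult)
    have "cmod ((1 - \<i> * of_real s) powr of_real (\<mu> - 1)) = cmod (1 - \<i> * of_real s) powr (\<mu> - 1)"
      by (subst norm_powr_real_powr') auto
    also have "\<dots> \<le> cmod (1 - \<i> * of_real s) powr \<mu>" using le by (intro powr_mono) auto
    also have "\<dots> \<le> (1 + \<bar>t\<bar>) powr \<mu>" using le \<mu> by (intro powr_mono2) auto
    finally show ?thesis unfolding h'_def norm_mult
      using close[OF s] by (intro mult_mono) auto
  qed
  have "norm (h t - h 0) \<le> (1 + \<bar>t\<bar>) powr \<mu> * e * norm (t - 0)"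
  proof (rule differentiable_bound[where S = "{-\<bar>t\<bar>..\<bar>t\<bar>}"])
    show "(h has_derivative (\<lambda>y. y *\<^sub>R h' s)) (at s within {-\<bar>t\<bar>..\<bar>t\<bar>})" for s
      using dh[of s] by (auto simp: has_vector_derivative_def intro: has_derivative_at_withinI)
    show "onorm (\<lambda>y. y *\<^sub>R h' s) \<le> (1 + \<bar>t\<bar>) powr \<mu> * e" if "s \<in> {-\<bar>t\<bar>..\<bar>t\<bar>}" for s
      using bound[of s] that by (subst onorm_scaleR_left) (auto simp: onorm_id)
  qed auto
  then show ?thesis by (simp add: h_def \<phi>0)
qed

lemma set_integrable_Gamma_integrand:
  assumes "0 < a"
  shows "set_integrable lborel {0<..} (\<lambda>x. x powr (a - 1) * exp (- x) :: real)"
proof -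
  have "(\<lambda>x::real. x powr (a - 1) * exp (- x)) integrable_on {0..}"
    using Gamma_integral_real[OF assms] by (auto simp: exp_minus field_simps integrable_on_def)
  then have "(\<lambda>x::real. x powr (a - 1) * exp (- x)) absolutely_integrable_on {0..}"
    by (rule nonnegative_absolutely_integrable_1) simp
  then have "set_integrable lborel {0..} (\<lambda>x::real. x powr (a - 1) * exp (- x))"
    unfolding set_integrable_def by (subst (asm) integrable_completion) auto
  then show ?thesis by (rule set_integrable_subset) auto
qed

text \<open>
  Integration by parts turns the density into the differential equation of the previous stability
  estimate, with no error.
\<close>
lemma char_gamma_distribution:
  assumes \<mu>: "0 < \<mu>" and M: "prob_space (density lborel (gamma_density \<mu>))" (is "prob_space ?M")
  shows "(1 - \<i> * t) powr of_real \<mu> * char ?M t = 1"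
proof -
  interpret prob_space ?M by fact
  interpret real_distribution ?M
    by (auto simp: real_distribution_def real_distribution_axioms_def M)
  have Gp: "0 < Gamma \<mu>" using \<mu> by (rule Gamma_real_pos)
  have [measurable]: "gamma_density \<mu> \<in> borel_measurable borel"
    unfolding gamma_density_def[abs_def] by measurable
  have nn: "0 \<le> gamma_density \<mu> x" for x using Gp by (simp add: gamma_density_def)
  have mom: "integrable ?M (\<lambda>x. x ^ k)" for k
  proof -
    have "set_integrable lborel {0<..} (\<lambda>x. x powr ((\<mu> + k) - 1) * exp (- x))"
      using \<mu> by (intro set_integrable_Gamma_integrand) simp
    then have "integrable lborel (\<lambda>x. inverse (Gamma \<mu>) * (indicator {0<..} x *\<^sub>R (x powr ((\<mu> + k) - 1) * exp (- x))))"
      unfolding set_integrable_def by simp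
    also have "(\<lambda>x. inverse (Gamma \<mu>) * (indicator {0<..} x *\<^sub>R (x powr ((\<mu> + k) - 1) * exp (- x))))
      = (\<lambda>x. gamma_density \<mu> x *\<^sub>R x ^ k)"
      by (auto simp: fun_eq_iff gamma_density_def indicator_def powr_realpow[symmetric]
          powr_add[symmetric] field_simps)
    finally show ?thesis using nn by (subst integrable_density) auto
  qed
  have mom1: "integrable ?M (\<lambda>x. x)" using mom[of 1] by simp
  have eq: "(1 - \<i> * s) * (CLINT x|?M. \<i> * x * iexp (s * x)) = \<i> * \<mu> * char ?M s" for s :: real
  proof -
    have c1: "integrable ?M (\<lambda>x. complex_of_real x * iexp (s * x))"
      using mom1 by (rule Bochner_Integration.integrable_bound) (auto simp: norm_mult)
    have c0: "integrable ?M (\<lambda>x. iexp (s * x))" by (intro integrable_iexp) auto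
    \<comment> \<open>The equation says that the derivative \<open>f\<close> of \<open>F\<close> has integral 0; the boundary values of \<open>F\<close> vanish.\<close>
    define F where "F x = (x powr \<mu> * exp (- x)) *\<^sub>R iexp (s * x)" for x :: real
    define f where "f x = (x powr (\<mu> - 1) * exp (- x)) *\<^sub>R ((\<mu> - (1 - \<i> * s) * x) * iexp (s * x))" for x :: real
    have "integrable ?M (\<lambda>x. \<mu> * iexp (s * x) - (1 - \<i> * s) * (complex_of_real x * iexp (s * x)))"
      using c0 c1 by simp
    then have intX: "integrable lborel (\<lambda>x. gamma_density \<mu> x *\<^sub>R (\<mu> * iexp (s * x) - (1 - \<i> * s) * (complex_of_real x * iexp (s * x))))"
      using nn by (subst (asm) integrable_density) auto
    then have "integrable lborel (\<lambda>x. Gamma \<mu> *\<^sub>R (gamma_density \<mu> x *\<^sub>R (\<mu> * iexp (s * x) - (1 - \<i> * s) * (complex_of_real x * iexp (s * x)))))"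
      by (rule integrable_scaleR_right)
    also have dens: "(\<lambda>x. Gamma \<mu> *\<^sub>R (gamma_density \<mu> x *\<^sub>R (\<mu> * iexp (s * x) - (1 - \<i> * s) * (complex_of_real x * iexp (s * x)))))
      = (\<lambda>x. indicator {0<..} x *\<^sub>R f x)"
      using Gp by (auto simp: fun_eq_iff gamma_density_def f_def indicator_def algebra_simps)
    finally have fint: "set_integrable lborel (einterval 0 \<infinity>) f"
      unfolding set_integrable_def by (simp add: einterval_def greaterThan_def)
    have "(LBINT x=0..\<infinity>. f x) = 0 - 0"
    proof (rule interval_integral_FTC_integrable[OF _ _ _ fint])
      fix x assume "0 < ereal x"
      then have x: "0 < x" by simp
      have "((\<lambda>x. x powr \<mu> * exp (- x)) has_field_derivative x powr (\<mu> - 1) * exp (- x) * (\<mu> - x)) (at x)"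
        using x by (auto intro!: derivative_eq_intros simp: powr_diff field_simps)
      then have "((\<lambda>x. x powr \<mu> * exp (- x)) has_vector_derivative x powr (\<mu> - 1) * exp (- x) * (\<mu> - x)) (at x)"
        by (simp add: has_real_derivative_iff_has_vector_derivative)
      moreover have "((\<lambda>x. iexp (s * x)) has_vector_derivative s *\<^sub>R (\<i> * iexp (s * x))) (at x)"
      proof -
        have "((*) s has_vector_derivative s) (at x)"
          by (auto intro!: derivative_eq_intros simp: has_real_derivative_iff_has_vector_derivative[symmetric])
        from vector_diff_chain_at[OF this has_vector_derivative_iexp] show ?thesis by (simp only: o_def)
      qed
      moreover have "x powr \<mu> = x powr (\<mu> - 1) * x" using x by (simp add: powr_diff)
      ultimately show "(F has_vector_derivative f x) (at x)"
        unfolding F_def[abs_def] f_def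
        using x by (auto intro!: derivative_eq_intros simp: has_real_derivative_iff_has_vector_derivative[symmetric] scaleR_conv_of_real algebra_simps)
      show "isCont f x" unfolding f_def using x by (auto intro!: continuous_intros)
    next
      have nF: "norm (F x) = x powr \<mu> * exp (- x)" for x by (simp add: F_def)
      have "(F \<longlongrightarrow> 0) (at_right 0)"
      proof (rule Lim_null_comparison)
        show "\<forall>\<^sub>F x in at_right 0. norm (F x) \<le> x powr \<mu> * exp (- x)" by (simp add: nF)
        show "((\<lambda>x. x powr \<mu> * exp (- x)) \<longlongrightarrow> 0) (at_right 0)" using \<mu> by real_asymp
      qed
      then show "((F \<circ> real_of_ereal) \<longlongrightarrow> 0) (at_right 0)"
        by (simp add: zero_ereal_def ereal_tendsto_simps)
      have "(F \<longlongrightarrow> 0) at_top"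
      proof (rule Lim_null_comparison)
        show "\<forall>\<^sub>F x in at_top. norm (F x) \<le> x powr \<mu> * exp (- x)" by (simp add: nF)
        show "((\<lambda>x. x powr \<mu> * exp (- x)) \<longlongrightarrow> 0) at_top" using \<mu> by real_asymp
      qed
      then show "((F \<circ> real_of_ereal) \<longlongrightarrow> 0) (at_left \<infinity>)"
        by (simp add: ereal_tendsto_simps)
    qed auto
    then have "(LINT x|lborel. indicator {0<..} x *\<^sub>R f x) = 0"
      by (simp add: interval_lebesgue_integral_def set_lebesgue_integral_def einterval_def greaterThan_def)
    then have "Gamma \<mu> *\<^sub>R (CLINT x|lborel. gamma_density \<mu> x *\<^sub>R (\<mu> * iexp (s * x) - (1 - \<i> * s) * (complex_of_real x * iexp (s * x)))) = 0"
      unfolding dens[symmetric] by (simp only: integral_scaleR_right intX)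
    then have "(CLINT x|?M. \<mu> * iexp (s * x) - (1 - \<i> * s) * (complex_of_real x * iexp (s * x))) = 0"
      using nn Gp by (subst integral_density) auto
    then have "\<mu> * char ?M s = (1 - \<i> * s) * (CLINT x|?M. complex_of_real x * iexp (s * x))"
      using c0 c1 by (simp add: char_def)
    moreover have "(CLINT x|?M. \<i> * x * iexp (s * x)) = \<i> * (CLINT x|?M. complex_of_real x * iexp (s * x))"
      using c1 by (simp add: mult.assoc)
    ultimately show ?thesis by (metis mult.assoc mult.left_commute)
  qed
  have "cmod ((1 - \<i> * t) powr of_real \<mu> * char ?M t - 1) \<le> (1 + \<bar>t\<bar>) powr \<mu> * 0 * \<bar>t\<bar>"
    by (rule gamma_equation_stability[OF \<mu> char_zero has_vector_derivative_char[OF mom1 mom]])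
       (simp only: eq, simp)
  then show ?thesis by simp
qed

text \<open>
  The exponential law is the gamma law with \<open>\<mu> = 1\<close>.
\<close>
lemma char_exponential_distribution:
  "(1 - \<i> * t) * char (density lborel (exponential_density 1)) t = 1"
proof -
  have eq: "density lborel (gamma_density 1) = density lborel (exponential_density 1)"
  proof (rule density_cong)
    have "AE x in lborel. x \<noteq> (0::real)" by (rule AE_lborel_singleton)
    then show "AE x in lborel. ennreal (gamma_density 1 x) = ennreal (exponential_density 1 x)"
      by eventually_elim (auto simp: gamma_density_def exponential_density_def)
  qed (auto simp: gamma_density_def[abs_def])
  have "prob_space (density lborel (exponential_density 1))"
    by (rule prob_space_exponential_density) simp
  moreover have "1 - \<i> * of_real t \<noteq> 0" for t :: real by (simp add: complex_eq_iff)
  ultimately show ?thesis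
    using char_gamma_distribution[of 1 t] unfolding eq by simp
qed

section \<open>Series, summability and power series\<close>

lemma (in prob_space) sums_expectation_nat:
  fixes f :: "nat \<Rightarrow> 'b::{banach, second_countable_topology}"
  assumes X[measurable]: "random_variable (count_space UNIV) X" and bdd: "\<And>k. norm (f k) \<le> B"
  shows "(\<lambda>k. prob {\<omega> \<in> space M. X \<omega> = k} *\<^sub>R f k) sums (\<integral>\<omega>. f (X \<omega>) \<partial>M)"
proof -
  let ?p = "\<lambda>k. prob {\<omega> \<in> space M. X \<omega> = k}"
  interpret X: prob_space "distr M (count_space UNIV) X" by (rule prob_space_distr) fact
  have law: "distr M (count_space UNIV) X = density (count_space UNIV) (\<lambda>k. ennreal (?p k))"
  proof (rule measure_eqI_countable[of _ UNIV])
    fix k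
    have "emeasure (distr M (count_space UNIV) X) {k} = emeasure M {\<omega> \<in> space M. X \<omega> = k}"
      by (subst emeasure_distr) (auto intro!: arg_cong2[where f = emeasure])
    then show "emeasure (distr M (count_space UNIV) X) {k} = emeasure (density (count_space UNIV) (\<lambda>k. ennreal (?p k))) {k}"
      by (simp add: emeasure_density emeasure_eq_measure)
  qed auto
  have "integrable (distr M (count_space UNIV) X) f"
    by (rule X.integrable_const_bound[of _ B]) (auto simp: bdd)
  then have "integrable (count_space UNIV) (\<lambda>k. ?p k *\<^sub>R f k)"
    unfolding law by (subst (asm) integrable_density) auto
  then have "(\<lambda>k. ?p k *\<^sub>R f k) sums (\<integral>k. ?p k *\<^sub>R f k \<partial>count_space UNIV)"
    by (rule sums_integral_count_space_nat)
  also have "(\<integral>k. ?p k *\<^sub>R f k \<partial>count_space UNIV) = (\<integral>k. f k \<partial>distr M (count_space UNIV) X)"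
    unfolding law by (subst integral_density) auto
  also have "\<dots> = (\<integral>\<omega>. f (X \<omega>) \<partial>M)" by (rule integral_distr) auto
  finally show ?thesis .
qed

lemma AE_summable_if_summable_nn_integral:
  assumes [measurable]: "\<And>n. f n \<in> borel_measurable M" and nn: "\<And>n \<omega>. 0 \<le> f n \<omega>"
    and c: "\<And>n. (\<integral>\<^sup>+ \<omega>. ennreal (f n \<omega>) \<partial>M) = ennreal (c n)" "\<And>n. 0 \<le> c n" "summable c"
  shows "AE \<omega> in M. summable (\<lambda>n. f n \<omega> :: real)"
proof -
  have "(\<integral>\<^sup>+ \<omega>. (\<Sum>n. ennreal (f n \<omega>)) \<partial>M) = (\<Sum>n. ennreal (c n))"
    by (subst nn_integral_suminf) (auto simp: c)
  moreover have "(\<Sum>n. ennreal (c n)) \<noteq> top"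
    using c by (intro ennreal_suminf_neq_top) auto
  ultimately have "AE \<omega> in M. (\<Sum>n. ennreal (f n \<omega>)) \<noteq> \<infinity>"
    by (intro nn_integral_PInf_AE) auto
  then show ?thesis by eventually_elim (intro summable_suminf_not_top, auto simp: nn)
qed

text \<open>
  Divide by \<open>x\<close> and let \<open>x\<close> tend to 0 to peel off one coefficient at a time.
\<close>
lemma powser_zero_imp_coeffs_zero:
  fixes a :: "nat \<Rightarrow> real"
  assumes "\<And>x. \<bar>x\<bar> < 1 \<Longrightarrow> (\<lambda>n. a n * x ^ n) sums 0"
  shows "a n = 0"
  using assms
proof (induction n arbitrary: a)
  case 0
  from 0[of 0] show ?case by simp
next
  case (Suc n)
  have a0: "a 0 = 0" using Suc.prems[of 0] by simp
  have nz: "(\<lambda>n. a (Suc n) * x ^ n) sums 0" if "\<bar>x\<bar> < 1" "x \<noteq> 0" for x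
  proof -
    have "(\<lambda>n. a (Suc n) * x ^ Suc n) sums 0"
      using Suc.prems[OF that(1)] a0 by (subst sums_Suc_iff) simp
    then have "(\<lambda>n. (a (Suc n) * x ^ Suc n) / x) sums (0 / x)" by (rule sums_divide)
    then show ?thesis using that by simp
  qed
  have "((\<lambda>_. 0) \<longlongrightarrow> a (Suc 0)) (at (0::real))"
    by (rule powser_limit_0_strong[where s = 1 and a = "\<lambda>n. a (Suc n)"]) (auto intro: nz)
  then have "a (Suc 0) = 0" by (simp add: tendsto_const_iff)
  then have "(\<lambda>n. a (Suc n) * x ^ n) sums 0" if "\<bar>x\<bar> < 1" for x
    using nz[OF that] by (cases "x = 0") auto
  from Suc.IH[OF this] show ?case .
qed

section \<open>The weighted series of exponential variables\<close>

lemma (in prob_space) exponential_series_summable: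
  assumes q: "0 < q" "q < 1" and \<epsilon>: "iid_std_exponential \<epsilon>"
  shows "AE \<omega> in M. summable (\<lambda>n. q ^ n * \<epsilon> n \<omega>)"
proof -
  have d: "distributed M lborel (\<epsilon> n) (exponential_density 1)" for n
    using \<epsilon> by (simp add: iid_std_exponential_def)
  have [measurable]: "\<epsilon> n \<in> borel_measurable M" for n
    using d[of n] by (auto simp: distributed_def)
  define c where "c = (\<integral>\<^sup>+ x. ennreal (exponential_density 1 x) * ennreal \<bar>x\<bar> \<partial>lborel)"
  have c: "(\<integral>\<^sup>+ \<omega>. ennreal \<bar>\<epsilon> n \<omega>\<bar> \<partial>M) = c" for n
    unfolding c_def by (subst distributed_nn_integral[OF d]) auto
  have "integrable M (\<lambda>\<omega>. \<epsilon> 0 \<omega> ^ 1)"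
    by (rule erlang_ith_moment_integrable[OF _ d]) simp
  then have "c < \<infinity>" unfolding c[of 0, symmetric] integrable_iff_bounded by simp
  then obtain r where r: "c = ennreal r" "0 \<le> r" by (cases c) auto
  have "AE \<omega> in M. summable (\<lambda>n. \<bar>q ^ n * \<epsilon> n \<omega>\<bar>)"
  proof (rule AE_summable_if_summable_nn_integral)
    show "(\<integral>\<^sup>+ \<omega>. ennreal \<bar>q ^ n * \<epsilon> n \<omega>\<bar> \<partial>M) = ennreal (q ^ n * r)" for n
      using q r by (simp add: abs_mult ennreal_mult nn_integral_cmult c)
  qed (use q r in \<open>auto intro!: summable_mult2 summable_geometric\<close>)
  then show ?thesis by eventually_elim (rule summable_rabs_cancel)
qed

lemma (in prob_space) I_q_measurable:
  assumes "iid_std_exponential \<epsilon>"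
  shows "random_variable borel (I_q q \<epsilon>)"
proof -
  have [measurable]: "\<epsilon> n \<in> borel_measurable M" for n
    using assms by (auto simp: iid_std_exponential_def distributed_def)
  show ?thesis unfolding I_q_def[abs_def] by measurable
qed

text \<open>
  The partial sums have independent summands, and they converge almost surely.
\<close>
lemma (in prob_space) char_I_q_product:
  assumes q: "0 < q" "q < 1" and \<epsilon>: "iid_std_exponential \<epsilon>"
  shows "(\<lambda>n. \<Prod>k<n. 1 / (1 - \<i> * of_real (q ^ k * t))) \<longlonglongrightarrow> char (distr M borel (I_q q \<epsilon>)) t"
proof -
  have d: "distributed M lborel (\<epsilon> n) (exponential_density 1)" for n
    using \<epsilon> by (simp add: iid_std_exponential_def)
  have [measurable]: "\<epsilon> n \<in> borel_measurable M" for n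
    using d[of n] by (auto simp: distributed_def)
  have [measurable]: "random_variable borel (I_q q \<epsilon>)" by (rule I_q_measurable) fact
  have ne: "1 - \<i> * of_real s \<noteq> 0" for s :: real by (simp add: complex_eq_iff)
  have 1: "char (distr M borel (\<lambda>\<omega>. q ^ k * \<epsilon> k \<omega>)) t = 1 / (1 - \<i> * of_real (q ^ k * t))" for k
  proof -
    have "char (distr M borel (\<lambda>\<omega>. q ^ k * \<epsilon> k \<omega>)) t = (CLINT \<omega>|M. iexp (t * (q ^ k * \<epsilon> k \<omega>)))"
      unfolding char_def by (rule integral_distr) auto
    also have "\<dots> = (CLINT \<omega>|M. iexp ((q ^ k * t) * \<epsilon> k \<omega>))"
      by (simp only: mult.assoc mult.left_commute)
    also have "\<dots> = char (distr M lborel (\<epsilon> k)) (q ^ k * t)"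
      unfolding char_def by (rule integral_distr[symmetric]) auto
    also have "\<dots> = char (density lborel (exponential_density 1)) (q ^ k * t)"
      using d[of k] by (simp add: distributed_def)
    finally show ?thesis
      using char_exponential_distribution[of "q ^ k * t"] ne by (simp add: field_simps)
  qed
  have "indep_vars (\<lambda>_. borel) (\<lambda>k \<omega>. q ^ k * \<epsilon> k \<omega>) {..<n}" for n
  proof -
    have "indep_vars (\<lambda>_. borel) \<epsilon> {..<n}"
      using \<epsilon> by (auto simp: iid_std_exponential_def intro: indep_vars_subset)
    then show ?thesis by (rule indep_vars_compose2) auto
  qed
  moreover have eq: "char (distr M borel (\<lambda>\<omega>. \<Sum>k<n. q ^ k * \<epsilon> k \<omega>)) t
      = (CLINT \<omega>|M. iexp (t * (\<Sum>k<n. q ^ k * \<epsilon> k \<omega>)))" for n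
    unfolding char_def by (rule integral_distr) auto
  ultimately have 2: "(CLINT \<omega>|M. iexp (t * (\<Sum>k<n. q ^ k * \<epsilon> k \<omega>))) = (\<Prod>k<n. 1 / (1 - \<i> * of_real (q ^ k * t)))" for n
    using char_distr_sum[of "\<lambda>k \<omega>. q ^ k * \<epsilon> k \<omega>" "{..<n}" t]
    unfolding 1 by (simp only: eq)
  have "(\<lambda>n. CLINT \<omega>|M. iexp (t * (\<Sum>k<n. q ^ k * \<epsilon> k \<omega>))) \<longlonglongrightarrow> (CLINT \<omega>|M. iexp (t * I_q q \<epsilon> \<omega>))"
  proof (rule integral_dominated_convergence[where w = "\<lambda>_. 1"])
    from exponential_series_summable[OF q \<epsilon>]
    show "AE \<omega> in M. (\<lambda>n. iexp (t * (\<Sum>k<n. q ^ k * \<epsilon> k \<omega>))) \<longlonglongrightarrow> iexp (t * I_q q \<epsilon> \<omega>)"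
    proof eventually_elim
      fix \<omega> assume "summable (\<lambda>n. q ^ n * \<epsilon> n \<omega>)"
      then have "(\<lambda>n. \<Sum>k<n. q ^ k * \<epsilon> k \<omega>) \<longlonglongrightarrow> I_q q \<epsilon> \<omega>"
        unfolding I_q_def by (rule summable_LIMSEQ)
      then show "(\<lambda>n. iexp (t * (\<Sum>k<n. q ^ k * \<epsilon> k \<omega>))) \<longlonglongrightarrow> iexp (t * I_q q \<epsilon> \<omega>)"
        by (intro tendsto_intros)
    qed
  qed auto
  also have "(CLINT \<omega>|M. iexp (t * I_q q \<epsilon> \<omega>)) = char (distr M borel (I_q q \<epsilon>)) t"
    unfolding char_def by (rule integral_distr[symmetric]) auto
  finally show ?thesis unfolding 2 .
qed

text \<open>
  Replacing \<open>t\<close> by \<open>q t\<close> deletes the first factor of the product.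
\<close>
lemma (in prob_space) char_I_q_equation:
  assumes q: "0 < q" "q < 1" and \<epsilon>: "iid_std_exponential \<epsilon>"
  shows "(1 - \<i> * of_real t) * char (distr M borel (I_q q \<epsilon>)) t = char (distr M borel (I_q q \<epsilon>)) (q * t)"
proof (rule LIMSEQ_unique)
  let ?f = "\<lambda>s n. \<Prod>k<n. 1 / (1 - \<i> * of_real (q ^ k * s))"
  have ne: "1 - \<i> * of_real s \<noteq> 0" for s :: real by (simp add: complex_eq_iff)
  have "?f (q * t) n = (1 - \<i> * of_real t) * ?f t (Suc n)" for n
    using ne[of t] by (subst prod.lessThan_Suc_shift) (simp add: mult_ac)
  with char_I_q_product[OF q \<epsilon>, of "q * t"]
  show "(\<lambda>n. (1 - \<i> * of_real t) * ?f t (Suc n)) \<longlonglongrightarrow> char (distr M borel (I_q q \<epsilon>)) (q * t)" by simp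
  show "(\<lambda>n. (1 - \<i> * of_real t) * ?f t (Suc n)) \<longlonglongrightarrow> (1 - \<i> * of_real t) * char (distr M borel (I_q q \<epsilon>)) t"
    by (intro tendsto_mult tendsto_const LIMSEQ_Suc char_I_q_product[OF q \<epsilon>])
qed

text \<open>
  A quantitative law of large numbers for \<open>(1 - q) I_q\<close>: compare the product factor by factor with
  \<open>exp(\<i> s)\<close>, where \<open>s = q^k (1 - q) t\<close>; the errors are of order \<open>s\<^sup>2\<close> and sum up to order \<open>1 - q\<close>.
\<close>
lemma (in prob_space) char_I_q_near_iexp:
  assumes q: "0 < q" "q < 1" and \<epsilon>: "iid_std_exponential \<epsilon>"
  shows "cmod (char (distr M borel (I_q q \<epsilon>)) ((1 - q) * t) - iexp t) \<le> 2 * t\<^sup>2 * (1 - q)"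
proof -
  have factor: "cmod (1 / (1 - \<i> * of_real s) - iexp s) \<le> 2 * s\<^sup>2" for s :: real
  proof -
    have ne: "1 - \<i> * of_real s \<noteq> 0" by (simp add: complex_eq_iff)
    have ge: "1 \<le> cmod (1 - \<i> * of_real s)" using abs_Re_le_cmod[of "1 - \<i> * of_real s"] by simp
    have "1 / (1 - \<i> * of_real s) - iexp s
        = - (of_real s)\<^sup>2 / (1 - \<i> * of_real s) - (iexp s - (\<Sum>k\<le>1. (\<i> * s) ^ k / fact k))"
      using ne by (simp add: field_simps power2_eq_square)
    also have "cmod \<dots> \<le> cmod (- (of_real s)\<^sup>2 / (1 - \<i> * of_real s)) + cmod (iexp s - (\<Sum>k\<le>1. (\<i> * s) ^ k / fact k))"
      by (rule norm_triangle_ineq4)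
    also have "\<dots> \<le> s\<^sup>2 + \<bar>s\<bar> ^ Suc 1 / fact (Suc 1)"
    proof (intro add_mono iexp_approx1)
      show "cmod (- (of_real s)\<^sup>2 / (1 - \<i> * of_real s)) \<le> s\<^sup>2"
        using ge mult_left_mono[OF ge, of "s\<^sup>2"] by (simp add: norm_divide norm_power divide_le_eq)
    qed
    also have "\<dots> \<le> 2 * s\<^sup>2" by (simp add: power2_eq_square)
    finally show ?thesis .
  qed
  let ?s = "\<lambda>k. q ^ k * ((1 - q) * t)"
  let ?w = "\<lambda>n. \<Prod>k<n. iexp (?s k)"
  have w: "?w n = iexp ((1 - q ^ n) * t)" for n
  proof -
    have "(\<Sum>k<n. ?s k) = (1 - q ^ n) * t"
      unfolding sum_distrib_right[symmetric] using one_diff_power_eq[of q n] by simp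
    moreover have "?w n = iexp (\<Sum>k<n. ?s k)"
      by (simp add: exp_sum sum_distrib_left)
    ultimately show ?thesis by simp
  qed
  have "(\<lambda>n. iexp ((1 - q ^ n) * t)) \<longlonglongrightarrow> iexp ((1 - 0) * t)"
    by (intro tendsto_intros) (use q in auto)
  then have "?w \<longlonglongrightarrow> iexp t" unfolding w by simp
  with char_I_q_product[OF q \<epsilon>, of "(1 - q) * t"]
  have "(\<lambda>n. cmod ((\<Prod>k<n. 1 / (1 - \<i> * of_real (?s k))) - ?w n))
      \<longlonglongrightarrow> cmod (char (distr M borel (I_q q \<epsilon>)) ((1 - q) * t) - iexp t)"
    by (intro tendsto_intros)
  then show ?thesis
  proof (rule LIMSEQ_le_const2, intro exI allI impI)
    fix n :: nat
    have "cmod ((\<Prod>k<n. 1 / (1 - \<i> * of_real (?s k))) - ?w n) \<le> (\<Sum>k<n. cmod (1 / (1 - \<i> * of_real (?s k)) - iexp (?s k)))"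
    proof (rule norm_prod_diff)
      show "cmod (1 / (1 - \<i> * of_real (?s k))) \<le> 1" for k
        using abs_Re_le_cmod[of "1 - \<i> * of_real (?s k)"] by (simp add: norm_divide divide_le_eq)
    qed simp
    also have "\<dots> \<le> (\<Sum>k<n. 2 * (?s k)\<^sup>2)" by (intro sum_mono factor)
    also have "\<dots> \<le> (\<Sum>k<n. 2 * ((1 - q)\<^sup>2 * t\<^sup>2 * q ^ k))"
    proof (intro sum_mono mult_left_mono)
      fix k
      have "q ^ k * q ^ k \<le> 1 * q ^ k" using q by (intro mult_right_mono power_le_one) auto
      then have "(1 - q)\<^sup>2 * t\<^sup>2 * (q ^ k * q ^ k) \<le> (1 - q)\<^sup>2 * t\<^sup>2 * q ^ k"
        by (intro mult_left_mono) auto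
      then show "(?s k)\<^sup>2 \<le> (1 - q)\<^sup>2 * t\<^sup>2 * q ^ k" by (simp add: power2_eq_square mult_ac)
    qed simp
    also have "\<dots> = 2 * t\<^sup>2 * (1 - q) * ((1 - q) * (\<Sum>k<n. q ^ k))"
      unfolding sum_distrib_left by (intro sum.cong) (auto simp: power2_eq_square algebra_simps)
    also have "(1 - q) * (\<Sum>k<n. q ^ k) = 1 - q ^ n" using one_diff_power_eq[of q n] by simp
    also have "2 * t\<^sup>2 * (1 - q) * (1 - q ^ n) \<le> 2 * t\<^sup>2 * (1 - q) * 1"
      using q by (intro mult_left_mono) auto
    finally show "cmod ((\<Prod>k<n. 1 / (1 - \<i> * of_real (?s k))) - ?w n) \<le> 2 * t\<^sup>2 * (1 - q)" by simp
  qed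
qed

section \<open>The series of geometric variables\<close>

lemma summable_nat_iff_eventually_zero:
  fixes g :: "nat \<Rightarrow> nat"
  shows "summable g \<longleftrightarrow> (\<exists>N. \<forall>n\<ge>N. g n = 0)"
proof
  assume "summable g"
  then have "(\<lambda>n. \<Sum>i<n. g i) \<longlonglongrightarrow> suminf g" by (rule summable_LIMSEQ)
  then have "\<forall>\<^sub>F n in sequentially. (\<Sum>i<n. g i) = suminf g" by (simp add: tendsto_discrete)
  then obtain N where N: "\<And>n. N \<le> n \<Longrightarrow> (\<Sum>i<n. g i) = suminf g" by (auto simp: eventually_sequentially)
  have "g n = 0" if "N \<le> n" for n using N[of n] N[of "Suc n"] that by simp
  then show "\<exists>N. \<forall>n\<ge>N. g n = 0" by blast
next
  assume "\<exists>N. \<forall>n\<ge>N. g n = 0"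
  then obtain N where "\<And>n. N \<le> n \<Longrightarrow> g n = 0" by blast
  then show "summable g" by (intro summable_finite[of "{..<N}"]) auto
qed

text \<open>
  Convergence in the discrete space \<open>nat\<close> means that the partial sums are eventually constant, which
  is a countable condition on the terms; all divergent series share one default value.
\<close>
lemma measurable_suminf_nat:
  fixes G :: "nat \<Rightarrow> 'a \<Rightarrow> nat"
  assumes [measurable]: "\<And>n. G n \<in> measurable M (count_space UNIV)"
  shows "(\<lambda>\<omega>. \<Sum>n. G n \<omega>) \<in> measurable M (count_space UNIV)"
proof -
  \<comment> \<open>The value that \<open>suminf\<close> takes at every divergent series.\<close>
  define c where "c = (THE s :: nat. False)"
  define p where "p k \<omega> \<longleftrightarrow> ((\<exists>N. \<forall>n\<ge>N. G n \<omega> = 0) \<and> (\<exists>N. \<forall>n\<ge>N. (\<Sum>i<n. G i \<omega>) = k)) \<or>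
     (\<not> (\<exists>N. \<forall>n\<ge>N. G n \<omega> = 0) \<and> k = c)" for k \<omega>
  have "(\<Sum>n. G n \<omega>) = k \<longleftrightarrow> p k \<omega>" for k \<omega>
  proof (cases "summable (\<lambda>n. G n \<omega>)")
    case True
    then have "(\<lambda>n. \<Sum>i<n. G i \<omega>) \<longlonglongrightarrow> (\<Sum>n. G n \<omega>)" by (rule summable_LIMSEQ)
    then have "\<forall>\<^sub>F n in sequentially. (\<Sum>i<n. G i \<omega>) = (\<Sum>n. G n \<omega>)" by (simp add: tendsto_discrete)
    then obtain N where N: "\<And>n. N \<le> n \<Longrightarrow> (\<Sum>i<n. G i \<omega>) = (\<Sum>n. G n \<omega>)" by (auto simp: eventually_sequentially)
    have "(\<Sum>n. G n \<omega>) = k \<longleftrightarrow> (\<exists>N. \<forall>n\<ge>N. (\<Sum>i<n. G i \<omega>) = k)"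
      using N by (metis le_cases)
    with True show ?thesis by (simp add: p_def summable_nat_iff_eventually_zero)
  next
    case False
    then have "(\<Sum>n. G n \<omega>) = c" by (simp add: suminf_def c_def summable_def)
    moreover have "\<not> (\<exists>N. \<forall>n\<ge>N. G n \<omega> = 0)"
      using False summable_nat_iff_eventually_zero by blast
    ultimately show ?thesis unfolding p_def by metis
  qed
  moreover have "Measurable.pred M (p k)" for k
    unfolding p_def by measurable
  ultimately have "(\<lambda>\<omega>. \<Sum>n. G n \<omega>) -` {k} \<inter> space M \<in> sets M" for k
    by (simp add: vimage_def Int_def conj_commute pred_def)
  then show ?thesis by (simp add: measurable_count_space_eq2_countable)
qed

text \<open>
  Borel-Cantelli: the probabilities \<open>P(G n \<noteq> 0) = a q^n\<close> are summable.
\<close>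
lemma (in prob_space) geometric_series_summable:
  assumes q: "0 < q" "q < 1" and a: "0 \<le> a" "a < 1" and G: "indep_geometric_seq q a G"
  shows "AE \<omega> in M. summable (\<lambda>n. G n \<omega>)"
proof -
  have [measurable]: "random_variable (count_space UNIV) (G n)" for n
    using G by (auto simp: indep_geometric_seq_def indep_vars_def)
  have aq: "0 \<le> a * q ^ n" "a * q ^ n < 1" for n
    using q a mult_right_le_one_le[of a "q ^ n"] power_le_one[of q n] by (auto intro: le_less_trans)
  have "prob {\<omega> \<in> space M. G n \<omega> \<noteq> 0} = a * q ^ n" for n
  proof -
    have "prob {\<omega> \<in> space M. G n \<omega> = 0} = measure (distr M (count_space UNIV) (G n)) {0}"
      by (subst measure_distr) (auto intro!: arg_cong[where f = prob])
    also have "\<dots> = pmf (geometric_pmf (1 - a * q ^ n)) 0"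
      using G by (simp add: indep_geometric_seq_def measure_pmf_single)
    also have "\<dots> = 1 - a * q ^ n" using aq[of n] by simp
    finally show ?thesis by (subst prob_neg) auto
  qed
  then have "AE \<omega> in M. eventually (\<lambda>n. \<omega> \<in> space M - {\<omega> \<in> space M. G n \<omega> \<noteq> 0}) sequentially"
    using q by (intro borel_cantelli_AE1) (auto simp: less_top[symmetric] summable_mult summable_geometric)
  then show ?thesis
  proof eventually_elim
    fix \<omega> assume "eventually (\<lambda>n. \<omega> \<in> space M - {\<omega> \<in> space M. G n \<omega> \<noteq> 0}) sequentially"
    then show "summable (\<lambda>n. G n \<omega>)"
      by (auto simp: summable_nat_iff_eventually_zero eventually_sequentially)
  qed
qed

lemma (in prob_space) geometric_series_pgf:
  assumes q: "0 < q" "q < 1" and a: "0 \<le> a" "a < 1" and G: "indep_geometric_seq q a G"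
    and x: "\<bar>x\<bar> \<le> 1"
  shows "(\<lambda>n. \<Prod>k<n. (1 - a * q ^ k) / (1 - a * q ^ k * x)) \<longlonglongrightarrow> expectation (\<lambda>\<omega>. x ^ (\<Sum>n. G n \<omega>))"
proof -
  have Gm[measurable]: "random_variable (count_space UNIV) (G n)" for n
    using G by (auto simp: indep_geometric_seq_def indep_vars_def)
  have aq: "0 \<le> a * q ^ n" "a * q ^ n < 1" for n
    using q a mult_right_le_one_le[of a "q ^ n"] power_le_one[of q n] by (auto intro: le_less_trans)
  have px: "\<bar>x ^ k\<bar> \<le> 1" for k using x by (simp add: power_abs power_le_one)
  have 1: "expectation (\<lambda>\<omega>. x ^ G k \<omega>) = (1 - a * q ^ k) / (1 - a * q ^ k * x)" for k
  proof (rule sums_unique2)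
    have "prob {\<omega> \<in> space M. G k \<omega> = j} = (a * q ^ k) ^ j * (1 - a * q ^ k)" for j
    proof -
      have "prob {\<omega> \<in> space M. G k \<omega> = j} = measure (distr M (count_space UNIV) (G k)) {j}"
        by (subst measure_distr) (auto intro!: arg_cong[where f = prob])
      also have "\<dots> = pmf (geometric_pmf (1 - a * q ^ k)) j"
        using G by (simp add: indep_geometric_seq_def measure_pmf_single)
      also have "\<dots> = (a * q ^ k) ^ j * (1 - a * q ^ k)" using aq[of k] by simp
      finally show ?thesis .
    qed
    then show "(\<lambda>j. (1 - a * q ^ k) * (a * q ^ k * x) ^ j) sums expectation (\<lambda>\<omega>. x ^ G k \<omega>)"
      using sums_expectation_nat[OF Gm, of "\<lambda>j. x ^ j" 1 k] px by (simp add: power_mult_distrib mult_ac)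
    have "\<bar>a * q ^ k * x\<bar> \<le> a * q ^ k * 1" unfolding abs_mult[of "a * q ^ k"]
      using x aq[of k] by (intro mult_mono) auto
    then have "norm (a * q ^ k * x) < 1" using aq(2)[of k] by simp
    from sums_mult[OF geometric_sums[OF this], of "1 - a * q ^ k"]
    show "(\<lambda>j. (1 - a * q ^ k) * (a * q ^ k * x) ^ j) sums ((1 - a * q ^ k) / (1 - a * q ^ k * x))" by simp
  qed
  have 2: "expectation (\<lambda>\<omega>. x ^ (\<Sum>k<n. G k \<omega>)) = (\<Prod>k<n. (1 - a * q ^ k) / (1 - a * q ^ k * x))" for n
  proof -
    have "indep_vars (\<lambda>_. count_space UNIV) G {..<n}"
      using G by (auto simp: indep_geometric_seq_def intro: indep_vars_subset)
    then have "indep_vars (\<lambda>_. borel) (\<lambda>k \<omega>. x ^ G k \<omega>) {..<n}"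
      by (rule indep_vars_compose2) auto
    then have "expectation (\<lambda>\<omega>. \<Prod>k<n. x ^ G k \<omega>) = (\<Prod>k<n. expectation (\<lambda>\<omega>. x ^ G k \<omega>))"
      by (intro indep_vars_lebesgue_integral integrable_const_bound[of _ 1]) (auto simp: px)
    then show ?thesis unfolding 1 by (simp add: power_sum)
  qed
  have "(\<lambda>n. expectation (\<lambda>\<omega>. x ^ (\<Sum>k<n. G k \<omega>))) \<longlonglongrightarrow> expectation (\<lambda>\<omega>. x ^ (\<Sum>n. G n \<omega>))"
  proof (rule integral_dominated_convergence[where w = "\<lambda>_. 1"])
    from geometric_series_summable[OF q a G]
    show "AE \<omega> in M. (\<lambda>n. x ^ (\<Sum>k<n. G k \<omega>)) \<longlonglongrightarrow> x ^ (\<Sum>n. G n \<omega>)"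
    proof eventually_elim
      fix \<omega> assume "summable (\<lambda>n. G n \<omega>)"
      then have "(\<lambda>n. \<Sum>k<n. G k \<omega>) \<longlonglongrightarrow> (\<Sum>n. G n \<omega>)" by (rule summable_LIMSEQ)
      then have "\<forall>\<^sub>F n in sequentially. (\<Sum>k<n. G k \<omega>) = (\<Sum>n. G n \<omega>)" by (simp add: tendsto_discrete)
      then have "\<forall>\<^sub>F n in sequentially. x ^ (\<Sum>k<n. G k \<omega>) = x ^ (\<Sum>n. G n \<omega>)"
        by eventually_elim simp
      then show "(\<lambda>n. x ^ (\<Sum>k<n. G k \<omega>)) \<longlonglongrightarrow> x ^ (\<Sum>n. G n \<omega>)" by (rule tendsto_eventually)
    qed
    show "(\<lambda>\<omega>. x ^ (\<Sum>n. G n \<omega>)) \<in> borel_measurable M"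
      using measurable_suminf_nat[OF Gm] by (rule measurable_compose) simp
  qed (auto simp: px)
  then show ?thesis unfolding 2 .
qed

text \<open>
  With \<open>S\<close> the sum of the series, \<open>E[(1 - q^S) f(S)] = a E[f(S + 1)]\<close>. The product formula for the
  generating function \<open>P\<close> gives \<open>P(q x) = (1 - a x) P(x)\<close>, by telescoping; comparing coefficients gives
  \<open>(1 - q^(k+1)) P(S = k + 1) = a P(S = k)\<close>, and the claim is the sum of these relations against \<open>f\<close>.
\<close>
lemma (in prob_space) geometric_series_size_bias:
  fixes f :: "nat \<Rightarrow> 'b::{banach, second_countable_topology}"
  assumes q: "0 < q" "q < 1" and a: "0 \<le> a" "a < 1" and G: "indep_geometric_seq q a G"
    and bdd: "\<And>k. norm (f k) \<le> B"
  shows "(\<integral>\<omega>. (1 - q ^ (\<Sum>n. G n \<omega>)) *\<^sub>R f (\<Sum>n. G n \<omega>) \<partial>M) = a *\<^sub>R (\<integral>\<omega>. f (Suc (\<Sum>n. G n \<omega>)) \<partial>M)"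
proof -
  define S where "S \<omega> = (\<Sum>n. G n \<omega>)" for \<omega>
  define p where "p k = prob {\<omega> \<in> space M. S \<omega> = k}" for k
  have S[measurable]: "random_variable (count_space UNIV) S"
    unfolding S_def[abs_def] using G
    by (intro measurable_suminf_nat) (auto simp: indep_geometric_seq_def indep_vars_def)
  have pgf: "(\<lambda>k. p k * x ^ k) sums expectation (\<lambda>\<omega>. x ^ S \<omega>)" if "\<bar>x\<bar> \<le> 1" for x :: real
    using sums_expectation_nat[OF S, of "\<lambda>k. x ^ k" 1] that
    by (simp add: p_def power_abs power_le_one)
  have eq: "expectation (\<lambda>\<omega>. (q * x) ^ S \<omega>) = (1 - a * x) * expectation (\<lambda>\<omega>. x ^ S \<omega>)" if x: "\<bar>x\<bar> < 1" for x
  proof (rule LIMSEQ_unique)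
    let ?P = "\<lambda>x n. \<Prod>k<n. (1 - a * q ^ k) / (1 - a * q ^ k * x)"
    have qx: "\<bar>q * x\<bar> \<le> 1" using x q by (simp add: abs_mult mult_le_one)
    have ne: "1 - a * q ^ k * x \<noteq> 0" for k
    proof -
      have "\<bar>a * q ^ k * x\<bar> \<le> 1 * 1 * \<bar>x\<bar>" unfolding abs_mult
        using a q by (intro mult_mono) (auto simp: power_le_one)
      then show ?thesis using x by auto
    qed
    have "(1 - a * q ^ n * x) * ?P (q * x) n = (1 - a * x) * ?P x n" for n
    proof (induction n)
      case (Suc n)
      have "(1 - a * q ^ Suc n * x) * ?P (q * x) (Suc n) = (1 - a * q ^ n) * ?P (q * x) n"
        using ne[of "Suc n"] by (simp add: field_simps)
      also have "\<dots> = (1 - a * q ^ n) / (1 - a * q ^ n * x) * ((1 - a * q ^ n * x) * ?P (q * x) n)"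
        using ne[of n] by simp
      also have "\<dots> = (1 - a * x) * ?P x (Suc n)" unfolding Suc.IH by simp
      finally show ?case .
    qed simp
    moreover have "(\<lambda>n. (1 - a * x) * ?P x n) \<longlonglongrightarrow> (1 - a * x) * expectation (\<lambda>\<omega>. x ^ S \<omega>)"
      unfolding S_def using x by (intro tendsto_mult tendsto_const geometric_series_pgf[OF q a G]) auto
    ultimately show "(\<lambda>n. (1 - a * q ^ n * x) * ?P (q * x) n) \<longlonglongrightarrow> (1 - a * x) * expectation (\<lambda>\<omega>. x ^ S \<omega>)"
      by simp
    have "(\<lambda>n. (1 - a * q ^ n * x) * ?P (q * x) n) \<longlonglongrightarrow> (1 - a * 0 * x) * expectation (\<lambda>\<omega>. (q * x) ^ S \<omega>)"
      unfolding S_def using q geometric_series_pgf[OF q a G qx] by (intro tendsto_intros) auto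
    then show "(\<lambda>n. (1 - a * q ^ n * x) * ?P (q * x) n) \<longlonglongrightarrow> expectation (\<lambda>\<omega>. (q * x) ^ S \<omega>)" by simp
  qed
  \<comment> \<open>The coefficients of \<open>P(x) - P(q x) - a x P(x)\<close>, where \<open>P\<close> is the generating function.\<close>
  define r where "r k = (1 - q ^ k) * p k - (if k = 0 then 0 else a * p (k - 1))" for k
  have "(\<lambda>k. r k * x ^ k) sums 0" if x: "\<bar>x\<bar> < 1" for x
  proof -
    have "(\<lambda>k. (if Suc k = 0 then 0 else a * p (Suc k - 1)) * x ^ Suc k) sums (a * x * expectation (\<lambda>\<omega>. x ^ S \<omega>))"
      using sums_mult[OF pgf, of x "a * x"] x by (simp add: mult_ac)
    then have sh: "(\<lambda>k. (if k = 0 then 0 else a * p (k - 1)) * x ^ k) sums (a * x * expectation (\<lambda>\<omega>. x ^ S \<omega>))"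
      by (subst (asm) sums_Suc_iff) simp
    have "\<bar>q * x\<bar> \<le> 1" using x q by (simp add: abs_mult mult_le_one)
    then have "(\<lambda>k. p k * x ^ k - p k * (q * x) ^ k - (if k = 0 then 0 else a * p (k - 1)) * x ^ k) sums
      (expectation (\<lambda>\<omega>. x ^ S \<omega>) - expectation (\<lambda>\<omega>. (q * x) ^ S \<omega>) - a * x * expectation (\<lambda>\<omega>. x ^ S \<omega>))"
      using x by (intro sums_diff pgf sh) auto
    moreover have "expectation (\<lambda>\<omega>. x ^ S \<omega>) - expectation (\<lambda>\<omega>. (q * x) ^ S \<omega>) - a * x * expectation (\<lambda>\<omega>. x ^ S \<omega>) = 0"
      unfolding eq[OF x] by (simp add: algebra_simps)
    moreover have "(\<lambda>k. p k * x ^ k - p k * (q * x) ^ k - (if k = 0 then 0 else a * p (k - 1)) * x ^ k) = (\<lambda>k. r k * x ^ k)"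
      by (auto simp: r_def fun_eq_iff algebra_simps power_mult_distrib)
    ultimately show ?thesis by simp
  qed
  then have "r k = 0" for k by (rule powser_zero_imp_coeffs_zero)
  then have rec: "(1 - q ^ Suc k) * p (Suc k) = a * p k" for k using r_def[of "Suc k"] by simp
  have bdd1: "norm ((1 - q ^ k) *\<^sub>R f k) \<le> B" for k
  proof -
    have "norm ((1 - q ^ k) *\<^sub>R f k) \<le> 1 * B"
      unfolding norm_scaleR using q bdd[of k] by (intro mult_mono) (auto simp: power_le_one)
    then show ?thesis by simp
  qed
  have "(\<lambda>k. p k *\<^sub>R (1 - q ^ k) *\<^sub>R f k) sums (\<integral>\<omega>. (1 - q ^ S \<omega>) *\<^sub>R f (S \<omega>) \<partial>M)"
    unfolding p_def by (rule sums_expectation_nat[OF S bdd1])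
  then have "(\<lambda>k. p (Suc k) *\<^sub>R (1 - q ^ Suc k) *\<^sub>R f (Suc k)) sums (\<integral>\<omega>. (1 - q ^ S \<omega>) *\<^sub>R f (S \<omega>) \<partial>M)"
    by (subst sums_Suc_iff) simp
  moreover have "p (Suc k) *\<^sub>R (1 - q ^ Suc k) *\<^sub>R f (Suc k) = a *\<^sub>R (p k *\<^sub>R f (Suc k))" for k
    using rec[of k] by (simp add: mult.commute)
  ultimately have "(\<lambda>k. a *\<^sub>R (p k *\<^sub>R f (Suc k))) sums (\<integral>\<omega>. (1 - q ^ S \<omega>) *\<^sub>R f (S \<omega>) \<partial>M)"
    by (simp only:)
  moreover have "(\<lambda>k. a *\<^sub>R (p k *\<^sub>R f (Suc k))) sums (a *\<^sub>R (\<integral>\<omega>. f (Suc (S \<omega>)) \<partial>M))"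
    unfolding p_def by (intro sums_scaleR_right sums_expectation_nat[OF S, of "\<lambda>k. f (Suc k)" B, OF bdd])
  ultimately show ?thesis unfolding S_def[symmetric] by (rule sums_unique2)
qed

section \<open>The quotient solves the q-difference equation\<close>

text \<open>
  Conditioning on \<open>S\<close> gives \<open>\<phi> s = E[\<psi>(s / q^S)]\<close> with \<open>\<psi>\<close> the characteristic function of \<open>I_q\<close>. Put
  \<open>c k = \<psi>(t / q^k)\<close> and \<open>c' k = \<psi>(q t / q^k)\<close>, so that \<open>c' (k + 1) = c k\<close>. Then \<open>\<phi> t\<close>, \<open>\<phi> (q t)\<close> and \<open>\<phi> (t / q)\<close> are the expectations of
  \<open>c S\<close>, \<open>c' S\<close> and \<open>c (S + 1)\<close>. The size-bias identity for \<open>c\<close> and for \<open>c'\<close> removes the shifts from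
  \<open>a c (S + 1)\<close> and \<open>a c S\<close>, and what remains vanishes pointwise by the equation of \<open>\<psi>\<close>.
\<close>
lemma (in prob_space) char_quotient_equation:
  assumes q: "0 < q" "q < 1" and a: "0 \<le> a" "a < 1" and \<epsilon>: "iid_std_exponential \<epsilon>"
    and G: "indep_geometric_seq q a G"
    and ind: "indep_var borel (I_q q \<epsilon>) borel (q_gamma q G)"
  defines "\<phi> \<equiv> char (distr M borel (\<lambda>\<omega>. q powi (- int (\<Sum>n. G n \<omega>)) * I_q q \<epsilon> \<omega>))"
  shows "(of_real (1 + a) - \<i> * of_real t) * \<phi> t = \<phi> (q * t) + of_real a * \<phi> (t / q)"
proof -
  define S where "S \<omega> = (\<Sum>n. G n \<omega>)" for \<omega>
  define \<psi> where "\<psi> = char (distr M borel (I_q q \<epsilon>))"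
  have Sm[measurable]: "random_variable (count_space UNIV) S"
    unfolding S_def[abs_def] using G
    by (intro measurable_suminf_nat) (auto simp: indep_geometric_seq_def indep_vars_def)
  have Im[measurable]: "random_variable borel (I_q q \<epsilon>)" and Rm[measurable]: "random_variable borel (q_gamma q G)"
    using ind by (auto simp: indep_var_distribution_eq)
  interpret I: real_distribution "distr M borel (I_q q \<epsilon>)" by (rule real_distribution_distr) measurable
  interpret R: real_distribution "distr M borel (q_gamma q G)" by (rule real_distribution_distr) measurable
  interpret P: pair_prob_space "distr M borel (I_q q \<epsilon>)" "distr M borel (q_gamma q G)" ..
  have R: "(1 - q) * q_gamma q G \<omega> = q ^ S \<omega>" for \<omega> using q by (simp add: q_gamma_def S_def)
  have psi1: "cmod (\<psi> s) \<le> 1" for s unfolding \<psi>_def by (rule I.cmod_char_le_1)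
  have \<psi>m[measurable]: "\<psi> \<in> borel_measurable borel" unfolding \<psi>_def by measurable
  have mix: "\<phi> s = (CLINT \<omega>|M. \<psi> (s / q ^ S \<omega>))" for s
  proof -
    let ?h = "\<lambda>x r. iexp (s / ((1 - q) * r) * x)"
    have "\<phi> s = (CLINT \<omega>|M. iexp (s * (q powi (- int (S \<omega>)) * I_q q \<epsilon> \<omega>)))"
      unfolding \<phi>_def char_def S_def[symmetric] by (rule integral_distr) auto
    also have "\<dots> = (CLINT \<omega>|M. case_prod ?h (I_q q \<epsilon> \<omega>, q_gamma q G \<omega>))"
      by (simp only: R prod.case) (simp add: power_int_minus divide_inverse mult_ac)
    also have "\<dots> = (CLINT y|distr M (borel \<Otimes>\<^sub>M borel) (\<lambda>\<omega>. (I_q q \<epsilon> \<omega>, q_gamma q G \<omega>)). case_prod ?h y)"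
      by (rule integral_distr[symmetric]) measurable
    also have "distr M (borel \<Otimes>\<^sub>M borel) (\<lambda>\<omega>. (I_q q \<epsilon> \<omega>, q_gamma q G \<omega>))
      = distr M borel (I_q q \<epsilon>) \<Otimes>\<^sub>M distr M borel (q_gamma q G)"
      using ind by (simp add: indep_var_distribution_eq)
    also have "(CLINT y|\<dots>. case_prod ?h y)
      = (CLINT r|distr M borel (q_gamma q G). (CLINT x|distr M borel (I_q q \<epsilon>). ?h x r))"
      by (rule P.integral_snd[symmetric], rule P.integrable_const_bound[of _ 1]) auto
    also have "\<dots> = (CLINT r|distr M borel (q_gamma q G). \<psi> (s / ((1 - q) * r)))"
      by (simp add: \<psi>_def char_def)
    also have "\<dots> = (CLINT \<omega>|M. \<psi> (s / q ^ S \<omega>))" by (subst integral_distr) (auto simp: R)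
    finally show ?thesis .
  qed
  have psi_eq: "(1 - \<i> * of_real s) * \<psi> s = \<psi> (q * s)" for s
    unfolding \<psi>_def by (rule char_I_q_equation[OF q \<epsilon>])
  define c where "c k = \<psi> (t / q ^ k)" for k
  define c' where "c' k = \<psi> (q * (t / q ^ k))" for k
  have [simp]: "integrable M (\<lambda>\<omega>. c (S \<omega>))" "integrable M (\<lambda>\<omega>. c' (S \<omega>))" "integrable M (\<lambda>\<omega>. c (Suc (S \<omega>)))"
    by (intro integrable_const_bound[of _ 1]; simp add: c_def c'_def psi1)+
  have le1: "cmod ((1 - q ^ k) *\<^sub>R \<psi> s) \<le> 1" for k s
    using q mult_mono[OF _ psi1[of s], of "1 - q ^ k" 1] by (simp add: power_le_one)
  have [simp]: "integrable M (\<lambda>\<omega>. (1 - q ^ S \<omega>) *\<^sub>R c (S \<omega>))" "integrable M (\<lambda>\<omega>. (1 - q ^ S \<omega>) *\<^sub>R c' (S \<omega>))"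
    by (intro integrable_const_bound[of _ 1]; simp add: c_def c'_def le1 del: norm_scaleR)+
  have up: "(CLINT \<omega>|M. (1 - q ^ S \<omega>) *\<^sub>R c (S \<omega>)) = a *\<^sub>R (CLINT \<omega>|M. c (Suc (S \<omega>)))"
    unfolding S_def by (rule geometric_series_size_bias[OF q a G, of _ 1]) (simp add: c_def psi1)
  have "c' (Suc k) = c k" for k using q by (simp add: c_def c'_def)
  then have down: "(CLINT \<omega>|M. (1 - q ^ S \<omega>) *\<^sub>R c' (S \<omega>)) = a *\<^sub>R (CLINT \<omega>|M. c (S \<omega>))"
    using geometric_series_size_bias[OF q a G, of c' 1] by (simp add: S_def c'_def psi1)
  have zero: "(1 - \<i> * of_real t) * c k - c' k - (1 - q ^ k) *\<^sub>R c k + (1 - q ^ k) *\<^sub>R c' k = 0" for k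
  proof -
    have "c' k = (1 - \<i> * of_real (t / q ^ k)) * c k" unfolding c_def c'_def by (simp only: psi_eq)
    then show ?thesis using q by (simp add: scaleR_conv_of_real field_simps)
  qed
  have "0 = (CLINT \<omega>|M. (1 - \<i> * of_real t) * c (S \<omega>) - c' (S \<omega>) - (1 - q ^ S \<omega>) *\<^sub>R c (S \<omega>) + (1 - q ^ S \<omega>) *\<^sub>R c' (S \<omega>))"
    unfolding zero by simp
  also have "\<dots> = (1 - \<i> * of_real t) * (CLINT \<omega>|M. c (S \<omega>)) - (CLINT \<omega>|M. c' (S \<omega>))
      - (CLINT \<omega>|M. (1 - q ^ S \<omega>) *\<^sub>R c (S \<omega>)) + (CLINT \<omega>|M. (1 - q ^ S \<omega>) *\<^sub>R c' (S \<omega>))"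
    by simp
  also have "\<dots> = (1 - \<i> * of_real t) * \<phi> t - \<phi> (q * t) - of_real a * \<phi> (t / q) + of_real a * \<phi> t"
    unfolding up down mix by (simp add: c_def c'_def scaleR_conv_of_real)
  finally show ?thesis by (simp add: algebra_simps)
qed

section \<open>Riemann sums of right-continuous paths\<close>

lemma nn_integral_step_function:
  assumes h: "0 < h" and a: "\<And>k. 0 \<le> a k"
  shows "(\<integral>\<^sup>+ s. ennreal (indicator {0..} s * a (nat \<lfloor>s / h\<rfloor>)) \<partial>lborel) = (\<Sum>k. ennreal (h * a k))"
proof -
  define A where "A k = {real k * h..<real (Suc k) * h}" for k
  have [measurable]: "A k \<in> sets borel" for k by (simp add: A_def)
  have A: "s \<in> A k \<longleftrightarrow> 0 \<le> s \<and> nat \<lfloor>s / h\<rfloor> = k" for s k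
  proof
    assume "s \<in> A k"
    then have s: "real k \<le> s / h" "s / h < real k + 1" using h by (auto simp: A_def field_simps)
    then have "0 \<le> s / h" by linarith
    moreover have "\<lfloor>s / h\<rfloor> = int k" using s by linarith
    ultimately show "0 \<le> s \<and> nat \<lfloor>s / h\<rfloor> = k" using h by (simp add: zero_le_divide_iff)
  next
    assume s: "0 \<le> s \<and> nat \<lfloor>s / h\<rfloor> = k"
    then have "0 \<le> s / h" using h by simp
    then have "real k \<le> s / h" "s / h < real k + 1" using s by linarith+
    then show "s \<in> A k" using h by (auto simp: A_def field_simps)
  qed
  have disj: "disjoint_family A" by (auto simp: disjoint_family_on_def A)
  have "ennreal (indicator {0..} s * a (nat \<lfloor>s / h\<rfloor>)) = (\<Sum>k. ennreal (a k) * indicator (A k) s)" for s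
  proof (cases "0 \<le> s")
    case True
    then have "s \<in> A (nat \<lfloor>s / h\<rfloor>)" by (simp add: A)
    from suminf_cmult_indicator[OF disj this, of "\<lambda>k. ennreal (a k)"] True show ?thesis by simp
  next
    case False
    then have "s \<notin> A k" for k by (simp add: A)
    with False show ?thesis by simp
  qed
  then have "(\<integral>\<^sup>+ s. ennreal (indicator {0..} s * a (nat \<lfloor>s / h\<rfloor>)) \<partial>lborel)
      = (\<Sum>k. \<integral>\<^sup>+ s. ennreal (a k) * indicator (A k) s \<partial>lborel)"
    by (simp add: nn_integral_suminf)
  also have "\<dots> = (\<Sum>k. ennreal (h * a k))"
  proof (rule suminf_cong)
    fix k
    have "real k * h \<le> real (Suc k) * h" using h by simp
    then have "emeasure lborel (A k) = ennreal h" by (simp add: A_def algebra_simps)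
    then show "(\<integral>\<^sup>+ s. ennreal (a k) * indicator (A k) s \<partial>lborel) = ennreal (h * a k)"
      using h a[of k] by (simp add: nn_integral_cmult ennreal_mult[symmetric] mult.commute)
  qed
  finally show ?thesis .
qed

lemma has_bochner_integral_step_function:
  fixes a :: "nat \<Rightarrow> real"
  assumes h: "0 < h" and a: "\<And>k. 0 \<le> a k" and sm: "summable a"
  shows "has_bochner_integral lborel (\<lambda>s. indicator {0..} s * a (nat \<lfloor>s / h\<rfloor>)) (h * (\<Sum>k. a k))"
proof (rule has_bochner_integral_nn_integral)
  have "(\<lambda>k. h * a k) sums (h * (\<Sum>k. a k))" using sm by (intro sums_mult summable_sums)
  then have "(\<Sum>k. ennreal (h * a k)) = ennreal (h * (\<Sum>k. a k))"
    using h a by (intro suminf_ennreal_eq) auto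
  then show "(\<integral>\<^sup>+ s. ennreal (indicator {0..} s * a (nat \<lfloor>s / h\<rfloor>)) \<partial>lborel) = ennreal (h * (\<Sum>k. a k))"
    using nn_integral_step_function[OF h a] by (rule trans[rotated])
qed (use h a sm in \<open>auto intro!: mult_nonneg_nonneg suminf_nonneg\<close>)

text \<open>
  The path is sampled at the grid point strictly to the right of \<open>s\<close>, so that right-continuity alone
  makes the step functions converge to the path at every \<open>s\<close>.
\<close>
definition grid_step :: "(real \<Rightarrow> real) \<Rightarrow> real \<Rightarrow> real \<Rightarrow> real"
  where "grid_step Z h s = indicator {0..} s * Z (real (Suc (nat \<lfloor>s / h\<rfloor>)) * h)"

locale right_continuous =
  fixes Z :: "real \<Rightarrow> real"
  assumes right_cont: "\<And>s. 0 \<le> s \<Longrightarrow> continuous (at_right s) Z"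
begin

lemma next_grid_point:
  assumes "0 < h" "0 \<le> s"
  shows "s < real (Suc (nat \<lfloor>s / h\<rfloor>)) * h" "real (Suc (nat \<lfloor>s / h\<rfloor>)) * h \<le> s + h"
proof -
  have "0 \<le> s / h" using assms by simp
  then have "s / h < real (Suc (nat \<lfloor>s / h\<rfloor>))" "real (Suc (nat \<lfloor>s / h\<rfloor>)) \<le> s / h + 1" by linarith+
  then show "s < real (Suc (nat \<lfloor>s / h\<rfloor>)) * h" "real (Suc (nat \<lfloor>s / h\<rfloor>)) * h \<le> s + h"
    using assms by (simp_all add: field_simps)
qed

lemma step_measurable[measurable]: "grid_step Z h \<in> borel_measurable borel"
  unfolding grid_step_def[abs_def] by measurable

lemma step_tendsto:
  assumes h: "\<And>m. 0 < h m" "h \<longlonglongrightarrow> 0"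
  shows "(\<lambda>m. grid_step Z (h m) s) \<longlonglongrightarrow> indicator {0..} s * Z s"
proof (cases "0 \<le> s")
  case True
  have "(\<lambda>m. real (Suc (nat \<lfloor>s / h m\<rfloor>)) * h m) \<longlonglongrightarrow> s"
  proof (rule tendsto_sandwich)
    show "\<forall>\<^sub>F m in sequentially. s \<le> real (Suc (nat \<lfloor>s / h m\<rfloor>)) * h m"
      using next_grid_point(1)[OF h(1) True] by (intro always_eventually allI) (auto intro: less_imp_le)
    show "\<forall>\<^sub>F m in sequentially. real (Suc (nat \<lfloor>s / h m\<rfloor>)) * h m \<le> s + h m"
      using next_grid_point(2)[OF h(1) True] by (intro always_eventually allI)
    show "(\<lambda>m. s + h m) \<longlonglongrightarrow> s" using h(2) by (auto intro!: tendsto_eq_intros)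
  qed simp
  then have "filterlim (\<lambda>m. real (Suc (nat \<lfloor>s / h m\<rfloor>)) * h m) (at_right s) sequentially"
    using next_grid_point(1)[OF h(1) True] unfolding filterlim_at
    by (auto intro!: always_eventually simp: less_imp_neq[THEN not_sym] simp del: of_nat_Suc)
  with right_cont[OF True] have "(\<lambda>m. Z (real (Suc (nat \<lfloor>s / h m\<rfloor>)) * h m)) \<longlonglongrightarrow> Z s"
    unfolding continuous_within by (rule filterlim_compose)
  with True show ?thesis by (simp add: grid_step_def)
qed (simp add: grid_step_def)

lemma measurable_Z: "(\<lambda>s. indicator {0..} s * Z s) \<in> borel_measurable borel"
  by (rule borel_measurable_LIMSEQ_real[OF step_tendsto[of "\<lambda>m. inverse (real (Suc m))"]])
     (auto simp: LIMSEQ_inverse_real_of_nat simp del: of_nat_Suc)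

end

text \<open>
  The majorant bounds the path on a whole unit interval after \<open>s\<close>, since the sampling point may lie
  up to one mesh width beyond \<open>s\<close>.
\<close>
locale dominated_right_continuous = right_continuous +
  fixes D :: "nat \<Rightarrow> real"
  assumes nonneg: "\<And>s. 0 \<le> s \<Longrightarrow> 0 \<le> Z s"
    and dom: "\<And>s u. 0 \<le> s \<Longrightarrow> s \<le> u \<Longrightarrow> u \<le> s + 1 \<Longrightarrow> Z u \<le> D (nat \<lfloor>s\<rfloor>)"
    and summable_dom: "summable D"
begin

lemma dom_nonneg: "0 \<le> D n"
  using nonneg[of "real n"] dom[of "real n" "real n"] by simp

lemma integrable_majorant: "integrable lborel (\<lambda>s::real. indicator {0..} s * D (nat \<lfloor>s\<rfloor>))"
  using has_bochner_integral_step_function[of 1 D] dom_nonneg summable_dom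
  by (auto simp: has_bochner_integral_iff)

lemma step_le:
  assumes "0 < h" "h \<le> 1"
  shows "norm (grid_step Z h s) \<le> indicator {0..} s * D (nat \<lfloor>s\<rfloor>)"
proof (cases "0 \<le> s")
  case True
  have "Z (real (Suc (nat \<lfloor>s / h\<rfloor>)) * h) \<le> D (nat \<lfloor>s\<rfloor>)"
    using next_grid_point[of h s] assms True by (intro dom) auto
  with True assms show ?thesis by (simp add: grid_step_def nonneg)
qed (simp add: grid_step_def)

lemma integrable_Z: "set_integrable lborel {0..} Z"
  unfolding set_integrable_def
proof (rule Bochner_Integration.integrable_bound[OF integrable_majorant])
  show "AE s in lborel. norm (indicator {0..} s *\<^sub>R Z s) \<le> norm (indicator {0..} s * D (nat \<lfloor>s\<rfloor>))"
  proof (intro AE_I2)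
    fix s :: real
    show "norm (indicator {0..} s *\<^sub>R Z s) \<le> norm (indicator {0..} s * D (nat \<lfloor>s\<rfloor>))"
      using nonneg[of s] dom[of s s] dom_nonneg by (cases "0 \<le> s") auto
  qed
qed (use measurable_Z in simp)

text \<open>
  The Riemann sum over the infinite grid is the integral of a step function below the majorant;
  integrability of the step function is what makes the sum finite.
\<close>
lemma grid_sum:
  assumes h: "0 < h" "h \<le> 1"
  shows "summable (\<lambda>k. Z (real (Suc k) * h))"
    and "(\<integral>s. grid_step Z h s \<partial>lborel) = h * (\<Sum>k. Z (real (Suc k) * h))"
proof -
  have nn: "0 \<le> Z (real (Suc k) * h)" for k using h by (intro nonneg) simp
  have "integrable lborel (grid_step Z h)"
    by (rule Bochner_Integration.integrable_bound[OF integrable_majorant])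
       (use step_le[OF h] dom_nonneg in auto)
  then have "(\<integral>\<^sup>+ s. ennreal (norm (grid_step Z h s)) \<partial>lborel) \<noteq> top"
    unfolding integrable_iff_bounded by auto
  moreover have "norm (grid_step Z h s) = indicator {0..} s * Z (real (Suc (nat \<lfloor>s / h\<rfloor>)) * h)" for s
    using nn by (simp add: grid_step_def abs_mult)
  ultimately have "(\<Sum>k. ennreal (h * Z (real (Suc k) * h))) \<noteq> top"
    using nn_integral_step_function[OF h(1), of "\<lambda>k. Z (real (Suc k) * h)"] nn by simp
  then have "summable (\<lambda>k. h * Z (real (Suc k) * h))"
    using nn h by (intro summable_suminf_not_top) auto
  then show sm: "summable (\<lambda>k. Z (real (Suc k) * h))"
    using h by (simp add: summable_cmult_iff)
  show "(\<integral>s. grid_step Z h s \<partial>lborel) = h * (\<Sum>k. Z (real (Suc k) * h))"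
    unfolding grid_step_def
    using has_bochner_integral_step_function[OF h(1), of "\<lambda>k. Z (real (Suc k) * h)"] nn sm
    by (intro has_bochner_integral_integral_eq) auto
qed

lemma riemann_sums_tendsto:
  assumes h: "\<And>m. 0 < h m" "\<And>m. h m \<le> 1" "h \<longlonglongrightarrow> 0"
  shows "(\<lambda>m. h m * (\<Sum>k. Z (real (Suc k) * h m))) \<longlonglongrightarrow> (LBINT s:{0..}. Z s)"
proof -
  have "(\<lambda>m. \<integral>s. grid_step Z (h m) s \<partial>lborel) \<longlonglongrightarrow> (\<integral>s. indicator {0..} s * Z s \<partial>lborel)"
    by (rule integral_dominated_convergence[OF _ _ integrable_majorant])
       (use measurable_Z step_tendsto[OF h(1,3)] step_le h in auto)
  then show ?thesis by (simp add: grid_sum h set_lebesgue_integral_def)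
qed

end

section \<open>Perpetuities with independent factors\<close>

text \<open>
  The characteristic function of \<open>h (v 0 + v 0 v 1 + \<dots> + v 0 \<dots> v (N - 1))\<close>, with factors
  \<open>v k = w (W k)\<close> for independent \<open>W k\<close> of law \<open>\<nu>\<close>, obtained by conditioning on the first factor.
  It depends only on \<open>\<nu>\<close>, which makes it invariant under a shift of the sequence.
\<close>
primrec perpetuity_char :: "real \<Rightarrow> ('x \<Rightarrow> real) \<Rightarrow> 'x pmf \<Rightarrow> nat \<Rightarrow> real \<Rightarrow> complex" where
  "perpetuity_char h w \<nu> 0 t = 1"
| "perpetuity_char h w \<nu> (Suc N) t = (CLINT x|measure_pmf \<nu>. iexp (t * (w x * h)) * perpetuity_char h w \<nu> N (t * w x))"

lemma (in prob_space) indep_vars_reindex: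
  assumes f: "inj_on f I" and X: "indep_vars M' X (f ` I)"
  shows "indep_vars (M' \<circ> f) (X \<circ> f) I"
  unfolding indep_vars_def2
proof (intro conjI ballI indep_setsI)
  fix i assume i: "i \<in> I"
  then show m: "random_variable ((M' \<circ> f) i) ((X \<circ> f) i)" using X by (auto simp: indep_vars_def)
  show "{(X \<circ> f) i -` A \<inter> space M |A. A \<in> sets ((M' \<circ> f) i)} \<subseteq> events"
    using measurable_sets[OF m] by auto
next
  fix A J assume J: "J \<noteq> {}" "J \<subseteq> I" "finite J"
    and A: "\<forall>j\<in>J. A j \<in> {(X \<circ> f) j -` A \<inter> space M |A. A \<in> sets ((M' \<circ> f) j)}"
  have fJ: "inj_on f J" using f J by (auto intro: inj_on_subset)
  have "prob (\<Inter>i\<in>f ` J. A (the_inv_into J f i)) = (\<Prod>i\<in>f ` J. prob (A (the_inv_into J f i)))"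
  proof (rule indep_setsD)
    show "indep_sets (\<lambda>i. {X i -` A \<inter> space M |A. A \<in> sets (M' i)}) (f ` I)"
      using X by (simp add: indep_vars_def2)
    show "\<forall>i\<in>f ` J. A (the_inv_into J f i) \<in> {X i -` A \<inter> space M |A. A \<in> sets (M' i)}"
      using A by (simp add: the_inv_into_f_f[OF fJ])
  qed (use J in auto)
  then show "prob (\<Inter>j\<in>J. A j) = (\<Prod>j\<in>J. prob (A j))"
    by (simp add: the_inv_into_f_f[OF fJ] prod.reindex[OF fJ])
qed

text \<open>
  The sum factors as \<open>w (W 0) * (h + V)\<close>, where \<open>V\<close> is the sum of one term fewer formed from the
  shifted sequence, and \<open>V\<close> is independent of \<open>W 0\<close>.
\<close>
lemma (in prob_space) expectation_iexp_perpetuity: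
  fixes W :: "nat \<Rightarrow> 'a \<Rightarrow> 'x" and w :: "'x \<Rightarrow> real"
  assumes "indep_vars (\<lambda>_. count_space UNIV) W {..<N}"
    and "\<And>k. k < N \<Longrightarrow> distr M (count_space UNIV) (W k) = measure_pmf \<nu>"
  shows "(CLINT \<omega>|M. iexp (t * (h * (\<Sum>k<N. \<Prod>j\<le>k. w (W j \<omega>))))) = perpetuity_char h w \<nu> N t"
  using assms
proof (induction N arbitrary: W t)
  case 0
  show ?case by (simp add: prob_space)
next
  case (Suc N)
  define U where "U \<omega> = w (W 0 \<omega>)" for \<omega>
  define g :: "(nat \<Rightarrow> 'x) \<Rightarrow> real" where "g x = h * (\<Sum>k<N. \<Prod>j\<le>k. w (x (Suc j)))" for x
  define V where "V \<omega> = g (\<lambda>j. W j \<omega>)" for \<omega>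
  have Wm: "random_variable (count_space UNIV) (W k)" if "k < Suc N" for k
    using Suc.prems(1) that by (auto simp: indep_vars_def)
  have "indep_var (PiM {0} (\<lambda>_. count_space UNIV)) (\<lambda>\<omega>. \<lambda>i\<in>{0}. W i \<omega>)
      (PiM {1..<Suc N} (\<lambda>_. count_space UNIV)) (\<lambda>\<omega>. \<lambda>i\<in>{1..<Suc N}. W i \<omega>)"
    by (rule indep_var_restrict[OF Suc.prems(1)]) auto
  moreover have "(\<lambda>x. w (x 0)) \<in> borel_measurable (PiM {0} (\<lambda>_. count_space UNIV :: 'x measure))"
    by (rule measurable_compose[OF measurable_component_singleton]) auto
  moreover have "g \<in> borel_measurable (PiM {1..<Suc N} (\<lambda>_. count_space UNIV))"
    unfolding g_def[abs_def]
    by (intro borel_measurable_times borel_measurable_const borel_measurable_sum borel_measurable_prod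
          measurable_compose[OF measurable_component_singleton]) auto
  ultimately have "indep_var borel ((\<lambda>x. w (x 0)) \<circ> (\<lambda>\<omega>. \<lambda>i\<in>{0}. W i \<omega>))
      borel (g \<circ> (\<lambda>\<omega>. \<lambda>i\<in>{1..<Suc N}. W i \<omega>))"
    by (rule indep_var_compose)
  moreover have "(\<lambda>x. w (x 0)) \<circ> (\<lambda>\<omega>. \<lambda>i\<in>{0}. W i \<omega>) = U" by (auto simp: U_def)
  moreover have "g \<circ> (\<lambda>\<omega>. \<lambda>i\<in>{1..<Suc N}. W i \<omega>) = V"
    by (auto simp: V_def g_def fun_eq_iff intro!: sum.cong prod.cong)
  ultimately have ind: "indep_var borel U borel V" by simp
  then have [measurable]: "random_variable borel U" "random_variable borel V"
    by (auto simp: indep_var_distribution_eq)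
  interpret U: real_distribution "distr M borel U" by (rule real_distribution_distr) measurable
  interpret V: real_distribution "distr M borel V" by (rule real_distribution_distr) measurable
  interpret P: pair_prob_space "distr M borel U" "distr M borel V" ..
  have charV: "char (distr M borel V) s = perpetuity_char h w \<nu> N s" for s
  proof -
    have "indep_vars (\<lambda>_. count_space UNIV) (\<lambda>k. W (Suc k)) {..<N}"
      using indep_vars_reindex[of Suc "{..<N}" "\<lambda>_. count_space UNIV" W] indep_vars_subset[OF Suc.prems(1), of "Suc ` {..<N}"]
      by (auto simp: o_def)
    then have "(CLINT \<omega>|M. iexp (s * V \<omega>)) = perpetuity_char h w \<nu> N s"
      unfolding V_def g_def using Suc.IH[of "\<lambda>k. W (Suc k)" s] Suc.prems(2) by simp
    then show ?thesis unfolding char_def by (subst integral_distr) auto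
  qed
  have "h * (\<Sum>k<Suc N. \<Prod>j\<le>k. w (W j \<omega>)) = U \<omega> * (h + V \<omega>)" for \<omega>
  proof -
    have "(\<Sum>k<Suc N. \<Prod>j\<le>k. w (W j \<omega>)) = w (W 0 \<omega>) + (\<Sum>k<N. w (W 0 \<omega>) * (\<Prod>j\<le>k. w (W (Suc j) \<omega>)))"
      by (subst sum.lessThan_Suc_shift) (simp add: prod.atMost_Suc_shift del: prod.atMost_Suc)
    then show ?thesis by (simp add: U_def V_def g_def sum_distrib_left algebra_simps)
  qed
  then have "(CLINT \<omega>|M. iexp (t * (h * (\<Sum>k<Suc N. \<Prod>j\<le>k. w (W j \<omega>)))))
      = (CLINT \<omega>|M. (\<lambda>(u, v). iexp (t * (u * (h + v)))) (U \<omega>, V \<omega>))" by simp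
  also have "\<dots> = (CLINT y|distr M (borel \<Otimes>\<^sub>M borel) (\<lambda>\<omega>. (U \<omega>, V \<omega>)). (\<lambda>(u, v). iexp (t * (u * (h + v)))) y)"
    by (rule integral_distr[symmetric]) measurable
  also have "distr M (borel \<Otimes>\<^sub>M borel) (\<lambda>\<omega>. (U \<omega>, V \<omega>)) = distr M borel U \<Otimes>\<^sub>M distr M borel V"
    using ind by (simp add: indep_var_distribution_eq)
  also have "(CLINT y|\<dots>. (\<lambda>(u, v). iexp (t * (u * (h + v)))) y)
      = (CLINT u|distr M borel U. CLINT v|distr M borel V. iexp (t * (u * (h + v))))"
    by (subst P.integral_fst'[symmetric], rule P.integrable_const_bound[of _ 1]) auto
  also have "\<dots> = (CLINT u|distr M borel U. iexp (t * (u * h)) * char (distr M borel V) (t * u))"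
  proof -
    have "iexp (t * (u * (h + v))) = iexp (t * (u * h)) * iexp (t * u * v)" for u v
      by (simp only: mult_exp_exp distrib_left of_real_add of_real_mult mult.assoc)
    then show ?thesis unfolding char_def by (simp only: integral_mult_right_zero)
  qed
  also have "\<dots> = (CLINT \<omega>|M. iexp (t * (U \<omega> * h)) * char (distr M borel V) (t * U \<omega>))"
    by (rule integral_distr) auto
  also have "\<dots> = (CLINT x|distr M (count_space UNIV) (W 0). iexp (t * (w x * h)) * perpetuity_char h w \<nu> N (t * w x))"
    unfolding charV U_def by (rule integral_distr[symmetric]) (auto intro: Wm)
  finally show ?case using Suc.prems(2)[of 0] by simp
qed

lemma (in prob_space) norm_expectation_le_1:
  fixes f :: "'a \<Rightarrow> complex"
  assumes "\<And>x. norm (f x) \<le> 1"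
  shows "norm (expectation f) \<le> 1"
proof (cases "integrable M f")
  case True
  have "norm (expectation f) \<le> expectation (\<lambda>x. norm (f x))" by (rule integral_norm_bound)
  also have "\<dots> \<le> expectation (\<lambda>_. 1)"
    using True assms by (intro integral_mono) auto
  finally show ?thesis by (simp add: prob_space)
qed (simp add: not_integrable_integral_eq)

lemma norm_perpetuity_char_le_1: "cmod (perpetuity_char h w \<nu> N t) \<le> 1"
  by (induction N arbitrary: t) (auto intro!: measure_pmf.norm_expectation_le_1 simp: norm_mult)

section \<open>The exponential functional of a difference of Poisson processes\<close>

lemma nn_integral_poisson_power:
  assumes r: "0 < r" and x: "0 \<le> x"
  shows "(\<integral>\<^sup>+ k. ennreal (x ^ k) \<partial>measure_pmf (poisson_pmf r)) = ennreal (exp (r * (x - 1)))"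
proof -
  have "(\<lambda>k. exp (- r) * ((r * x) ^ k /\<^sub>R fact k)) sums (exp (- r) * exp (r * x))"
    by (intro sums_mult exp_converges)
  then have "(\<Sum>k. ennreal (exp (- r) * ((r * x) ^ k /\<^sub>R fact k))) = ennreal (exp (- r) * exp (r * x))"
    using r x by (intro suminf_ennreal_eq) auto
  moreover have "ennreal (pmf (poisson_pmf r) k) * ennreal (x ^ k) = ennreal (exp (- r) * ((r * x) ^ k /\<^sub>R fact k))" for k
    using r x by (simp add: ennreal_mult[symmetric] power_mult_distrib divide_simps mult_ac)
  ultimately show ?thesis
    by (simp add: nn_integral_measure_pmf nn_integral_count_space_nat exp_add[symmetric] algebra_simps)
qed

lemma expectation_pmf_near_finite_sum:
  fixes g :: "'x \<Rightarrow> complex"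
  assumes F: "finite F" and g: "\<And>x. cmod (g x) \<le> 1"
  shows "cmod ((CLINT x|measure_pmf \<nu>. g x) - (\<Sum>x\<in>F. pmf \<nu> x * g x)) \<le> 1 - (\<Sum>x\<in>F. pmf \<nu> x)"
proof -
  have int: "integrable (measure_pmf \<nu>) (\<lambda>x. indicator A x * g x)" for A
    by (rule measure_pmf.integrable_const_bound[of _ 1]) (auto simp: g norm_mult indicator_def)
  have "(CLINT x|measure_pmf \<nu>. indicator F x * g x) = (\<Sum>x\<in>F. pmf \<nu> x *\<^sub>R (indicator F x * g x))"
    using F by (intro integral_measure_pmf) (auto simp: indicator_def split: if_splits)
  also have "\<dots> = (\<Sum>x\<in>F. pmf \<nu> x * g x)"
    by (intro sum.cong) (auto simp: scaleR_conv_of_real)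
  moreover have "(CLINT x|measure_pmf \<nu>. g x)
      = (CLINT x|measure_pmf \<nu>. indicator F x * g x + indicator (- F) x * g x)"
    by (intro Bochner_Integration.integral_cong) (auto simp: indicator_def)
  ultimately have "(CLINT x|measure_pmf \<nu>. g x) - (\<Sum>x\<in>F. pmf \<nu> x * g x)
      = (CLINT x|measure_pmf \<nu>. indicator (- F) x * g x)"
    by (simp only: Bochner_Integration.integral_add[OF int int] add_diff_cancel_left')
  also have "cmod \<dots> \<le> (\<integral>x. indicator (- F) x \<partial>measure_pmf \<nu>)"
  proof (rule order_trans[OF integral_norm_bound], rule integral_mono)
    show "integrable (measure_pmf \<nu>) (\<lambda>x. cmod (indicator (- F) x * g x))" using int[of "- F"] by (rule integrable_norm)
    show "integrable (measure_pmf \<nu>) (indicator (- F) :: _ \<Rightarrow> real)"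
      by (rule measure_pmf.integrable_const_bound[of _ 1]) auto
  qed (auto simp: g norm_mult indicator_def)
  also have "\<dots> = 1 - measure (measure_pmf \<nu>) F"
    using measure_pmf.prob_compl[of F \<nu>] by (simp add: Compl_eq_Diff_UNIV)
  also have "measure (measure_pmf \<nu>) F = (\<Sum>x\<in>F. pmf \<nu> x)"
    using F by (rule measure_measure_pmf_finite)
  finally show ?thesis .
qed

lemma measurable_count_space_binop:
  fixes f1 :: "'a \<Rightarrow> 'b::countable"
  assumes "f1 \<in> measurable M (count_space UNIV)" "f2 \<in> measurable M (count_space UNIV)"
  shows "(\<lambda>x. g (f1 x) (f2 x)) \<in> measurable M (count_space UNIV)"
  by (rule measurable_compose_countable[OF _ assms(1)], rule measurable_compose[OF assms(2)]) simp

text \<open>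
  The left-hand side of the theorem: \<open>Z s\<close> is \<open>q\<close> to the power of the difference of the two processes
  at time \<open>s\<close>, \<open>X\<close> is its integral, and \<open>D n\<close> bounds \<open>Z\<close> on the interval from \<open>n\<close> to \<open>n + 2\<close>, because
  \<open>Pp\<close> is smallest at the left end and \<open>Pm\<close> is largest at the right end.
\<close>
locale poisson_pair_functional = prob_space M for M :: "'a measure" +
  fixes q \<mu> :: real and Pp Pm :: "real \<Rightarrow> 'a \<Rightarrow> nat"
  assumes q: "0 < q" "q < 1" and \<mu>: "0 < \<mu>" and pair: "indep_poisson_pair 1 (q powr \<mu>) Pp Pm"
begin

abbreviation "z \<equiv> q powr \<mu>"

definition Z :: "real \<Rightarrow> 'a \<Rightarrow> real"
  where "Z s \<omega> = q ^ Pp s \<omega> / q ^ Pm s \<omega>"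

definition D :: "nat \<Rightarrow> 'a \<Rightarrow> real"
  where "D n \<omega> = q ^ Pp n \<omega> / q ^ Pm (n + 2) \<omega>"

definition X :: "'a \<Rightarrow> real"
  where "X \<omega> = (LBINT s:{0..}. Z s \<omega>)"

lemma z: "0 < z" using q by simp

lemma poisson: "poisson_process 1 Pp" "poisson_process z Pm" and indep: "indep_processes Pp Pm"
  using pair by (auto simp: indep_poisson_pair_def)

lemma powi_zeta: "q powi zeta Pp Pm s \<omega> = Z s \<omega>"
  using q by (simp add: zeta_def Z_def power_int_diff)

lemma exp_functional_eq: "exp_functional q Pp Pm = X"
  by (simp add: exp_functional_def X_def fun_eq_iff powi_zeta)

lemma measurable_P[measurable]:
  assumes "0 \<le> t"
  shows "random_variable (count_space UNIV) (Pp t)" "random_variable (count_space UNIV) (Pm t)"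
  using poisson assms by (auto simp: poisson_process_def)

lemma measurable_Z: "0 \<le> t \<Longrightarrow> random_variable borel (Z t)"
  unfolding Z_def[abs_def]
  by (intro borel_measurable_divide measurable_compose[OF measurable_P(1)] measurable_compose[OF measurable_P(2)]) auto

lemma P_0:
  assumes "\<omega> \<in> space M"
  shows "Pp 0 \<omega> = 0" "Pm 0 \<omega> = 0"
  using poisson assms by (auto simp: poisson_process_def)

lemma P_mono:
  assumes "\<omega> \<in> space M" "0 \<le> s" "s \<le> t"
  shows "Pp s \<omega> \<le> Pp t \<omega>" "Pm s \<omega> \<le> Pm t \<omega>"
  using poisson assms by (auto simp: poisson_process_def mono_on_def)

lemma Z_pos: "0 < Z s \<omega>" using q by (simp add: Z_def)

lemma Z_right_continuous:
  assumes "\<omega> \<in> space M" "0 \<le> s"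
  shows "continuous (at_right s) (\<lambda>s. Z s \<omega>)"
proof -
  have "continuous (at_right s) (\<lambda>s. Pp s \<omega>)" "continuous (at_right s) (\<lambda>s. Pm s \<omega>)"
    using poisson assms by (auto simp: poisson_process_def)
  then have "\<forall>\<^sub>F u in at_right s. Pp u \<omega> = Pp s \<omega>" "\<forall>\<^sub>F u in at_right s. Pm u \<omega> = Pm s \<omega>"
    by (simp_all add: continuous_within tendsto_discrete)
  then have "\<forall>\<^sub>F u in at_right s. Z u \<omega> = Z s \<omega>" by eventually_elim (simp add: Z_def)
  then show ?thesis unfolding continuous_within by (rule tendsto_eventually)
qed

lemma Z_le_D:
  assumes \<omega>: "\<omega> \<in> space M" and s: "0 \<le> s" "s \<le> u" "u \<le> s + 1"
  shows "Z u \<omega> \<le> D (nat \<lfloor>s\<rfloor>) \<omega>"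
proof -
  have n: "real (nat \<lfloor>s\<rfloor>) \<le> u" "u \<le> real (nat \<lfloor>s\<rfloor>) + 2" using s by linarith+
  have "Pp (nat \<lfloor>s\<rfloor>) \<omega> \<le> Pp u \<omega>" by (rule P_mono[OF \<omega>]) (use n in auto)
  moreover have "Pm u \<omega> \<le> Pm (nat \<lfloor>s\<rfloor> + 2) \<omega>" by (rule P_mono[OF \<omega>]) (use n s in auto)
  ultimately show ?thesis unfolding Z_def D_def
    using q by (intro frac_le power_decreasing) auto
qed

lemma law_P:
  assumes "0 \<le> s" "s < t"
  shows "distr M (count_space UNIV) (\<lambda>\<omega>. Pp t \<omega> - Pp s \<omega>) = measure_pmf (poisson_pmf (t - s))"
    "distr M (count_space UNIV) (\<lambda>\<omega>. Pm t \<omega> - Pm s \<omega>) = measure_pmf (poisson_pmf (z * (t - s)))"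
  using poisson assms by (auto simp: poisson_process_def)

text \<open>
  Independence reduces the moment of order \<open>\<alpha>\<close> to the generating functions of two Poisson variables.
  The index starts at 1, where the time interval has positive length.
\<close>
lemma nn_integral_D_powr:
  fixes \<alpha> :: real
  defines "\<theta> \<equiv> q powr \<alpha> - 1 + z * (q powr (- \<alpha>) - 1)"
  shows "(\<integral>\<^sup>+ \<omega>. ennreal (D (Suc n) \<omega> powr \<alpha>) \<partial>M)
    = ennreal (exp (\<theta> + 2 * z * (q powr (- \<alpha>) - 1)) * exp \<theta> ^ n)"
proof -
  define x y where "x = q powr \<alpha>" and "y = q powr (- \<alpha>)"
  have xy: "0 \<le> x" "0 \<le> y" by (auto simp: x_def y_def)
  define A B where "A \<omega> = ennreal (x ^ Pp (Suc n) \<omega>)" and "B \<omega> = ennreal (y ^ Pm (Suc n + 2) \<omega>)" for \<omega>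
  have t: "(0::real) \<le> real (Suc n)" "(0::real) \<le> real (Suc n) + 2" by auto
  have "D (Suc n) \<omega> powr \<alpha> = x ^ Pp (Suc n) \<omega> * y ^ Pm (Suc n + 2) \<omega>" for \<omega>
  proof -
    have "q ^ k = q powr k" for k using q by (simp add: powr_realpow)
    moreover have "(q powr b) ^ k = q powr (b * k)" for b k
      using q by (simp add: powr_realpow[symmetric] powr_powr)
    ultimately show ?thesis using q
      by (simp add: D_def x_def y_def powr_diff[symmetric] powr_powr powr_add[symmetric] algebra_simps)
  qed
  then have "(\<integral>\<^sup>+ \<omega>. ennreal (D (Suc n) \<omega> powr \<alpha>) \<partial>M) = (\<integral>\<^sup>+ \<omega>. A \<omega> * B \<omega> \<partial>M)"
    using xy by (simp add: A_def B_def ennreal_mult)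
  also have "\<dots> = (\<integral>\<^sup>+ \<omega>. (\<Prod>b\<in>UNIV. case_bool A B b \<omega>) \<partial>M)"
    by (simp add: UNIV_bool mult.commute)
  also have "\<dots> = (\<Prod>b\<in>UNIV. \<integral>\<^sup>+ \<omega>. case_bool A B b \<omega> \<partial>M)"
  proof (rule indep_vars_nn_integral)
    have mc: "(\<lambda>p. ennreal (c ^ p t)) \<in> borel_measurable (PiM {0..} (\<lambda>_. count_space UNIV :: nat measure))" if "0 \<le> t" for c t :: real
      by (rule measurable_compose[OF measurable_component_singleton]) (use that in auto)
    have "indep_var borel ((\<lambda>p. ennreal (x ^ p (real (Suc n)))) \<circ> (\<lambda>\<omega>. \<lambda>t\<in>{0..}. Pp t \<omega>))
      borel ((\<lambda>p. ennreal (y ^ p (real (Suc n) + 2))) \<circ> (\<lambda>\<omega>. \<lambda>t\<in>{0..}. Pm t \<omega>))"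
      by (rule indep_var_compose[OF indep[unfolded indep_processes_def] mc[OF t(1)] mc[OF t(2)]])
    also have "(\<lambda>p. ennreal (x ^ p (real (Suc n)))) \<circ> (\<lambda>\<omega>. \<lambda>t\<in>{0..}. Pp t \<omega>) = A"
      by (simp add: A_def fun_eq_iff)
    also have "(\<lambda>p. ennreal (y ^ p (real (Suc n) + 2))) \<circ> (\<lambda>\<omega>. \<lambda>t\<in>{0..}. Pm t \<omega>) = B"
      by (simp add: B_def fun_eq_iff add_ac)
    finally have "indep_vars (case_bool borel borel) (case_bool A B) UNIV"
      by (simp add: indep_var_def)
    also have "case_bool borel borel = (\<lambda>_. borel)" by (auto simp: fun_eq_iff split: bool.split)
    finally show "indep_vars (\<lambda>_. borel) (case_bool A B) UNIV" .
  qed auto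
  also have "\<dots> = (\<integral>\<^sup>+ \<omega>. A \<omega> \<partial>M) * (\<integral>\<^sup>+ \<omega>. B \<omega> \<partial>M)" by (simp add: UNIV_bool mult.commute)
  also have "(\<integral>\<^sup>+ \<omega>. A \<omega> \<partial>M) = ennreal (exp (real (Suc n) * (x - 1)))"
  proof -
    have "(\<integral>\<^sup>+ \<omega>. A \<omega> \<partial>M) = (\<integral>\<^sup>+ \<omega>. ennreal (x ^ (Pp (Suc n) \<omega> - Pp 0 \<omega>)) \<partial>M)"
      by (rule nn_integral_cong) (simp add: A_def P_0)
    also have "\<dots> = (\<integral>\<^sup>+ k. ennreal (x ^ k) \<partial>distr M (count_space UNIV) (\<lambda>\<omega>. Pp (Suc n) \<omega> - Pp 0 \<omega>))"
      by (rule nn_integral_distr[symmetric]) (auto intro!: measurable_count_space_binop[where g = "(-)"] measurable_P)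
    also have "\<dots> = ennreal (exp (real (Suc n) * (x - 1)))"
      using law_P(1)[of 0 "Suc n"] xy by (simp add: nn_integral_poisson_power)
    finally show ?thesis .
  qed
  also have "(\<integral>\<^sup>+ \<omega>. B \<omega> \<partial>M) = ennreal (exp (z * (real (Suc n) + 2) * (y - 1)))"
  proof -
    have "(\<integral>\<^sup>+ \<omega>. B \<omega> \<partial>M) = (\<integral>\<^sup>+ \<omega>. ennreal (y ^ (Pm (Suc n + 2) \<omega> - Pm 0 \<omega>)) \<partial>M)"
      by (rule nn_integral_cong) (simp add: B_def P_0)
    also have "\<dots> = (\<integral>\<^sup>+ k. ennreal (y ^ k) \<partial>distr M (count_space UNIV) (\<lambda>\<omega>. Pm (Suc n + 2) \<omega> - Pm 0 \<omega>))"
      by (rule nn_integral_distr[symmetric]) (auto intro!: measurable_count_space_binop[where g = "(-)"] measurable_P)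
    also have "\<dots> = ennreal (exp (z * (real (Suc n) + 2) * (y - 1)))"
      using law_P(2)[of 0 "Suc n + 2"] xy z by (simp add: nn_integral_poisson_power add_ac)
    finally show ?thesis .
  qed
  also have "ennreal (exp (real (Suc n) * (x - 1))) * ennreal (exp (z * (real (Suc n) + 2) * (y - 1)))
      = ennreal (exp (\<theta> + 2 * z * (y - 1)) * exp \<theta> ^ n)"
    by (simp add: \<theta>_def x_def y_def ennreal_mult[symmetric] exp_of_nat_mult[symmetric] exp_add[symmetric] algebra_simps)
  finally show ?thesis by (simp add: y_def)
qed

text \<open>
  The drift to plus infinity of the difference of the processes enters only through a fractional
  moment: \<open>E[D n powr \<alpha>]\<close> decays geometrically for \<open>0 < \<alpha> < \<mu>\<close>. With \<open>\<alpha> \<le> 1\<close>, summability of the powers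
  implies summability of the terms, which are eventually below 1.
\<close>
lemma AE_summable_D: "AE \<omega> in M. summable (\<lambda>n. D n \<omega>)"
proof -
  \<comment> \<open>Any exponent in \<open>{0<..1}\<close> below \<open>\<mu>\<close> will do: the exponent \<open>\<theta>\<close> of the decay is negative exactly for \<open>0 < \<alpha> < \<mu>\<close>.\<close>
  define \<alpha> where "\<alpha> = min 1 (\<mu> / 2)"
  have \<alpha>: "0 < \<alpha>" "\<alpha> \<le> 1" "\<alpha> < \<mu>" using \<mu> by (auto simp: \<alpha>_def)
  define \<theta> where "\<theta> = q powr \<alpha> - 1 + z * (q powr (- \<alpha>) - 1)"
  have "\<theta> = - (1 - q powr \<alpha>) * (1 - q powr (\<mu> - \<alpha>))"
    using q by (simp add: \<theta>_def algebra_simps powr_add[symmetric] powr_diff powr_minus divide_inverse)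
  moreover have "q powr \<alpha> < 1" "q powr (\<mu> - \<alpha>) < 1" 
    using q \<alpha> powr_less_mono2[of \<alpha> q 1] powr_less_mono2[of "\<mu> - \<alpha>" q 1] by auto
  ultimately have \<theta>: "\<theta> < 0" by (simp add: mult_neg_pos)
  have Dm: "random_variable borel (D n)" for n
    unfolding D_def[abs_def]
    by (intro borel_measurable_divide measurable_compose[OF measurable_P(1)] measurable_compose[OF measurable_P(2)]) auto
  have "AE \<omega> in M. summable (\<lambda>n. D (Suc n) \<omega> powr \<alpha>)"
  proof (rule AE_summable_if_summable_nn_integral)
    show "(\<integral>\<^sup>+ \<omega>. ennreal (D (Suc n) \<omega> powr \<alpha>) \<partial>M)
        = ennreal (exp (\<theta> + 2 * z * (q powr (- \<alpha>) - 1)) * exp \<theta> ^ n)" for n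
      unfolding \<theta>_def by (rule nn_integral_D_powr)
    show "summable (\<lambda>n. exp (\<theta> + 2 * z * (q powr (- \<alpha>) - 1)) * exp \<theta> ^ n)"
      using \<theta> by (intro summable_mult summable_geometric) simp
  qed (use Dm in auto)
  then show ?thesis
  proof eventually_elim
    fix \<omega> assume sm: "summable (\<lambda>n. D (Suc n) \<omega> powr \<alpha>)"
    have pos: "0 < D n \<omega>" for n using q by (simp add: D_def)
    have "(\<lambda>n. D (Suc n) \<omega> powr \<alpha>) \<longlonglongrightarrow> 0" using sm by (rule summable_LIMSEQ_zero)
    then have "\<forall>\<^sub>F n in sequentially. D (Suc n) \<omega> powr \<alpha> < 1" by (rule order_tendstoD) simp
    then have "\<forall>\<^sub>F n in sequentially. norm (D (Suc n) \<omega>) \<le> D (Suc n) \<omega> powr \<alpha>"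
    proof eventually_elim
      fix n assume less: "D (Suc n) \<omega> powr \<alpha> < 1"
      have "D (Suc n) \<omega> \<le> 1"
      proof (rule ccontr)
        assume "\<not> D (Suc n) \<omega> \<le> 1"
        then have "1 \<le> D (Suc n) \<omega> powr \<alpha>" using \<alpha> by (intro ge_one_powr_ge_zero) auto
        with less show False by simp
      qed
      then have "D (Suc n) \<omega> powr 1 \<le> D (Suc n) \<omega> powr \<alpha>"
        using pos[of "Suc n"] \<alpha> by (intro powr_mono') auto
      then show "norm (D (Suc n) \<omega>) \<le> D (Suc n) \<omega> powr \<alpha>" using pos[of "Suc n"] by simp
    qed
    then have "summable (\<lambda>n. D (Suc n) \<omega>)" using sm by (rule summable_comparison_test_ev)
    then show "summable (\<lambda>n. D n \<omega>)" by (subst (asm) summable_Suc_iff)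
  qed
qed

lemma dominated_path:
  assumes "\<omega> \<in> space M" "summable (\<lambda>n. D n \<omega>)"
  shows "dominated_right_continuous (\<lambda>s. Z s \<omega>) (\<lambda>n. D n \<omega>)"
  by unfold_locales (auto intro: Z_right_continuous Z_le_D less_imp_le[OF Z_pos] assms)

lemma AE_dominated_path: "AE \<omega> in M. dominated_right_continuous (\<lambda>s. Z s \<omega>) (\<lambda>n. D n \<omega>)"
  using AE_summable_D AE_space by eventually_elim (rule dominated_path)

lemma AE_set_integrable: "AE \<omega> in M. set_integrable lborel {0..} (\<lambda>s. Z s \<omega>)"
  using AE_dominated_path by eventually_elim (rule dominated_right_continuous.integrable_Z)

text \<open>
  By right-continuity the path value at \<open>(\<omega>, s)\<close> is a limit of step functions in \<open>s\<close>, and these are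
  jointly measurable because the grid is countable.
\<close>
lemma measurable_X: "random_variable borel X"
proof -
  define h where "h m = inverse (real (Suc m))" for m
  have h: "0 < h m" "h \<longlonglongrightarrow> 0" for m
    using LIMSEQ_inverse_real_of_nat by (auto simp: h_def[abs_def])
  have rc: "right_continuous (\<lambda>s. Z s \<omega>)" if "\<omega> \<in> space M" for \<omega>
    by unfold_locales (rule Z_right_continuous[OF that])
  have "(\<lambda>(\<omega>, s). indicator {0..} s * Z s \<omega>) \<in> borel_measurable (M \<Otimes>\<^sub>M lborel)"
  proof (rule borel_measurable_LIMSEQ_real)
    fix y :: "'a \<times> real" assume y: "y \<in> space (M \<Otimes>\<^sub>M lborel)"
    then show "(\<lambda>m. (\<lambda>(\<omega>, s). grid_step (\<lambda>s. Z s \<omega>) (h m) s) y) \<longlonglongrightarrow> (\<lambda>(\<omega>, s). indicator {0..} s * Z s \<omega>) y"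
      using right_continuous.step_tendsto[OF rc h, of "fst y" "snd y"]
      by (auto simp: space_pair_measure split: prod.split)
  next
    fix m
    have "(\<lambda>y. Z (real (Suc (nat \<lfloor>snd y / h m\<rfloor>)) * h m) (fst y)) \<in> borel_measurable (M \<Otimes>\<^sub>M lborel)"
    proof (rule measurable_compose_countable[where f = "\<lambda>k y. Z (real (Suc k) * h m) (fst y)"])
      show "(\<lambda>y. Z (real (Suc k) * h m) (fst y)) \<in> borel_measurable (M \<Otimes>\<^sub>M lborel)" for k
        by (rule measurable_compose[OF measurable_fst measurable_Z]) (simp add: h_def)
      have "(\<lambda>y. nat \<lfloor>snd y / h m\<rfloor>) \<in> measurable (M \<Otimes>\<^sub>M borel) (count_space UNIV)" by measurable
      then show "(\<lambda>y. nat \<lfloor>snd y / h m\<rfloor>) \<in> measurable (M \<Otimes>\<^sub>M lborel) (count_space UNIV)"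
        by (simp cong: measurable_cong_sets)
    qed
    then have "(\<lambda>y. indicator {0..} (snd y) * Z (real (Suc (nat \<lfloor>snd y / h m\<rfloor>)) * h m) (fst y)) \<in> borel_measurable (M \<Otimes>\<^sub>M lborel)"
      by measurable
    then show "(\<lambda>(\<omega>, s). grid_step (\<lambda>s. Z s \<omega>) (h m) s) \<in> borel_measurable (M \<Otimes>\<^sub>M lborel)"
      by (simp add: grid_step_def split_beta' cong: measurable_cong_simp)
  qed
  then have "(\<lambda>\<omega>. \<integral>s. indicator {0..} s * Z s \<omega> \<partial>lborel) \<in> borel_measurable M"
    by (rule lborel.borel_measurable_lebesgue_integral)
  then show ?thesis by (simp add: X_def[abs_def] set_lebesgue_integral_def)
qed

definition increments :: "real \<Rightarrow> nat \<Rightarrow> 'a \<Rightarrow> nat \<times> nat"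
  where "increments h k \<omega> = (Pp (real (Suc k) * h) \<omega> - Pp (real k * h) \<omega>, Pm (real (Suc k) * h) \<omega> - Pm (real k * h) \<omega>)"

definition increment_pmf :: "real \<Rightarrow> (nat \<times> nat) pmf"
  where "increment_pmf h = pair_pmf (poisson_pmf h) (poisson_pmf (z * h))"

definition weight :: "nat \<times> nat \<Rightarrow> real"
  where "weight x = q ^ fst x / q ^ snd x"

lemma grid: "0 \<le> h \<Longrightarrow> 0 \<le> real k * h" "0 \<le> h \<Longrightarrow> real k * h \<le> real (Suc k) * h" for h :: real
  by (auto simp: algebra_simps)

lemma measurable_dP:
  assumes h: "0 \<le> h"
  shows "random_variable (count_space UNIV) (\<lambda>\<omega>. Pp (real (Suc k) * h) \<omega> - Pp (real k * h) \<omega>)"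
    "random_variable (count_space UNIV) (\<lambda>\<omega>. Pm (real (Suc k) * h) \<omega> - Pm (real k * h) \<omega>)"
  using grid[OF h] by (intro measurable_count_space_binop[where g = "(-)"] measurable_P; simp del: of_nat_Suc)+

lemma measurable_increments:
  assumes h: "0 \<le> h"
  shows "random_variable (count_space UNIV) (increments h k)"
  unfolding increments_def[abs_def] by (rule measurable_count_space_binop[where g = Pair, OF measurable_dP[OF h]])

text \<open>
  Identifies the Riemann sums of \<open>Z\<close> with perpetuities in the increments of the two processes.
\<close>
lemma Z_telescope:
  assumes \<omega>: "\<omega> \<in> space M" and h: "0 \<le> h"
  shows "(\<Prod>j\<le>k. weight (increments h j \<omega>)) = Z (real (Suc k) * h) \<omega>"
proof -
  have step: "weight (increments h j \<omega>) * Z (real j * h) \<omega> = Z (real (Suc j) * h) \<omega>" for j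
  proof -
    have "Pp (real j * h) \<omega> \<le> Pp (real (Suc j) * h) \<omega>" "Pm (real j * h) \<omega> \<le> Pm (real (Suc j) * h) \<omega>"
      using grid[OF h, of j] by (auto intro!: P_mono[OF \<omega>] simp del: of_nat_Suc)
    then show ?thesis using q
      by (simp add: weight_def increments_def Z_def power_add[symmetric] del: of_nat_Suc)
  qed
  have "Z 0 \<omega> = 1" using P_0[OF \<omega>] by (simp add: Z_def)
  show ?thesis
  proof (induction k)
    case 0
    show ?case using step[of 0] \<open>Z 0 \<omega> = 1\<close> by simp
  next
    case (Suc k)
    then show ?case using step[of "Suc k"] by (simp add: mult.commute del: of_nat_Suc)
  qed
qed

text \<open>
  The two processes are independent as random paths, so events that depend on finitely many
  coordinates of each factor.
\<close>
lemma prob_increments_rectangle: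
  assumes h: "0 \<le> h" and J: "finite J"
  shows "prob {\<omega> \<in> space M. \<forall>j\<in>J. increments h j \<omega> \<in> B j \<times> C j}
    = prob {\<omega> \<in> space M. \<forall>j\<in>J. fst (increments h j \<omega>) \<in> B j} * prob {\<omega> \<in> space M. \<forall>j\<in>J. snd (increments h j \<omega>) \<in> C j}"
proof -
  let ?S = "PiM {0..} (\<lambda>_. count_space UNIV :: nat measure)"
  let ?E = "\<lambda>A. {p \<in> space ?S. \<forall>j\<in>J. p (real (Suc j) * h) - p (real j * h) \<in> A j}"
  have E: "?E A \<in> sets ?S" for A
  proof -
    have m: "(\<lambda>p. p (real (Suc j) * h) - p (real j * h)) \<in> measurable ?S (count_space UNIV)" for j
      using grid[OF h]
      by (intro measurable_count_space_binop[where g = "(-)"] measurable_component_singleton) (auto simp del: of_nat_Suc)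
    have "Measurable.pred ?S (\<lambda>p. p (real (Suc j) * h) - p (real j * h) \<in> A j)" for j
      by (rule measurable_compose[OF m]) simp
    then show ?thesis using J by measurable
  qed
  have emb: "(\<lambda>t\<in>{0..}. P t \<omega>) \<in> space ?S" for P :: "real \<Rightarrow> 'a \<Rightarrow> nat" and \<omega>
    by (simp add: space_PiM)
  have r: "(\<lambda>t\<in>{0..}. P t \<omega>) (real k * h) = P (real k * h) \<omega>" for P :: "real \<Rightarrow> 'a \<Rightarrow> nat" and \<omega> k
    using grid[OF h, of k] by simp
  have p: "(\<lambda>\<omega>. \<lambda>t\<in>{0..}. P t \<omega>) -` ?E A \<inter> space M
      = {\<omega> \<in> space M. \<forall>j\<in>J. P (real (Suc j) * h) \<omega> - P (real j * h) \<omega> \<in> A j}" for P :: "real \<Rightarrow> 'a \<Rightarrow> nat" and A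
    by (auto simp only: vimage_def mem_Collect_eq emb r Int_iff simp_thms)
  have "(\<lambda>\<omega>. (\<lambda>t\<in>{0..}. Pp t \<omega>, \<lambda>t\<in>{0..}. Pm t \<omega>)) -` (?E B \<times> ?E C) \<inter> space M
      = ((\<lambda>\<omega>. \<lambda>t\<in>{0..}. Pp t \<omega>) -` ?E B \<inter> space M) \<inter> ((\<lambda>\<omega>. \<lambda>t\<in>{0..}. Pm t \<omega>) -` ?E C \<inter> space M)"
    by auto
  also have "\<dots> = {\<omega> \<in> space M. \<forall>j\<in>J. increments h j \<omega> \<in> B j \<times> C j}"
    unfolding p by (auto simp: increments_def)
  finally show ?thesis
    using indep_varD[OF indep[unfolded indep_processes_def] E[of B] E[of C]]
    unfolding p by (simp add: increments_def)
qed

lemma prob_increments_coordinate: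
  assumes h: "0 \<le> h"
  shows "prob {\<omega> \<in> space M. \<forall>j\<in>{..<Suc N}. fst (increments h j \<omega>) \<in> B j} = (\<Prod>j<Suc N. prob {\<omega> \<in> space M. fst (increments h j \<omega>) \<in> B j})"
    and "prob {\<omega> \<in> space M. \<forall>j\<in>{..<Suc N}. snd (increments h j \<omega>) \<in> B j} = (\<Prod>j<Suc N. prob {\<omega> \<in> space M. snd (increments h j \<omega>) \<in> B j})"
proof -
  have mono: "0 \<le> real 0 * h \<and> (\<forall>i<Suc N. real i * h \<le> real (Suc i) * h)" using grid[OF h] by simp
  have *: "prob {\<omega> \<in> space M. \<forall>j\<in>{..<Suc N}. Y j \<omega> \<in> B j} = (\<Prod>j<Suc N. prob {\<omega> \<in> space M. Y j \<omega> \<in> B j})"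
    if "indep_vars (\<lambda>_. count_space UNIV) Y {..<Suc N}" for Y :: "nat \<Rightarrow> 'a \<Rightarrow> nat"
  proof -
    have "(\<Inter>i\<in>{..<Suc N}. Y i -` B i \<inter> space M) = {\<omega> \<in> space M. \<forall>j\<in>{..<Suc N}. Y j \<omega> \<in> B j}" by auto
    moreover have "Y i -` B i \<inter> space M = {\<omega> \<in> space M. Y i \<omega> \<in> B i}" for i by auto
    ultimately show ?thesis using indep_varsD_finite[OF that, of B] by auto
  qed
  have "indep_vars (\<lambda>_. count_space UNIV) (\<lambda>j \<omega>. fst (increments h j \<omega>)) {..<Suc N}"
  proof -
    have "\<forall>n (t :: nat \<Rightarrow> real). 0 \<le> t 0 \<and> (\<forall>i<n. t i \<le> t (Suc i)) \<longrightarrow>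
        indep_vars (\<lambda>_. count_space UNIV) (\<lambda>i \<omega>. Pp (t (Suc i)) \<omega> - Pp (t i) \<omega>) {..<n}"
      using poisson(1) unfolding poisson_process_def by (elim conjE)
    from mp[OF spec[OF spec[OF this, of "Suc N"], of "\<lambda>k. real k * h"] mono]
    show ?thesis by (simp only: increments_def fst_conv)
  qed
  then show "prob {\<omega> \<in> space M. \<forall>j\<in>{..<Suc N}. fst (increments h j \<omega>) \<in> B j} = (\<Prod>j<Suc N. prob {\<omega> \<in> space M. fst (increments h j \<omega>) \<in> B j})"
    by (rule *)
  have "indep_vars (\<lambda>_. count_space UNIV) (\<lambda>j \<omega>. snd (increments h j \<omega>)) {..<Suc N}"
  proof -
    have "\<forall>n (t :: nat \<Rightarrow> real). 0 \<le> t 0 \<and> (\<forall>i<n. t i \<le> t (Suc i)) \<longrightarrow>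
        indep_vars (\<lambda>_. count_space UNIV) (\<lambda>i \<omega>. Pm (t (Suc i)) \<omega> - Pm (t i) \<omega>) {..<n}"
      using poisson(2) unfolding poisson_process_def by (elim conjE)
    from mp[OF spec[OF spec[OF this, of "Suc N"], of "\<lambda>k. real k * h"] mono]
    show ?thesis by (simp only: increments_def snd_conv)
  qed
  then show "prob {\<omega> \<in> space M. \<forall>j\<in>{..<Suc N}. snd (increments h j \<omega>) \<in> B j} = (\<Prod>j<Suc N. prob {\<omega> \<in> space M. snd (increments h j \<omega>) \<in> B j})"
    by (rule *)
qed

text \<open>
  Rectangles generate the discrete sigma-algebra on pairs, and on rectangles independence follows
  from that of the two processes and that of the increments of each.
\<close>
lemma indep_increments:
  assumes h: "0 \<le> h"
  shows "indep_vars (\<lambda>_. count_space UNIV) (increments h) {..<N}"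
proof -
  let ?E = "{B \<times> C |B C. True} :: (nat \<times> nat) set set"
  have gen: "sets (count_space UNIV) = sigma_sets (space (count_space UNIV)) ?E"
  proof -
    have "A \<in> sigma_sets UNIV ?E" for A :: "(nat \<times> nat) set"
    proof -
      have "{x} \<in> sigma_sets UNIV ?E" for x :: "nat \<times> nat"
      proof (rule sigma_sets.Basic)
        have "{x} = {fst x} \<times> {snd x}" by auto
        then show "{x} \<in> ?E" by blast
      qed
      then have "\<Union> ((\<lambda>x. {x}) ` A) \<in> sigma_sets UNIV ?E"
        by (intro sigma_sets_UNION) auto
      then show ?thesis by simp
    qed
    then show ?thesis by auto
  qed
  have "indep_vars (\<lambda>_. count_space UNIV) (increments h) {..<Suc N}"
  proof (subst indep_vars_finite[where E = "\<lambda>_. ?E"])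
    show "Int_stable ?E"
    proof (rule Int_stableI)
      fix a b assume "a \<in> ?E" "b \<in> ?E"
      then obtain B C B' C' where "a = B \<times> C" "b = B' \<times> C'" by blast
      then have "a \<inter> b = (B \<inter> B') \<times> (C \<inter> C')" by (simp add: Times_Int_Times)
      then show "a \<inter> b \<in> ?E" by blast
    qed
    show "space (count_space UNIV) \<in> ?E" by (auto intro!: exI[of _ UNIV])
    show "\<forall>A\<in>(\<Pi> i\<in>{..<Suc N}. ?E). prob (\<Inter>j\<in>{..<Suc N}. increments h j -` A j \<inter> space M)
        = (\<Prod>j\<in>{..<Suc N}. prob (increments h j -` A j \<inter> space M))"
    proof
      fix A assume "A \<in> (\<Pi> i\<in>{..<Suc N}. ?E)"
      then have "\<forall>j\<in>{..<Suc N}. \<exists>B C. A j = B \<times> C" by (auto simp: Pi_iff)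
      then obtain B C where A: "\<And>j. j < Suc N \<Longrightarrow> A j = B j \<times> C j"
        by (metis lessThan_iff)
      have "(\<Inter>j\<in>{..<Suc N}. increments h j -` A j \<inter> space M)
          = {\<omega> \<in> space M. \<forall>j\<in>{..<Suc N}. increments h j \<omega> \<in> B j \<times> C j}" using A by auto
      moreover have "prob (increments h j -` A j \<inter> space M)
          = prob {\<omega> \<in> space M. fst (increments h j \<omega>) \<in> B j} * prob {\<omega> \<in> space M. snd (increments h j \<omega>) \<in> C j}"
        if "j < Suc N" for j
      proof -
        have "increments h j -` A j \<inter> space M = {\<omega> \<in> space M. \<forall>j\<in>{j}. increments h j \<omega> \<in> B j \<times> C j}"
          using A[OF that] by auto
        then show ?thesis using prob_increments_rectangle[OF h, of "{j}" B C] by simp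
      qed
      ultimately show "prob (\<Inter>j\<in>{..<Suc N}. increments h j -` A j \<inter> space M)
        = (\<Prod>j\<in>{..<Suc N}. prob (increments h j -` A j \<inter> space M))"
        using prob_increments_rectangle[OF h, of "{..<Suc N}" B C] prob_increments_coordinate[OF h, where N = N]
        by (simp only: finite_lessThan prod.distrib[symmetric]) (intro prod.cong, auto)
    qed
  qed (use gen measurable_increments[OF h] in auto)
  then show ?thesis by (rule indep_vars_subset) auto
qed

lemma law_increments:
  assumes h: "0 < h"
  shows "distr M (count_space UNIV) (increments h k) = measure_pmf (increment_pmf h)"
proof (rule measure_eqI_countable[of _ UNIV])
  fix x :: "nat \<times> nat"
  have lt: "real k * h < real (Suc k) * h" "0 \<le> real k * h" "real (Suc k) * h - real k * h = h"
    using h by (auto simp: algebra_simps)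
  have 1: "prob {\<omega> \<in> space M. fst (increments h k \<omega>) = a} = pmf (poisson_pmf h) a" for a
  proof -
    have "prob {\<omega> \<in> space M. fst (increments h k \<omega>) = a}
      = measure (distr M (count_space UNIV) (\<lambda>\<omega>. Pp (real (Suc k) * h) \<omega> - Pp (real k * h) \<omega>)) {a}"
      using measurable_dP[of h k] h by (subst measure_distr) (auto simp: increments_def intro!: arg_cong[where f = prob])
    then show ?thesis unfolding law_P(1)[OF lt(2,1)] lt(3) by (simp only: measure_pmf_single)
  qed
  have 2: "prob {\<omega> \<in> space M. snd (increments h k \<omega>) = a} = pmf (poisson_pmf (z * h)) a" for a
  proof -
    have "prob {\<omega> \<in> space M. snd (increments h k \<omega>) = a}
      = measure (distr M (count_space UNIV) (\<lambda>\<omega>. Pm (real (Suc k) * h) \<omega> - Pm (real k * h) \<omega>)) {a}"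
      using measurable_dP[of h k] h by (subst measure_distr) (auto simp: increments_def intro!: arg_cong[where f = prob])
    then show ?thesis unfolding law_P(2)[OF lt(2,1)] lt(3) by (simp only: measure_pmf_single)
  qed
  have "emeasure (distr M (count_space UNIV) (increments h k)) {x}
      = prob {\<omega> \<in> space M. \<forall>j\<in>{k}. increments h j \<omega> \<in> {fst x} \<times> {snd x}}"
    using measurable_increments[of h k] h
    by (subst emeasure_distr) (auto simp: emeasure_eq_measure prod_eq_iff intro!: arg_cong[where f = prob])
  also have "\<dots> = pmf (increment_pmf h) x"
  proof -
    have "pmf (increment_pmf h) x = pmf (poisson_pmf h) (fst x) * pmf (poisson_pmf (z * h)) (snd x)"
      by (cases x) (simp only: increment_pmf_def pmf_pair fst_conv snd_conv)
    then show ?thesis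
      using h by (subst prob_increments_rectangle) (simp_all add: 1 2 del: pmf_poisson)
  qed
  finally show "emeasure (distr M (count_space UNIV) (increments h k)) {x} = emeasure (measure_pmf (increment_pmf h)) {x}"
    by (simp add: emeasure_pmf_single)
qed auto

definition grid_X :: "real \<Rightarrow> 'a \<Rightarrow> real"
  where "grid_X h \<omega> = h * (\<Sum>k. Z (real (Suc k) * h) \<omega>)"

definition grid_char :: "real \<Rightarrow> real \<Rightarrow> complex"
  where "grid_char h t = (CLINT \<omega>|M. iexp (t * grid_X h \<omega>))"

lemma measurable_grid_X[measurable]: "0 < h \<Longrightarrow> random_variable borel (grid_X h)"
  unfolding grid_X_def[abs_def]
  by (intro borel_measurable_times borel_measurable_const borel_measurable_suminf measurable_Z) simp

lemma perpetuity_char_tendsto_grid_char: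
  assumes h: "0 < h" "h \<le> 1"
  shows "(\<lambda>N. perpetuity_char h weight (increment_pmf h) N t) \<longlonglongrightarrow> grid_char h t"
proof -
  have "perpetuity_char h weight (increment_pmf h) N t = (CLINT \<omega>|M. iexp (t * (h * (\<Sum>k<N. Z (real (Suc k) * h) \<omega>))))" for N
  proof -
    have "perpetuity_char h weight (increment_pmf h) N t
        = (CLINT \<omega>|M. iexp (t * (h * (\<Sum>k<N. \<Prod>j\<le>k. weight (increments h j \<omega>)))))"
      using h by (intro expectation_iexp_perpetuity[symmetric] indep_increments law_increments) auto
    also have "\<dots> = (CLINT \<omega>|M. iexp (t * (h * (\<Sum>k<N. Z (real (Suc k) * h) \<omega>))))"
      using h by (intro Bochner_Integration.integral_cong refl) (simp only: Z_telescope less_imp_le)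
    finally show ?thesis .
  qed
  moreover have "(\<lambda>N. CLINT \<omega>|M. iexp (t * (h * (\<Sum>k<N. Z (real (Suc k) * h) \<omega>)))) \<longlonglongrightarrow> grid_char h t"
    unfolding grid_char_def
  proof (rule integral_dominated_convergence[where w = "\<lambda>_. 1"])
    show "AE \<omega> in M. (\<lambda>N. iexp (t * (h * (\<Sum>k<N. Z (real (Suc k) * h) \<omega>)))) \<longlonglongrightarrow> iexp (t * grid_X h \<omega>)"
      using AE_dominated_path
    proof eventually_elim
      fix \<omega> assume "dominated_right_continuous (\<lambda>s. Z s \<omega>) (\<lambda>n. D n \<omega>)"
      then have "summable (\<lambda>k. Z (real (Suc k) * h) \<omega>)"
        using dominated_right_continuous.grid_sum(1) h by blast
      then have "(\<lambda>N. \<Sum>k<N. Z (real (Suc k) * h) \<omega>) \<longlonglongrightarrow> (\<Sum>k. Z (real (Suc k) * h) \<omega>)"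
        by (rule summable_LIMSEQ)
      then show "(\<lambda>N. iexp (t * (h * (\<Sum>k<N. Z (real (Suc k) * h) \<omega>)))) \<longlonglongrightarrow> iexp (t * grid_X h \<omega>)"
        unfolding grid_X_def by (intro tendsto_intros)
    qed
    show "(\<lambda>\<omega>. iexp (t * (h * (\<Sum>k<N. Z (real (Suc k) * h) \<omega>)))) \<in> borel_measurable M" for N
    proof -
      have [measurable]: "Z (real (Suc k) * h) \<in> borel_measurable M" for k
        using h by (intro measurable_Z) simp
      show ?thesis by measurable
    qed
    show "(\<lambda>\<omega>. iexp (t * grid_X h \<omega>)) \<in> borel_measurable M" using measurable_grid_X[OF h(1)] by measurable
  qed auto
  ultimately show ?thesis by simp
qed

lemma grid_char_equation:
  assumes h: "0 < h" "h \<le> 1"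
  shows "grid_char h t = (CLINT x|measure_pmf (increment_pmf h). iexp (t * (weight x * h)) * grid_char h (t * weight x))"
proof (rule LIMSEQ_unique)
  show "(\<lambda>N. perpetuity_char h weight (increment_pmf h) (Suc N) t) \<longlonglongrightarrow> grid_char h t"
    by (rule LIMSEQ_Suc[OF perpetuity_char_tendsto_grid_char[OF h]])
  show "(\<lambda>N. perpetuity_char h weight (increment_pmf h) (Suc N) t)
      \<longlonglongrightarrow> (CLINT x|measure_pmf (increment_pmf h). iexp (t * (weight x * h)) * grid_char h (t * weight x))"
    unfolding perpetuity_char.simps
    by (rule integral_dominated_convergence[where w = "\<lambda>_. 1"])
       (auto intro!: tendsto_intros perpetuity_char_tendsto_grid_char[OF h] simp: norm_mult norm_perpetuity_char_le_1)
qed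

lemma norm_grid_char_le_1: "cmod (grid_char h t) \<le> 1"
  unfolding grid_char_def by (rule norm_expectation_le_1) simp

text \<open>
  The three terms are the contributions of no jump, one jump of \<open>Pp\<close> and one jump of \<open>Pm\<close> during the
  first grid interval; all other cases together have the probability on the right.
\<close>
lemma grid_char_one_jump:
  assumes h: "0 < h" "h \<le> 1"
  defines "p \<equiv> exp (- (1 + z) * h)"
  shows "cmod (grid_char h t - (p * (iexp (t * h) * grid_char h t) + p * h * (iexp (t * (q * h)) * grid_char h (q * t))
      + p * (z * h) * (iexp (t * (h / q)) * grid_char h (t / q)))) \<le> 1 - p * (1 + h + z * h)"
proof -
  let ?g = "\<lambda>x. iexp (t * (weight x * h)) * grid_char h (t * weight x)"
  let ?F = "{(0, 0), (1, 0), (0, 1)} :: (nat \<times> nat) set"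
  have zh: "0 < z * h" using z h by simp
  have pmf: "pmf (increment_pmf h) (0, 0) = p" "pmf (increment_pmf h) (Suc 0, 0) = p * h"
    "pmf (increment_pmf h) (0, Suc 0) = p * (z * h)"
    using h zh by (simp_all add: increment_pmf_def pmf_pair p_def exp_add[symmetric] algebra_simps)
  have w: "weight (0, 0) = 1" "weight (Suc 0, 0) = q" "weight (0, Suc 0) = 1 / q" by (simp_all add: weight_def)
  have "cmod ((CLINT x|measure_pmf (increment_pmf h). ?g x) - (\<Sum>x\<in>?F. pmf (increment_pmf h) x * ?g x))
      \<le> 1 - (\<Sum>x\<in>?F. pmf (increment_pmf h) x)"
    by (rule expectation_pmf_near_finite_sum) (simp_all add: norm_mult norm_grid_char_le_1)
  then show ?thesis
    unfolding grid_char_equation[OF h, symmetric] by (simp add: pmf w algebra_simps)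
qed

lemma grid_char_tendsto:
  assumes h: "\<And>m. 0 < h m" "\<And>m. h m \<le> 1" "h \<longlonglongrightarrow> 0"
  shows "(\<lambda>m. grid_char (h m) t) \<longlonglongrightarrow> char (distr M borel X) t"
proof -
  have "(\<lambda>m. grid_char (h m) t) \<longlonglongrightarrow> (CLINT \<omega>|M. iexp (t * X \<omega>))"
    unfolding grid_char_def
  proof (rule integral_dominated_convergence[where w = "\<lambda>_. 1"])
    show "AE \<omega> in M. (\<lambda>m. iexp (t * grid_X (h m) \<omega>)) \<longlonglongrightarrow> iexp (t * X \<omega>)"
      using AE_dominated_path
    proof eventually_elim
      fix \<omega> assume "dominated_right_continuous (\<lambda>s. Z s \<omega>) (\<lambda>n. D n \<omega>)"
      from dominated_right_continuous.riemann_sums_tendsto[OF this h]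
      have "(\<lambda>m. grid_X (h m) \<omega>) \<longlonglongrightarrow> X \<omega>" by (simp only: grid_X_def X_def)
      then show "(\<lambda>m. iexp (t * grid_X (h m) \<omega>)) \<longlonglongrightarrow> iexp (t * X \<omega>)" by (intro tendsto_intros)
    qed
    show "(\<lambda>\<omega>. iexp (t * X \<omega>)) \<in> borel_measurable M" using measurable_X by measurable
    show "(\<lambda>\<omega>. iexp (t * grid_X (h m) \<omega>)) \<in> borel_measurable M" for m
      using measurable_grid_X[OF h(1)[of m]] by measurable
  qed auto
  also have "(CLINT \<omega>|M. iexp (t * X \<omega>)) = char (distr M borel X) t"
    unfolding char_def using measurable_X by (intro integral_distr[symmetric]) auto
  finally show ?thesis .
qed

text \<open>
  Divide the estimate over one grid interval by \<open>h\<close>. The probability of two or more jumps is of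
  smaller order than \<open>h\<close>, and the coefficient of \<open>\<phi> t\<close> tends to \<open>1 + z - \<i> t\<close>.
\<close>
lemma char_X_equation:
  defines "\<phi> \<equiv> char (distr M borel X)"
  shows "(of_real (1 + z) - \<i> * of_real t) * \<phi> t = \<phi> (q * t) + of_real z * \<phi> (t / q)"
proof -
  define h where "h m = inverse (real (Suc m))" for m
  have h: "0 < h m" "h m \<le> 1" "h \<longlonglongrightarrow> 0" for m
    using LIMSEQ_inverse_real_of_nat by (auto simp: h_def[abs_def] inverse_le_1_iff)
  have hr: "filterlim h (at_right 0) sequentially"
    using h(1,3) unfolding filterlim_at by (auto intro!: always_eventually simp: less_imp_neq[THEN not_sym])
  define p where "p m = exp (- (1 + z) * h m)" for m
  define c where "c = - of_real (1 + z) + \<i> * of_real t"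
  let ?g = "\<lambda>m. grid_char (h m)"
  \<comment> \<open>The left-hand side of \<open>grid_char_one_jump\<close>, before taking the modulus, divided by \<open>h m\<close>.\<close>
  define L where "L m = (1 - p m * iexp (t * h m)) / h m * ?g m t
    - p m * (iexp (t * (q * h m)) * ?g m (q * t)) - p m * z * (iexp (t * (h m / q)) * ?g m (t / q))" for m
  have p1: "p \<longlonglongrightarrow> 1"
  proof -
    have "(\<lambda>m. exp (- (1 + z) * h m)) \<longlonglongrightarrow> exp (- (1 + z) * 0)" by (intro tendsto_intros h)
    then show ?thesis by (simp add: p_def[abs_def])
  qed
  have e1: "(\<lambda>m. iexp (t * (r * h m))) \<longlonglongrightarrow> 1" for r
  proof -
    have "(\<lambda>m. iexp (t * (r * h m))) \<longlonglongrightarrow> iexp (t * (r * 0))" by (intro tendsto_intros h)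
    then show ?thesis by simp
  qed
  have e2: "(\<lambda>m. iexp (t * (h m / q))) \<longlonglongrightarrow> 1" using e1[of "1 / q"] by simp
  have quot: "(\<lambda>m. (1 - p m * iexp (t * h m)) / h m) \<longlonglongrightarrow> - c"
  proof -
    have "((\<lambda>w. exp (w * c)) has_field_derivative c) (at 0)" by (auto intro!: derivative_eq_intros)
    then have "(\<lambda>w. (exp (w * c) - 1) / w) \<midarrow>0\<rightarrow> c" by (simp add: DERIV_def)
    moreover have "filterlim (\<lambda>m. complex_of_real (h m)) (at 0) sequentially"
      using h(1,3) unfolding filterlim_at
      by (auto intro!: always_eventually tendsto_eq_intros simp: less_imp_neq[THEN not_sym])
    ultimately have "(\<lambda>m. (exp (of_real (h m) * c) - 1) / of_real (h m)) \<longlonglongrightarrow> c"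
      by (rule filterlim_compose)
    then have "(\<lambda>m. - ((exp (of_real (h m) * c) - 1) / of_real (h m))) \<longlonglongrightarrow> - c" by (rule tendsto_minus)
    moreover have "exp (of_real (h m) * c) = p m * iexp (t * h m)" for m
      by (simp add: p_def c_def exp_of_real[symmetric] exp_add[symmetric] algebra_simps)
    ultimately show ?thesis by (simp add: diff_divide_distrib)
  qed
  have "L \<longlonglongrightarrow> - c * \<phi> t - of_real 1 * (1 * \<phi> (q * t)) - of_real (1 * z) * (1 * \<phi> (t / q))"
    unfolding L_def \<phi>_def
    by (intro tendsto_diff tendsto_mult tendsto_of_real tendsto_const quot p1 e1 e2 grid_char_tendsto[OF h])
  moreover have "L \<longlonglongrightarrow> 0"
  proof (rule Lim_null_comparison)
    show "\<forall>\<^sub>F m in sequentially. norm (L m) \<le> (1 - exp (- (1 + z) * h m) * (1 + h m + z * h m)) / h m"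
    proof (intro always_eventually allI)
      fix m
      let ?K = "?g m t - (p m * (iexp (t * h m) * ?g m t) + p m * h m * (iexp (t * (q * h m)) * ?g m (q * t))
        + p m * (z * h m) * (iexp (t * (h m / q)) * ?g m (t / q)))"
      have "L m = ?K / h m" using h(1)[of m] by (simp add: L_def field_simps)
      then have "norm (L m) = norm ?K / h m" using h(1)[of m] by (simp add: norm_divide)
      also have "\<dots> \<le> (1 - exp (- (1 + z) * h m) * (1 + h m + z * h m)) / h m"
        using grid_char_one_jump[OF h(1,2)[of m], of t] h(1)[of m] unfolding p_def by (intro divide_right_mono) auto
      finally show "norm (L m) \<le> (1 - exp (- (1 + z) * h m) * (1 + h m + z * h m)) / h m" .
    qed
    have "((\<lambda>h. (1 - exp (- (1 + z) * h) * (1 + h + z * h)) / h) \<longlongrightarrow> 0) (at_right 0)"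
      by real_asymp
    from filterlim_compose[OF this hr]
    show "(\<lambda>m. (1 - exp (- (1 + z) * h m) * (1 + h m + z * h m)) / h m) \<longlonglongrightarrow> 0" .
  qed
  ultimately have "- c * \<phi> t - of_real 1 * (1 * \<phi> (q * t)) - of_real (1 * z) * (1 * \<phi> (t / q)) = 0"
    by (rule LIMSEQ_unique)
  then show ?thesis by (simp add: c_def algebra_simps)
qed

end

section \<open>Equality in law\<close>

lemma (in poisson_pair_functional) exp_functional_law:
  fixes N :: "'b measure"
  assumes N: "prob_space N" and \<epsilon>: "prob_space.iid_std_exponential N \<epsilon>"
    and G: "prob_space.indep_geometric_seq N q z G"
    and ind: "prob_space.indep_var N borel (I_q q \<epsilon>) borel (q_gamma q G)"
  shows "distr M borel X = distr N borel (\<lambda>\<omega>. q powi (- int (\<Sum>n. G n \<omega>)) * I_q q \<epsilon> \<omega>)"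
proof -
  interpret N: prob_space N by fact
  have z1: "z < 1" using q \<mu> powr_less_mono2[of \<mu> q 1] by simp
  have Sm: "(\<lambda>\<omega>. \<Sum>n. G n \<omega>) \<in> measurable N (count_space UNIV)"
    using G by (intro measurable_suminf_nat) (auto simp: N.indep_geometric_seq_def N.indep_vars_def)
  have Ym: "(\<lambda>\<omega>. q powi (- int (\<Sum>n. G n \<omega>)) * I_q q \<epsilon> \<omega>) \<in> borel_measurable N"
    by (intro borel_measurable_times N.I_q_measurable[OF \<epsilon>]
        measurable_compose[OF Sm, of "\<lambda>k. q powi (- int k)"]) simp
  show ?thesis
  proof (rule q_difference_equation_law_unique)
    show "0 \<le> z" using z by simp
    show "real_distribution (distr M borel X)" by (rule real_distribution_distr[OF measurable_X])
    show "real_distribution (distr N borel (\<lambda>\<omega>. q powi (- int (\<Sum>n. G n \<omega>)) * I_q q \<epsilon> \<omega>))"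
      by (rule N.real_distribution_distr[OF Ym])
  qed (rule char_X_equation N.char_quotient_equation[OF q _ z1 \<epsilon> G ind]; use z in simp)+
qed

section \<open>The q-gamma law and its limit\<close>

lemma (in prob_space) q_gamma_measurable:
  assumes "indep_geometric_seq q a G"
  shows "random_variable borel (q_gamma q G)"
proof -
  have "random_variable (count_space UNIV) (\<lambda>\<omega>. \<Sum>n. G n \<omega>)" using assms
    by (intro measurable_suminf_nat) (auto simp: indep_geometric_seq_def indep_vars_def)
  then show ?thesis unfolding q_gamma_def[abs_def]
    by (rule measurable_compose[where g = "\<lambda>k. inverse (1 - q) * q ^ k"]) simp
qed

text \<open>
  The size-bias identity in terms of \<open>R = q_gamma q G\<close>: here \<open>q^S = (1 - q) R\<close>, and the shift of \<open>S\<close> by 1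
  multiplies \<open>R\<close> by \<open>q\<close>. A bound for \<open>f\<close> on the range of \<open>R\<close> suffices, so that the
  identity also yields the first two moments of \<open>R\<close>.
\<close>
lemma (in prob_space) q_gamma_stein:
  fixes f :: "real \<Rightarrow> 'b::{banach, second_countable_topology}"
  assumes q: "0 < q" "q < 1" and a: "0 \<le> a" "a < 1" and G: "indep_geometric_seq q a G"
    and bdd: "\<And>x. 0 \<le> x \<Longrightarrow> x \<le> inverse (1 - q) \<Longrightarrow> norm (f x) \<le> B"
  shows "(\<integral>\<omega>. f (q_gamma q G \<omega>) \<partial>M) - a *\<^sub>R (\<integral>\<omega>. f (q * q_gamma q G \<omega>) \<partial>M)
    = (1 - q) *\<^sub>R (\<integral>\<omega>. q_gamma q G \<omega> *\<^sub>R f (q_gamma q G \<omega>) \<partial>M)"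
proof -
  define S where "S \<omega> = (\<Sum>n. G n \<omega>)" for \<omega>
  have S[measurable]: "random_variable (count_space UNIV) S"
    unfolding S_def[abs_def] using G
    by (intro measurable_suminf_nat) (auto simp: indep_geometric_seq_def indep_vars_def)
  define r where "r k = inverse (1 - q) * q ^ k" for k
  have R: "q_gamma q G \<omega> = r (S \<omega>)" for \<omega> by (simp add: q_gamma_def r_def S_def)
  have r: "0 \<le> r k" "r k \<le> inverse (1 - q)" for k
    using q by (auto simp: r_def mult_left_le power_le_one)
  have fr: "norm (f (r k)) \<le> B" for k using bdd r by auto
  have B: "0 \<le> B" using fr[of 0] norm_ge_zero order_trans by blast
  have sb: "(\<integral>\<omega>. (1 - q ^ S \<omega>) *\<^sub>R f (r (S \<omega>)) \<partial>M) = a *\<^sub>R (\<integral>\<omega>. f (r (Suc (S \<omega>))) \<partial>M)"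
    unfolding S_def by (rule geometric_series_size_bias[OF q a G, of "\<lambda>k. f (r k)", OF fr])
  have i1: "integrable M (\<lambda>\<omega>. f (r (S \<omega>)))"
    by (rule integrable_const_bound[of _ B]) (auto simp: fr)
  have i2: "integrable M (\<lambda>\<omega>. r (S \<omega>) *\<^sub>R f (r (S \<omega>)))"
  proof (rule integrable_const_bound[of _ "inverse (1 - q) * B"])
    have "norm (r k *\<^sub>R f (r k)) \<le> inverse (1 - q) * B" for k
      unfolding norm_scaleR using r[of k] fr[of k] q by (intro mult_mono) auto
    then show "AE \<omega> in M. norm (r (S \<omega>) *\<^sub>R f (r (S \<omega>))) \<le> inverse (1 - q) * B" by simp
  qed measurable
  have "q ^ k = (1 - q) * r k" for k using q by (simp add: r_def)
  then have "(1 - q ^ S \<omega>) *\<^sub>R f (r (S \<omega>)) = f (r (S \<omega>)) - (1 - q) *\<^sub>R (r (S \<omega>) *\<^sub>R f (r (S \<omega>)))" for \<omega>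
    by (simp add: scaleR_diff_left)
  with sb have "(\<integral>\<omega>. f (r (S \<omega>)) \<partial>M) - (1 - q) *\<^sub>R (\<integral>\<omega>. r (S \<omega>) *\<^sub>R f (r (S \<omega>)) \<partial>M) = a *\<^sub>R (\<integral>\<omega>. f (r (Suc (S \<omega>))) \<partial>M)"
    using i1 i2 by (simp only: Bochner_Integration.integral_diff integrable_scaleR_right integral_scaleR_right)
  moreover have "r (Suc k) = q * r k" for k by (simp add: r_def)
  ultimately show ?thesis unfolding R by (simp add: algebra_simps)
qed

text \<open>
  The numbers \<open>b1\<close> and \<open>b1 * b2\<close> are the first two moments of \<open>R\<close>. The q-Stein identity for
  \<open>exp(\<i> s x)\<close> expresses the derivative of the characteristic function by a q-difference quotient, and
  the second moment controls the distance of that quotient from the derivative.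
\<close>
lemma (in prob_space) q_gamma_char_near_gamma:
  assumes q: "0 < q" "q < 1" and \<mu>: "0 < \<mu>" and G: "indep_geometric_seq q (q powr \<mu>) G"
  defines "b1 \<equiv> (1 - q powr \<mu>) / (1 - q)" and "b2 \<equiv> (1 - q powr (\<mu> + 1)) / (1 - q)"
  shows "cmod ((1 - \<i> * t) powr of_real \<mu> * char (distr M borel (q_gamma q G)) t - 1)
    \<le> (1 + \<bar>t\<bar>) powr \<mu> * (\<bar>b1 - \<mu>\<bar> + (1 - q powr \<mu>) * \<bar>t\<bar> * b1 + (1 - q) * t\<^sup>2 / 2 * (b1 * b2)) * \<bar>t\<bar>"
proof -
  define a where "a = q powr \<mu>"
  have a: "0 \<le> a" "a < 1" using q \<mu> powr_less_mono2[of \<mu> q 1] by (auto simp: a_def)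
  define R where "R = q_gamma q G"
  have Rm[measurable]: "random_variable borel R" unfolding R_def by (rule q_gamma_measurable[OF G])
  have R: "0 \<le> R \<omega>" "R \<omega> \<le> inverse (1 - q)" for \<omega>
    using q by (auto simp: R_def q_gamma_def mult_left_le power_le_one)
  note stein = q_gamma_stein[OF q a G[folded a_def], folded R_def]
  define \<rho> where "\<rho> = distr M borel R"
  interpret \<rho>: real_distribution \<rho> unfolding \<rho>_def by (rule real_distribution_distr) measurable
  have intR: "integrable M R" by (rule integrable_const_bound[of _ "inverse (1 - q)"]) (use R in auto)
  have sq: "(R \<omega>)\<^sup>2 \<le> (inverse (1 - q))\<^sup>2" for \<omega> using R by (intro power_mono)
  have intR2: "integrable M (\<lambda>\<omega>. (R \<omega>)\<^sup>2)"
    by (rule integrable_const_bound[of _ "(inverse (1 - q))\<^sup>2"]) (use sq in auto)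
  have m1: "expectation R = b1"
  proof -
    have "1 - a = (1 - q) * expectation R" using stein[of "\<lambda>_. 1::real" 1] by (simp add: prob_space)
    then show ?thesis using q by (simp add: b1_def a_def)
  qed
  have m2: "expectation (\<lambda>\<omega>. (R \<omega>)\<^sup>2) = b1 * b2"
  proof -
    have "b1 - a * (q * b1) = (1 - q) * expectation (\<lambda>\<omega>. (R \<omega>)\<^sup>2)"
      using stein[of "\<lambda>x. x" "inverse (1 - q)"] intR by (simp add: m1 power2_eq_square)
    moreover have "b1 - a * (q * b1) = (1 - q) * (b1 * b2)"
    proof -
      have "(1 - q) * b2 = 1 - a * q" using q by (simp add: b2_def a_def powr_add)
      then have eq: "(1 - q) * (b1 * b2) = b1 * (1 - a * q)" by (simp only: mult.left_commute[of "1 - q"])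
      show ?thesis unfolding eq by (simp add: algebra_simps)
    qed
    ultimately show ?thesis using q by simp
  qed
  have \<rho>1: "integrable \<rho> (\<lambda>x. x)" and \<rho>2: "integrable \<rho> (\<lambda>x. x\<^sup>2)"
    using intR intR2 by (simp_all add: \<rho>_def integrable_distr_eq)
  have e2: "\<rho>.expectation (\<lambda>x. x\<^sup>2) = b1 * b2" unfolding \<rho>_def by (subst integral_distr) (auto simp: m2)
  define D where "D s = (CLINT x|\<rho>. \<i> * x * iexp (s * x))" for s
  have D_M: "D s = \<i> * (CLINT \<omega>|M. R \<omega> *\<^sub>R iexp (s * R \<omega>))" for s
  proof -
    have "D s = (CLINT \<omega>|M. \<i> * R \<omega> * iexp (s * R \<omega>))" unfolding D_def \<rho>_def by (rule integral_distr) auto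
    also have "\<dots> = (CLINT \<omega>|M. \<i> * (R \<omega> *\<^sub>R iexp (s * R \<omega>)))" by (simp add: scaleR_conv_of_real mult.assoc)
    finally show ?thesis by (simp only: integral_mult_right_zero)
  qed
  have char_M: "char \<rho> s = (CLINT \<omega>|M. iexp (s * R \<omega>))" for s
    unfolding char_def \<rho>_def by (rule integral_distr) auto
  have D1: "cmod (D s) \<le> b1" for s
  proof -
    have "cmod (D s) \<le> (\<integral>\<omega>. cmod (R \<omega> *\<^sub>R iexp (s * R \<omega>)) \<partial>M)"
      unfolding D_M norm_mult by (simp del: norm_scaleR)
    also have "\<dots> = b1" using R by (simp add: m1)
    finally show ?thesis .
  qed
  have Dq: "(1 - q) * D s = \<i> * (char \<rho> s - a * char \<rho> (q * s))" for s
  proof -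
    let ?J = "CLINT \<omega>|M. R \<omega> *\<^sub>R iexp (s * R \<omega>)"
    have "(CLINT \<omega>|M. iexp (s * R \<omega>)) - a *\<^sub>R (CLINT \<omega>|M. iexp (s * (q * R \<omega>))) = (1 - q) *\<^sub>R ?J"
      by (rule stein[of "\<lambda>x. iexp (s * x)" 1]) simp
    moreover have "(CLINT \<omega>|M. iexp (s * (q * R \<omega>))) = char \<rho> (q * s)"
      unfolding char_M by (simp only: mult.assoc mult.left_commute)
    ultimately have "(1 - q) *\<^sub>R ?J = char \<rho> s - a *\<^sub>R char \<rho> (q * s)"
      by (simp only: char_M[symmetric])
    then have "\<i> * ((1 - q) *\<^sub>R ?J) = \<i> * (char \<rho> s - a *\<^sub>R char \<rho> (q * s))" by (rule arg_cong)
    then show ?thesis unfolding D_M scaleR_conv_of_real by (simp only: of_real_diff of_real_1 mult.left_commute[of \<i>])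
  qed
  have close: "cmod ((1 - \<i> * s) * D s - \<i> * \<mu> * char \<rho> s)
      \<le> \<bar>b1 - \<mu>\<bar> + (1 - a) * \<bar>t\<bar> * b1 + (1 - q) * t\<^sup>2 / 2 * (b1 * b2)" if s: "\<bar>s\<bar> \<le> \<bar>t\<bar>" for s
  proof -
    \<comment> \<open>The error of the linear approximation from \<open>s\<close> to \<open>q * s\<close>.\<close>
    define \<kappa> where "\<kappa> = char \<rho> (q * s) - char \<rho> s + ((1 - q) * s) * D s"
    have "s + - ((1 - q) * s) = q * s" by (simp add: algebra_simps)
    then have "\<kappa> = char \<rho> (s + - ((1 - q) * s)) - char \<rho> s - (- ((1 - q) * s)) *\<^sub>R D s"
      by (simp only: \<kappa>_def) (simp add: scaleR_conv_of_real)
    then have "cmod \<kappa> \<le> (- ((1 - q) * s))\<^sup>2 / 2 * (b1 * b2)"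
      using \<rho>.char_linear_approximation[OF \<rho>1 \<rho>2, of s "- ((1 - q) * s)", folded D_def] by (simp only: e2)
    then have "cmod \<kappa> / (1 - q) \<le> ((1 - q)\<^sup>2 * s\<^sup>2 / 2 * (b1 * b2)) / (1 - q)"
      using q by (intro divide_right_mono) (auto simp: power_mult_distrib)
    also have "\<dots> = (1 - q) * s\<^sup>2 / 2 * (b1 * b2)"
    proof -
      have gen: "(x\<^sup>2 * u / 2 * c) / x = x * u / 2 * c" if "x \<noteq> 0" for x u c :: real
        using that by (simp add: power2_eq_square)
      show ?thesis by (rule gen) (use q in simp)
    qed
    finally have \<kappa>: "cmod \<kappa> / (1 - q) \<le> (1 - q) * s\<^sup>2 / 2 * (b1 * b2)" .
    have alg: "(1 - \<i> * S) * d - \<i> * m * C = \<i> * (B - m) * C - \<i> * (1 - A) * S * d - \<i> * A * k"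
      if "(1 - Q) * B = 1 - A" "(1 - Q) * d = \<i> * (C - A * C')" "(1 - Q) * k = C' - C + ((1 - Q) * S) * d" "1 - Q \<noteq> 0"
      for Q S d m C B A k C' :: complex
    proof -
      have "(1 - Q) * ((1 - \<i> * S) * d - \<i> * m * C) = (1 - Q) * (\<i> * (B - m) * C - \<i> * (1 - A) * S * d - \<i> * A * k)"
        using that(1-3) by algebra
      then show ?thesis using that(4) by simp
    qed
    have "(1 - \<i> * s) * D s - \<i> * \<mu> * char \<rho> s
        = \<i> * (b1 - \<mu>) * char \<rho> s - \<i> * (1 - a) * s * D s - \<i> * a * (\<kappa> / (1 - q))"
    proof -
      have "(1 - q) * b1 = 1 - a" using q by (simp add: b1_def a_def)
      then have "complex_of_real ((1 - q) * b1) = of_real (1 - a)" by (rule arg_cong)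
      then have 1: "(1 - complex_of_real q) * of_real b1 = 1 - of_real a" by simp
      have ne: "1 - complex_of_real q \<noteq> 0" using q by (simp add: eq_diff_eq[symmetric])
      have 2: "(1 - complex_of_real q) * D s = \<i> * (char \<rho> s - of_real a * char \<rho> (q * s))"
        using Dq[of s] by simp
      have 3: "(1 - complex_of_real q) * (\<kappa> / (1 - of_real q)) = char \<rho> (q * s) - char \<rho> s + ((1 - of_real q) * of_real s) * D s"
        using ne by (simp add: \<kappa>_def)
      show ?thesis using alg[OF 1 2 3 ne, of \<mu>] by simp
    qed
    also have "cmod \<dots> \<le> cmod (\<i> * (b1 - \<mu>) * char \<rho> s) + cmod (\<i> * (1 - a) * s * D s) + cmod (\<i> * a * (\<kappa> / (1 - q)))"
      by (intro order_trans[OF norm_triangle_ineq4] add_mono order_refl norm_triangle_ineq4)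
    also have "\<dots> \<le> \<bar>b1 - \<mu>\<bar> * 1 + (1 - a) * \<bar>t\<bar> * b1 + 1 * ((1 - q) * t\<^sup>2 / 2 * (b1 * b2))"
    proof (intro add_mono)
      show "cmod (\<i> * (b1 - \<mu>) * char \<rho> s) \<le> \<bar>b1 - \<mu>\<bar> * 1"
        unfolding norm_mult using \<rho>.cmod_char_le_1[of s] by (intro mult_mono) (auto simp flip: of_real_diff)
      show "cmod (\<i> * (1 - a) * s * D s) \<le> (1 - a) * \<bar>t\<bar> * b1"
        unfolding norm_mult using D1[of s] s a by (intro mult_mono) (auto simp flip: of_real_diff)
      have "b1 * b2 \<ge> 0" unfolding m2[symmetric] by simp
      then have "(1 - q) * s\<^sup>2 / 2 * (b1 * b2) \<le> (1 - q) * t\<^sup>2 / 2 * (b1 * b2)"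
        using q s by (intro mult_right_mono divide_right_mono mult_left_mono) (auto simp: abs_le_square_iff)
      with \<kappa> have "cmod \<kappa> / (1 - q) \<le> (1 - q) * t\<^sup>2 / 2 * (b1 * b2)" by linarith
      then show "cmod (\<i> * a * (\<kappa> / (1 - q))) \<le> 1 * ((1 - q) * t\<^sup>2 / 2 * (b1 * b2))"
        unfolding norm_mult using a q by (intro mult_mono) (auto simp: norm_divide simp flip: of_real_diff)
    qed
    finally show ?thesis by simp
  qed
  show ?thesis
    using gamma_equation_stability[OF \<mu> \<rho>.char_zero \<rho>.has_vector_derivative_char[OF \<rho>1 \<rho>2], of t] close
    unfolding D_def a_def \<rho>_def R_def by blast
qed

lemma q_gamma_char_tendsto:
  fixes N :: "nat \<Rightarrow> 'b measure"
  assumes \<mu>: "0 < \<mu>" and q: "\<And>n. 0 < q n" "\<And>n. q n < 1" "q \<longlonglongrightarrow> 1"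
    and N: "\<And>n. prob_space (N n)" and G: "\<And>n. prob_space.indep_geometric_seq (N n) (q n) (q n powr \<mu>) (G n)"
    and \<Gamma>: "prob_space (density lborel (gamma_density \<mu>))"
  shows "(\<lambda>n. char (distr (N n) borel (q_gamma (q n) (G n))) t) \<longlonglongrightarrow> char (density lborel (gamma_density \<mu>)) t"
proof -
  define w where "w = (1 - \<i> * of_real t) powr of_real \<mu>"
  define b1 where "b1 q = (1 - q powr \<mu>) / (1 - q)" for q :: real
  define b2 where "b2 q = (1 - q powr (\<mu> + 1)) / (1 - q)" for q :: real
  define e where "e q = (1 + \<bar>t\<bar>) powr \<mu> * (\<bar>b1 q - \<mu>\<bar> + (1 - q powr \<mu>) * \<bar>t\<bar> * b1 q + (1 - q) * t\<^sup>2 / 2 * (b1 q * b2 q)) * \<bar>t\<bar>" for q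
  let ?c = "\<lambda>n. char (distr (N n) borel (q_gamma (q n) (G n))) t"
  have w1: "w * char (density lborel (gamma_density \<mu>)) t = 1"
    unfolding w_def by (rule char_gamma_distribution[OF \<mu> \<Gamma>])
  then have w0: "w \<noteq> 0" by auto
  have ql: "filterlim q (at_left 1) sequentially"
    using q unfolding filterlim_at by (auto intro!: always_eventually simp: less_imp_neq)
  have "(b1 \<longlongrightarrow> \<mu>) (at_left 1)" unfolding b1_def by real_asymp
  moreover have "(b2 \<longlongrightarrow> \<mu> + 1) (at_left 1)" unfolding b2_def by real_asymp
  moreover have "((\<lambda>q. q powr \<mu>) \<longlongrightarrow> 1) (at_left (1::real))" by real_asymp
  moreover have "((\<lambda>q. q) \<longlongrightarrow> 1) (at_left (1::real))" by (rule tendsto_ident_at)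
  ultimately have "(e \<longlongrightarrow> (1 + \<bar>t\<bar>) powr \<mu> * (\<bar>\<mu> - \<mu>\<bar> + (1 - 1) * \<bar>t\<bar> * \<mu> + (1 - 1) * t\<^sup>2 / 2 * (\<mu> * (\<mu> + 1))) * \<bar>t\<bar>) (at_left 1)"
    unfolding e_def by (intro tendsto_mult tendsto_add tendsto_diff tendsto_rabs tendsto_const tendsto_divide) auto
  then have "(e \<longlongrightarrow> 0) (at_left 1)" by simp
  from filterlim_compose[OF this ql] have e0: "(\<lambda>n. e (q n)) \<longlonglongrightarrow> 0" .
  have "(\<lambda>n. w * ?c n - 1) \<longlonglongrightarrow> 0"
  proof (rule Lim_null_comparison[OF _ e0], intro always_eventually allI)
    fix n
    interpret prob_space "N n" by (rule N)
    show "norm (w * ?c n - 1) \<le> e (q n)"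
      unfolding w_def e_def b1_def b2_def by (rule q_gamma_char_near_gamma[OF q(1,2) \<mu> G])
  qed
  then have "(\<lambda>n. (w * ?c n - 1 + 1) / w) \<longlonglongrightarrow> (0 + 1) / w" by (intro tendsto_intros w0)
  moreover have "(0 + 1) / w = char (density lborel (gamma_density \<mu>)) t" using w0 w1 by (simp add: field_simps)
  ultimately show ?thesis using w0 by simp
qed

section \<open>A probability space carrying both series\<close>

text \<open>
  The map \<open>\<pi>\<close> will be one of the two projections of a product of two sequence spaces.
\<close>
lemma indep_vars_PiM_coordinates_distr:
  fixes L :: "nat \<Rightarrow> 'x measure" and K :: "'x measure"
  assumes N: "prob_space N" and \<pi>: "\<pi> \<in> measurable N (PiM UNIV L)" and law: "distr N (PiM UNIV L) \<pi> = PiM UNIV L"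
    and L: "\<And>n. prob_space (L n)" and K: "\<And>n. sets (L n) = sets K"
  shows "prob_space.indep_vars N (\<lambda>_. K) (\<lambda>n \<omega>. \<pi> \<omega> n) UNIV"
    and "distr N K (\<lambda>\<omega>. \<pi> \<omega> n) = distr (L n) K (\<lambda>x. x)"
proof -
  interpret prob_space N by fact
  have setsP: "sets (PiM UNIV L) = sets (PiM UNIV (\<lambda>_. K))" using K by (intro sets_PiM_cong) auto
  have m: "(\<lambda>\<omega>. \<pi> \<omega> n) \<in> measurable N (L n)" for n
    by (rule measurable_compose[OF \<pi> measurable_component_singleton]) simp
  have law1: "distr N (L n) (\<lambda>\<omega>. \<pi> \<omega> n) = L n" for n
  proof -
    have "distr N (L n) (\<lambda>\<omega>. \<pi> \<omega> n) = distr (distr N (PiM UNIV L) \<pi>) (L n) (\<lambda>x. x n)"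
      by (subst distr_distr[OF _ \<pi>]) (auto simp: o_def)
    also have "\<dots> = L n" unfolding law by (rule distr_PiM_component) (auto intro: L)
    finally show ?thesis .
  qed
  have toK: "distr N K f = distr (distr N (L n) f) K (\<lambda>x. x)" if "f \<in> measurable N (L n)" for f n
    by (subst distr_distr) (auto simp: o_def K that intro: measurable_ident_sets)
  have lawK: "distr N K (\<lambda>\<omega>. \<pi> \<omega> n) = distr (L n) K (\<lambda>x. x)" for n
    using toK[OF m[of n]] law1[of n] by simp
  then show "distr N K (\<lambda>\<omega>. \<pi> \<omega> n) = distr (L n) K (\<lambda>x. x)" .
  have distrK: "distr (L n) K (\<lambda>x. x) = L n" for n by (rule distr_id2) (simp add: K)
  show "indep_vars (\<lambda>_. K) (\<lambda>n \<omega>. \<pi> \<omega> n) UNIV"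
  proof (subst indep_vars_iff_distr_eq_PiM)
    show "random_variable K (\<lambda>\<omega>. \<pi> \<omega> n)" for n
      using m[of n] K by (simp cong: measurable_cong_sets)
    have "distr N (PiM UNIV (\<lambda>_. K)) (\<lambda>x. \<lambda>i\<in>UNIV. \<pi> x i) = distr N (PiM UNIV L) \<pi>"
      by (rule distr_cong) (auto simp: setsP)
    then show "distr N (PiM UNIV (\<lambda>_. K)) (\<lambda>x. \<lambda>i\<in>UNIV. \<pi> x i) = PiM UNIV (\<lambda>i. distr N K (\<lambda>\<omega>. \<pi> \<omega> i))"
      by (simp add: law lawK distrK)
  qed simp
qed

text \<open>
  The limit theorem speaks about the functional alone. To use the equality in law there, some
  independent series of exponential and geometric variables must exist.
\<close>
lemma exists_exponential_geometric_model:
  assumes q: "0 < q" "q < 1" and a: "0 \<le> a" "a < 1"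
  obtains N :: "((nat \<Rightarrow> real) \<times> (nat \<Rightarrow> nat)) measure" and \<epsilon> G
  where "prob_space N" "prob_space.iid_std_exponential N \<epsilon>" "prob_space.indep_geometric_seq N q a G"
    "prob_space.indep_var N borel (I_q q \<epsilon>) borel (q_gamma q G)"
proof -
  define L1 where "L1 = (\<lambda>_::nat. density lborel (\<lambda>x. ennreal (exponential_density 1 x)))"
  define L2 where "L2 = (\<lambda>n. measure_pmf (geometric_pmf (1 - a * q ^ n)))"
  define N where "N = PiM UNIV L1 \<Otimes>\<^sub>M PiM UNIV L2"
  define \<epsilon> :: "nat \<Rightarrow> (nat \<Rightarrow> real) \<times> (nat \<Rightarrow> nat) \<Rightarrow> real" where "\<epsilon> n \<omega> = fst \<omega> n" for n \<omega>
  define G :: "nat \<Rightarrow> (nat \<Rightarrow> real) \<times> (nat \<Rightarrow> nat) \<Rightarrow> nat" where "G n \<omega> = snd \<omega> n" for n \<omega>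
  have L1: "prob_space (L1 n)" "sets (L1 n) = sets borel" for n
    using prob_space_exponential_density[of 1] by (auto simp: L1_def)
  have L2: "prob_space (L2 n)" "sets (L2 n) = sets (count_space UNIV)" for n
    by (auto simp: L2_def measure_pmf.prob_space_axioms)
  interpret P1: prob_space "PiM UNIV L1" by (rule prob_space_PiM) (rule L1)
  interpret P2: prob_space "PiM UNIV L2" by (rule prob_space_PiM) (rule L2)
  interpret PP: pair_prob_space "PiM UNIV L1" "PiM UNIV L2" ..
  have N: "prob_space N" unfolding N_def by (rule PP.prob_space_axioms)
  interpret prob_space N by (rule N)
  have f: "fst \<in> measurable N (PiM UNIV L1)" "snd \<in> measurable N (PiM UNIV L2)" by (auto simp: N_def)
  have d1: "distr N (PiM UNIV L1) fst = PiM UNIV L1" unfolding N_def by (rule P2.distr_pair_fst)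
  have d2: "distr N (PiM UNIV L2) snd = PiM UNIV L2"
  proof (rule measure_eqI)
    fix A assume "A \<in> sets (distr N (PiM UNIV L2) snd)"
    then have A: "A \<in> sets (PiM UNIV L2)" by simp
    have "snd -` A \<inter> space N = space (PiM UNIV L1) \<times> A"
      using sets.sets_into_space[OF A] by (auto simp: N_def space_pair_measure)
    then show "emeasure (distr N (PiM UNIV L2) snd) A = emeasure (PiM UNIV L2) A"
      using A f(2) by (simp add: emeasure_distr N_def P2.emeasure_pair_measure_Times P1.emeasure_space_1)
  qed simp
  note c1 = indep_vars_PiM_coordinates_distr[OF N f(1) d1 L1]
  note c2 = indep_vars_PiM_coordinates_distr[OF N f(2) d2 L2]
  have "distributed N lborel (\<epsilon> n) (exponential_density 1)" for n
  proof -
    have "distr N lborel (\<epsilon> n) = distr N borel (\<epsilon> n)" by (rule distr_cong) auto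
    also have "\<dots> = distr (L1 n) borel (\<lambda>x. x)" using c1(2)[of n] by (simp add: \<epsilon>_def[abs_def])
    also have "\<dots> = L1 n" by (rule distr_id2) (simp add: L1)
    finally have "distr N lborel (\<epsilon> n) = L1 n" .
    moreover have "\<epsilon> n \<in> borel_measurable N"
      using c1(1) by (simp add: indep_vars_def \<epsilon>_def[abs_def])
    ultimately show ?thesis by (auto simp: distributed_def L1_def)
  qed
  then have \<epsilon>: "iid_std_exponential \<epsilon>"
    using c1(1) by (simp add: iid_std_exponential_def \<epsilon>_def[abs_def])
  have "distr N (count_space UNIV) (G n) = measure_pmf (geometric_pmf (1 - a * q ^ n))" for n
  proof -
    have "distr N (count_space UNIV) (G n) = distr (L2 n) (count_space UNIV) (\<lambda>x. x)"
      using c2(2)[of n] by (simp add: G_def[abs_def])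
    also have "\<dots> = L2 n" by (rule distr_id2) (simp add: L2)
    finally show ?thesis by (simp add: L2_def)
  qed
  then have G: "indep_geometric_seq q a G"
    using c2(1) by (simp add: indep_geometric_seq_def G_def[abs_def])
  define f1 :: "(nat \<Rightarrow> real) \<Rightarrow> real" where "f1 x = (\<Sum>n. q ^ n * x n)" for x
  define f2 :: "(nat \<Rightarrow> nat) \<Rightarrow> real" where "f2 y = inverse (1 - q) * q ^ (\<Sum>n. y n)" for y
  have I: "I_q q \<epsilon> = f1 \<circ> fst" and R: "q_gamma q G = f2 \<circ> snd"
    by (auto simp: I_q_def q_gamma_def f1_def f2_def \<epsilon>_def G_def fun_eq_iff)
  have f1m: "f1 \<in> borel_measurable (PiM UNIV L1)"
  proof -
    have [measurable]: "(\<lambda>x. x n) \<in> borel_measurable (PiM UNIV L1)" for n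
      using measurable_component_singleton[of n UNIV L1] L1(2)[of n] by (simp cong: measurable_cong_sets)
    show ?thesis unfolding f1_def[abs_def] by measurable
  qed
  have f2m: "f2 \<in> borel_measurable (PiM UNIV L2)"
  proof -
    have "(\<lambda>y. y n) \<in> measurable (PiM UNIV L2) (count_space UNIV)" for n
      by (subst measurable_cong_sets[OF refl L2(2)[of n, symmetric]]) (rule measurable_component_singleton, simp)
    from measurable_suminf_nat[OF this]
    show ?thesis unfolding f2_def[abs_def]
      by (rule measurable_compose[where g = "\<lambda>k. inverse (1 - q) * q ^ k"]) simp
  qed
  have Rm: "random_variable borel (q_gamma q G)" unfolding R using f2m f(2) by (intro measurable_comp)
  have Im: "random_variable borel (I_q q \<epsilon>)" unfolding I using f1m f(1) by (intro measurable_comp)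
  have "distr N borel (I_q q \<epsilon>) \<Otimes>\<^sub>M distr N borel (q_gamma q G)
      = distr (PiM UNIV L1) borel f1 \<Otimes>\<^sub>M distr (PiM UNIV L2) borel f2"
    unfolding I R by (simp only: distr_distr[OF f1m f(1), symmetric] distr_distr[OF f2m f(2), symmetric] d1 d2)
  also have "\<dots> = distr N (borel \<Otimes>\<^sub>M borel) (\<lambda>(x, y). (f1 x, f2 y))"
    unfolding N_def
    by (intro pair_measure_distr f1m f2m prob_space_imp_sigma_finite P2.prob_space_distr)
  also have "\<dots> = distr N (borel \<Otimes>\<^sub>M borel) (\<lambda>\<omega>. (I_q q \<epsilon> \<omega>, q_gamma q G \<omega>))"
    unfolding I R by (simp add: o_def split_beta')
  finally have "indep_var borel (I_q q \<epsilon>) borel (q_gamma q G)"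
    using Im Rm by (simp add: indep_var_distribution_eq)
  with N \<epsilon> G show ?thesis by (rule that)
qed

section \<open>The limit of the rescaled functional\<close>

lemma real_distribution_return: "real_distribution (return borel (c::real))"
  by (simp add: real_distribution_def real_distribution_axioms_def prob_space_return)

lemma scaled_I_q_weak_conv:
  fixes N :: "nat \<Rightarrow> 'b measure"
  assumes q: "\<And>n. 0 < q n" "\<And>n. q n < 1" "q \<longlonglongrightarrow> 1"
    and N: "\<And>n. prob_space (N n)" and \<epsilon>: "\<And>n. prob_space.iid_std_exponential (N n) (\<epsilon> n)"
  shows "weak_conv_m (\<lambda>n. distr (N n) borel (\<lambda>\<omega>. (1 - q n) * I_q (q n) (\<epsilon> n) \<omega>)) (return borel 1)"
proof (rule levy_continuity)
  have m: "I_q (q n) (\<epsilon> n) \<in> borel_measurable (N n)" for n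
    by (rule prob_space.I_q_measurable[OF N \<epsilon>])
  show "real_distribution (distr (N n) borel (\<lambda>\<omega>. (1 - q n) * I_q (q n) (\<epsilon> n) \<omega>))" for n
    using m by (intro prob_space.real_distribution_distr[OF N]) simp
  show "real_distribution (return borel (1::real))" by (rule real_distribution_return)
  fix t
  have eq: "char (distr (N n) borel (\<lambda>\<omega>. (1 - q n) * I_q (q n) (\<epsilon> n) \<omega>)) t
      = char (distr (N n) borel (I_q (q n) (\<epsilon> n))) ((1 - q n) * t)" for n
  proof -
    have "char (distr (N n) borel (\<lambda>\<omega>. (1 - q n) * I_q (q n) (\<epsilon> n) \<omega>)) t
        = (CLINT \<omega>|N n. iexp (t * ((1 - q n) * I_q (q n) (\<epsilon> n) \<omega>)))"
      unfolding char_def using m by (intro integral_distr) auto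
    also have "\<dots> = (CLINT \<omega>|N n. iexp (((1 - q n) * t) * I_q (q n) (\<epsilon> n) \<omega>))"
      by (simp only: mult.assoc mult.left_commute)
    also have "\<dots> = char (distr (N n) borel (I_q (q n) (\<epsilon> n))) ((1 - q n) * t)"
      unfolding char_def using m by (intro integral_distr[symmetric]) auto
    finally show ?thesis .
  qed
  have "(\<lambda>n. char (distr (N n) borel (I_q (q n) (\<epsilon> n))) ((1 - q n) * t) - iexp t) \<longlonglongrightarrow> 0"
  proof (rule Lim_null_comparison)
    show "\<forall>\<^sub>F n in sequentially. norm (char (distr (N n) borel (I_q (q n) (\<epsilon> n))) ((1 - q n) * t) - iexp t) \<le> 2 * t\<^sup>2 * (1 - q n)"
      by (intro always_eventually allI prob_space.char_I_q_near_iexp[OF N q(1,2) \<epsilon>])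
    show "(\<lambda>n. 2 * t\<^sup>2 * (1 - q n)) \<longlonglongrightarrow> 0" using q(3) by (auto intro!: tendsto_eq_intros)
  qed
  then have "(\<lambda>n. char (distr (N n) borel (I_q (q n) (\<epsilon> n))) ((1 - q n) * t)) \<longlonglongrightarrow> iexp t"
    by (simp add: LIM_zero_iff)
  moreover have "char (return borel 1) t = iexp t" unfolding char_def by (subst integral_return) auto
  ultimately show "(\<lambda>n. char (distr (N n) borel (\<lambda>\<omega>. (1 - q n) * I_q (q n) (\<epsilon> n) \<omega>)) t) \<longlonglongrightarrow> char (return borel 1) t"
    unfolding eq by simp
qed

text \<open>
  Slutsky's theorem for a quotient whose numerator tends to 1. Up to the probability that \<open>U\<close> leaves
  the interval from \<open>1 - \<delta>\<close> to \<open>1 + \<delta>\<close>, the event \<open>U \<le> x R\<close> lies between \<open>(1 + \<delta>) / x < R\<close> and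
  \<open>(1 - \<delta>) / x < R\<close>.
\<close>
lemma ratio_cdf_tendsto:
  fixes N :: "nat \<Rightarrow> 'b measure"
  assumes N: "\<And>n. prob_space (N n)"
    and m: "\<And>n. U n \<in> borel_measurable (N n)" "\<And>n. R n \<in> borel_measurable (N n)"
    and pos: "\<And>n \<omega>. 0 < R n \<omega>"
    and U: "weak_conv_m (\<lambda>n. distr (N n) borel (U n)) (return borel 1)"
    and R: "weak_conv_m (\<lambda>n. distr (N n) borel (R n)) \<Gamma>"
    and \<Gamma>: "real_distribution \<Gamma>" "\<And>x. measure \<Gamma> {x} = 0"
  shows "(\<lambda>n. cdf (distr (N n) borel (\<lambda>\<omega>. U n \<omega> / R n \<omega>)) x) \<longlonglongrightarrow> (if 0 < x then 1 - cdf \<Gamma> (1 / x) else 0)"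
proof -
  note [measurable] = m
  interpret \<Gamma>: real_distribution \<Gamma> by fact
  interpret one: real_distribution "return borel (1::real)" by (rule real_distribution_return)
  let ?u = "\<lambda>n. cdf (distr (N n) borel (U n))" and ?r = "\<lambda>n. cdf (distr (N n) borel (R n))"
  let ?c = "\<lambda>n. cdf (distr (N n) borel (\<lambda>\<omega>. U n \<omega> / R n \<omega>)) x"
  have u: "?u n y = measure (N n) {\<omega> \<in> space (N n). U n \<omega> \<le> y}"
    and r: "?r n y = measure (N n) {\<omega> \<in> space (N n). R n \<omega> \<le> y}"
    and c: "?c n = measure (N n) {\<omega> \<in> space (N n). U n \<omega> \<le> x * R n \<omega>}" for n y
    unfolding cdf_def using pos
    by (auto simp: measure_distr pos_divide_le_eq intro!: arg_cong[where f = "measure (N n)"])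
  have ulim: "(\<lambda>n. ?u n y) \<longlonglongrightarrow> (if 1 \<le> y then 1 else 0)" if "y \<noteq> 1" for y
  proof -
    have "isCont (cdf (return borel 1)) y" using that by (simp add: one.isCont_cdf measure_return)
    moreover have "cdf (return borel 1) y = (if 1 \<le> y then 1 else 0)" by (simp add: cdf_def measure_return)
    ultimately show ?thesis using U by (auto simp: weak_conv_m_def weak_conv_def)
  qed
  have rlim: "(\<lambda>n. ?r n y) \<longlonglongrightarrow> cdf \<Gamma> y" for y
    using R \<Gamma>(2)[of y] by (simp add: weak_conv_m_def weak_conv_def \<Gamma>.isCont_cdf)
  show ?thesis
  proof (cases "0 < x")
    case False
    have "(\<lambda>n. ?c n) \<longlonglongrightarrow> 0"
    proof (rule tendsto_sandwich[of "\<lambda>_. 0" ?c _ "\<lambda>n. ?u n 0"])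
      have "?c n \<le> ?u n 0" for n
      proof -
        interpret prob_space "N n" by (rule N)
        have "x * R n \<omega> \<le> 0" for \<omega> using False pos[of n \<omega>] by (simp add: mult_nonpos_nonneg)
        then show ?thesis unfolding u c by (intro finite_measure_mono) (auto intro: order_trans)
      qed
      then show "\<forall>\<^sub>F n in sequentially. ?c n \<le> ?u n 0" by simp
      show "(\<lambda>n. ?u n 0) \<longlonglongrightarrow> 0" using ulim[of 0] by simp
    qed (auto simp: c)
    with False show ?thesis by simp
  next
    case True
    have upper: "?c n \<le> ?u n (1 - \<delta>) + (1 - ?r n ((1 - \<delta>) / x))" for n \<delta>
    proof -
      interpret prob_space "N n" by (rule N)
      have "?c n \<le> prob ({\<omega> \<in> space (N n). U n \<omega> \<le> 1 - \<delta>} \<union> {\<omega> \<in> space (N n). \<not> R n \<omega> \<le> (1 - \<delta>) / x})"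
        unfolding c using True by (intro finite_measure_mono) (auto simp: pos_le_divide_eq mult.commute)
      also have "\<dots> \<le> prob {\<omega> \<in> space (N n). U n \<omega> \<le> 1 - \<delta>} + prob {\<omega> \<in> space (N n). \<not> R n \<omega> \<le> (1 - \<delta>) / x}"
        by (intro measure_Un_le) auto
      finally show ?thesis unfolding u r by (subst (asm) prob_neg) auto
    qed
    have lower: "1 - ?r n ((1 + \<delta>) / x) \<le> ?c n + (1 - ?u n (1 + \<delta>))" for n \<delta>
    proof -
      interpret prob_space "N n" by (rule N)
      have "prob {\<omega> \<in> space (N n). \<not> R n \<omega> \<le> (1 + \<delta>) / x}
          \<le> prob ({\<omega> \<in> space (N n). U n \<omega> \<le> x * R n \<omega>} \<union> {\<omega> \<in> space (N n). \<not> U n \<omega> \<le> 1 + \<delta>})"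
        using True by (intro finite_measure_mono) (auto simp: pos_le_divide_eq mult.commute)
      also have "\<dots> \<le> prob {\<omega> \<in> space (N n). U n \<omega> \<le> x * R n \<omega>} + prob {\<omega> \<in> space (N n). \<not> U n \<omega> \<le> 1 + \<delta>}"
        by (intro measure_Un_le) auto
      finally show ?thesis unfolding u r c by (subst (asm) (1 2) prob_neg) auto
    qed
    have "?c \<longlonglongrightarrow> 1 - cdf \<Gamma> (1 / x)"
    proof (rule tendstoI)
      fix e :: real assume e: "0 < e"
      have cont: "isCont (cdf \<Gamma>) (1 / x)" by (simp add: \<Gamma>.isCont_cdf \<Gamma>(2))
      have "((\<lambda>\<delta>. cdf \<Gamma> ((1 - \<delta>) / x)) \<longlongrightarrow> cdf \<Gamma> (1 / x)) (at_right 0)"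
        using True by (intro isCont_tendsto_compose[OF cont]) (auto intro!: tendsto_eq_intros)
      then have 1: "\<forall>\<^sub>F \<delta> in at_right 0. dist (cdf \<Gamma> ((1 - \<delta>) / x)) (cdf \<Gamma> (1 / x)) < e / 2"
        using e by (intro tendstoD) auto
      have "((\<lambda>\<delta>. cdf \<Gamma> ((1 + \<delta>) / x)) \<longlongrightarrow> cdf \<Gamma> (1 / x)) (at_right 0)"
        using True by (intro isCont_tendsto_compose[OF cont]) (auto intro!: tendsto_eq_intros)
      then have 2: "\<forall>\<^sub>F \<delta> in at_right 0. dist (cdf \<Gamma> ((1 + \<delta>) / x)) (cdf \<Gamma> (1 / x)) < e / 2"
        using e by (intro tendstoD) auto
      have 3: "\<forall>\<^sub>F \<delta> in at_right (0::real). 0 < \<delta>" by (rule eventually_at_right_less)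
      have "\<forall>\<^sub>F \<delta> in at_right (0::real). 0 < \<delta> \<and> dist (cdf \<Gamma> ((1 - \<delta>) / x)) (cdf \<Gamma> (1 / x)) < e / 2
          \<and> dist (cdf \<Gamma> ((1 + \<delta>) / x)) (cdf \<Gamma> (1 / x)) < e / 2"
        using 1 2 3 by eventually_elim auto
      then obtain \<delta> :: real where \<delta>: "0 < \<delta>" "dist (cdf \<Gamma> ((1 - \<delta>) / x)) (cdf \<Gamma> (1 / x)) < e / 2"
          "dist (cdf \<Gamma> ((1 + \<delta>) / x)) (cdf \<Gamma> (1 / x)) < e / 2"
        using eventually_happens'[of "at_right (0::real)"] by (auto simp: trivial_limit_at_right_real)
      have "(\<lambda>n. ?u n (1 - \<delta>) + (1 - ?r n ((1 - \<delta>) / x))) \<longlonglongrightarrow> 0 + (1 - cdf \<Gamma> ((1 - \<delta>) / x))"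
        using ulim[of "1 - \<delta>"] \<delta> by (intro tendsto_intros rlim) auto
      moreover have "0 + (1 - cdf \<Gamma> ((1 - \<delta>) / x)) < 1 - cdf \<Gamma> (1 / x) + e"
        using \<delta>(2) e by (simp add: dist_real_def abs_if split: if_splits)
      ultimately have up: "\<forall>\<^sub>F n in sequentially. ?u n (1 - \<delta>) + (1 - ?r n ((1 - \<delta>) / x)) < 1 - cdf \<Gamma> (1 / x) + e"
        by (rule order_tendstoD(2))
      have "(\<lambda>n. 1 - ?r n ((1 + \<delta>) / x) - (1 - ?u n (1 + \<delta>))) \<longlonglongrightarrow> 1 - cdf \<Gamma> ((1 + \<delta>) / x) - (1 - 1)"
        using ulim[of "1 + \<delta>"] \<delta> by (intro tendsto_intros rlim) auto
      moreover have "1 - cdf \<Gamma> (1 / x) - e < 1 - cdf \<Gamma> ((1 + \<delta>) / x) - (1 - 1)"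
        using \<delta>(3) e by (simp add: dist_real_def abs_if split: if_splits)
      ultimately have lo: "\<forall>\<^sub>F n in sequentially. 1 - cdf \<Gamma> (1 / x) - e < 1 - ?r n ((1 + \<delta>) / x) - (1 - ?u n (1 + \<delta>))"
        by (rule order_tendstoD(1))
      show "\<forall>\<^sub>F n in sequentially. dist (?c n) (1 - cdf \<Gamma> (1 / x)) < e"
        using up lo
      proof eventually_elim
        case (elim n)
        then show ?case using upper[of n \<delta>] lower[of n \<delta>] by (auto simp: dist_real_def abs_if)
      qed
    qed
    with True show ?thesis by simp
  qed
qed

lemma cdf_inverse_gamma:
  fixes Q :: "'c measure"
  assumes Q: "prob_space Q" and \<gamma>: "distributed Q lborel \<gamma> (gamma_density \<mu>)"
  defines "\<Gamma> \<equiv> density lborel (gamma_density \<mu>)"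
  shows "real_distribution \<Gamma>" and "measure \<Gamma> {x} = 0"
    and "cdf (distr Q borel (\<lambda>\<omega>. 1 / \<gamma> \<omega>)) x = (if 0 < x then 1 - cdf \<Gamma> (1 / x) else 0)"
proof -
  interpret Q: prob_space Q by fact
  have \<gamma>m[measurable]: "\<gamma> \<in> borel_measurable Q" and law: "distr Q lborel \<gamma> = \<Gamma>"
    using \<gamma> by (auto simp: distributed_def \<Gamma>_def)
  have lawb: "distr Q borel \<gamma> = \<Gamma>" unfolding law[symmetric] by (rule distr_cong) auto
  have dm[measurable]: "(\<lambda>x. ennreal (gamma_density \<mu> x)) \<in> borel_measurable borel"
    using \<gamma> by (auto simp: distributed_def)
  show rd: "real_distribution \<Gamma>" unfolding lawb[symmetric] by (rule Q.real_distribution_distr) measurable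
  interpret \<Gamma>: real_distribution \<Gamma> by (rule rd)
  have null: "emeasure \<Gamma> {y} = 0" for y
    unfolding \<Gamma>_def by (subst emeasure_density) (auto simp: nn_integral_indicator_singleton)
  then show sing: "measure \<Gamma> {x} = 0" for x by (simp add: measure_def)
  have "emeasure \<Gamma> {..0} = 0"
  proof -
    have "(\<integral>\<^sup>+ x. ennreal (gamma_density \<mu> x) * indicator {..0} x \<partial>lborel) = (\<integral>\<^sup>+ x. 0 \<partial>(lborel :: real measure))"
      by (rule nn_integral_cong) (auto simp: gamma_density_def indicator_def)
    then show ?thesis unfolding \<Gamma>_def by (subst emeasure_density) auto
  qed
  then have "emeasure (distr Q borel \<gamma>) {..0} = 0" by (simp add: lawb)
  then have "emeasure Q {\<omega> \<in> space Q. \<gamma> \<omega> \<le> 0} = 0"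
    by (subst (asm) emeasure_distr) (auto simp: vimage_def Int_def conj_commute)
  then have "{\<omega> \<in> space Q. \<not> 0 < \<gamma> \<omega>} \<in> null_sets Q" by (intro null_setsI) (auto simp: not_less)
  then have pos: "AE \<omega> in Q. 0 < \<gamma> \<omega>" by (rule AE_I') auto
  have c: "cdf (distr Q borel (\<lambda>\<omega>. 1 / \<gamma> \<omega>)) x = Q.prob {\<omega> \<in> space Q. 1 / \<gamma> \<omega> \<le> x}"
    unfolding cdf_def by (subst measure_distr) (auto intro!: arg_cong[where f = Q.prob])
  show "cdf (distr Q borel (\<lambda>\<omega>. 1 / \<gamma> \<omega>)) x = (if 0 < x then 1 - cdf \<Gamma> (1 / x) else 0)"
  proof (cases "0 < x")
    case True
    have "Q.prob {\<omega> \<in> space Q. 1 / \<gamma> \<omega> \<le> x} = Q.prob {\<omega> \<in> space Q. \<not> \<gamma> \<omega> < 1 / x}"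
    proof (rule Q.finite_measure_eq_AE)
      show "AE \<omega> in Q. (\<omega> \<in> {\<omega> \<in> space Q. 1 / \<gamma> \<omega> \<le> x}) = (\<omega> \<in> {\<omega> \<in> space Q. \<not> \<gamma> \<omega> < 1 / x})"
        using pos by eventually_elim (use True in \<open>auto simp: field_simps\<close>)
    qed auto
    also have "\<dots> = 1 - Q.prob {\<omega> \<in> space Q. \<gamma> \<omega> < 1 / x}" by (rule Q.prob_neg) measurable
    also have "Q.prob {\<omega> \<in> space Q. \<gamma> \<omega> < 1 / x} = measure \<Gamma> {..<1 / x}"
      unfolding lawb[symmetric] by (subst measure_distr) (auto intro!: arg_cong[where f = Q.prob])
    also have "\<dots> = measure \<Gamma> {..<1 / x} + measure \<Gamma> {1 / x}" by (simp add: sing)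
    also have "\<dots> = cdf \<Gamma> (1 / x)"
      unfolding cdf_def ivl_disj_un(2)[symmetric] by (subst \<Gamma>.finite_measure_Union) auto
    finally show ?thesis using True by (simp add: c)
  next
    case False
    have "Q.prob {\<omega> \<in> space Q. 1 / \<gamma> \<omega> \<le> x} = Q.prob {}"
    proof (rule Q.finite_measure_eq_AE)
      show "AE \<omega> in Q. (\<omega> \<in> {\<omega> \<in> space Q. 1 / \<gamma> \<omega> \<le> x}) = (\<omega> \<in> {})"
        using pos
      proof eventually_elim
        fix \<omega> assume "0 < \<gamma> \<omega>"
        then have "0 < 1 / \<gamma> \<omega>" by simp
        with False have "\<not> 1 / \<gamma> \<omega> \<le> x" by linarith
        then show "(\<omega> \<in> {\<omega> \<in> space Q. 1 / \<gamma> \<omega> \<le> x}) = (\<omega> \<in> {})" by blast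
      qed
    qed auto
    with False show ?thesis by (simp add: c)
  qed
qed

lemma quotient_eq_q_gamma:
  assumes "0 < q" "q < 1"
  shows "q powi (- int (\<Sum>n. G n \<omega>)) * I_q q \<epsilon> \<omega> = inverse (1 - q) * I_q q \<epsilon> \<omega> / q_gamma q G \<omega>"
  using assms by (simp add: q_gamma_def power_int_minus divide_simps)

text \<open>
  A left limit at 1 is a limit along sequences, and along a sequence the functional can be replaced,
  for each member separately, by the quotient on a model, where the numerator and \<open>R\<close> are available.
\<close>
lemma exp_functional_scaling_limit:
  fixes M :: "real \<Rightarrow> 'a measure" and Q :: "'c measure"
  assumes \<mu>: "0 < \<mu>"
    and M: "\<And>q. q \<in> {0<..<1} \<Longrightarrow> prob_space (M q) \<and> prob_space.indep_poisson_pair (M q) 1 (q powr \<mu>) (Pp q) (Pm q)"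
    and Q: "prob_space Q" and \<gamma>: "distributed Q lborel \<gamma> (gamma_density \<mu>)"
  shows "weak_conv_along (\<lambda>q. distr (M q) borel (\<lambda>\<omega>. (1 - q)\<^sup>2 * exp_functional q (Pp q) (Pm q) \<omega>))
    (distr Q borel (\<lambda>\<omega>. 1 / \<gamma> \<omega>)) (at_left 1)"
  unfolding weak_conv_along_def
proof (intro allI impI tendsto_at_left_sequentially[of 0])
  fix x :: real and q :: "nat \<Rightarrow> real"
  assume qs: "\<And>n. q n < 1" "\<And>n. 0 < q n" "q \<longlonglongrightarrow> 1"
  define \<Gamma> where "\<Gamma> = density lborel (gamma_density \<mu>)"
  note \<Gamma> = cdf_inverse_gamma[OF Q \<gamma>, folded \<Gamma>_def]
  have a: "0 \<le> q n powr \<mu>" "q n powr \<mu> < 1" for n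
    using qs(1,2)[of n] \<mu> powr_less_mono2[of \<mu> "q n" 1] by auto
  have "\<exists>(N :: ((nat \<Rightarrow> real) \<times> (nat \<Rightarrow> nat)) measure) \<epsilon> G. prob_space N \<and> prob_space.iid_std_exponential N \<epsilon> \<and>
      prob_space.indep_geometric_seq N (q n) (q n powr \<mu>) G \<and> prob_space.indep_var N borel (I_q (q n) \<epsilon>) borel (q_gamma (q n) G)" for n
    using exists_exponential_geometric_model[of "q n" "q n powr \<mu>", OF qs(2) qs(1) a] by metis
  then obtain N :: "nat \<Rightarrow> ((nat \<Rightarrow> real) \<times> (nat \<Rightarrow> nat)) measure" and \<epsilon> G where
    N: "\<And>n. prob_space (N n)" and \<epsilon>: "\<And>n. prob_space.iid_std_exponential (N n) (\<epsilon> n)"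
    and G: "\<And>n. prob_space.indep_geometric_seq (N n) (q n) (q n powr \<mu>) (G n)"
    and ind: "\<And>n. prob_space.indep_var (N n) borel (I_q (q n) (\<epsilon> n)) borel (q_gamma (q n) (G n))"
    by metis
  define U where "U n \<omega> = (1 - q n) * I_q (q n) (\<epsilon> n) \<omega>" for n \<omega>
  define R where "R n = q_gamma (q n) (G n)" for n
  have Im: "I_q (q n) (\<epsilon> n) \<in> borel_measurable (N n)" for n by (rule prob_space.I_q_measurable[OF N \<epsilon>])
  have Rm: "R n \<in> borel_measurable (N n)" for n unfolding R_def by (rule prob_space.q_gamma_measurable[OF N G])
  have Um: "U n \<in> borel_measurable (N n)" for n using Im unfolding U_def[abs_def] by simp
  have Rpos: "0 < R n \<omega>" for n \<omega> using qs(1,2)[of n] by (simp add: R_def q_gamma_def)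
  have law: "distr (M (q n)) borel (\<lambda>\<omega>. (1 - q n)\<^sup>2 * exp_functional (q n) (Pp (q n)) (Pm (q n)) \<omega>)
      = distr (N n) borel (\<lambda>\<omega>. U n \<omega> / R n \<omega>)" for n
  proof -
    interpret poisson_pair_functional "M (q n)" "q n" \<mu> "Pp (q n)" "Pm (q n)"
      using M[of "q n"] qs(1,2)[of n] \<mu>
      by (auto simp: poisson_pair_functional_def poisson_pair_functional_axioms_def)
    let ?Y = "\<lambda>\<omega>. q n powi (- int (\<Sum>k. G n k \<omega>)) * I_q (q n) (\<epsilon> n) \<omega>"
    have Y: "?Y = (\<lambda>\<omega>. inverse (1 - q n) * I_q (q n) (\<epsilon> n) \<omega> / R n \<omega>)"
      unfolding R_def by (intro ext quotient_eq_q_gamma qs)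
    have Ym: "?Y \<in> borel_measurable (N n)" unfolding Y using Im Rm by measurable
    have "distr (M (q n)) borel (\<lambda>\<omega>. (1 - q n)\<^sup>2 * X \<omega>) = distr (distr (M (q n)) borel X) borel (\<lambda>x. (1 - q n)\<^sup>2 * x)"
      using measurable_X by (subst distr_distr) (auto simp: o_def)
    also have "\<dots> = distr (distr (N n) borel ?Y) borel (\<lambda>x. (1 - q n)\<^sup>2 * x)"
      by (simp only: exp_functional_law[OF N \<epsilon> G ind])
    also have "\<dots> = distr (N n) borel (\<lambda>\<omega>. (1 - q n)\<^sup>2 * ?Y \<omega>)"
      using Ym by (subst distr_distr) (auto simp: o_def)
    also have "(\<lambda>\<omega>. (1 - q n)\<^sup>2 * ?Y \<omega>) = (\<lambda>\<omega>. U n \<omega> / R n \<omega>)"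
    proof (rule ext)
      show "(1 - q n)\<^sup>2 * ?Y \<omega> = U n \<omega> / R n \<omega>" for \<omega>
        unfolding quotient_eq_q_gamma[OF qs(2,1)] U_def R_def using qs(1)[of n] by (simp add: power2_eq_square)
    qed
    finally show ?thesis unfolding exp_functional_eq .
  qed
  have "weak_conv_m (\<lambda>n. distr (N n) borel (R n)) \<Gamma>"
  proof (rule levy_continuity)
    show "real_distribution (distr (N n) borel (R n))" for n
      by (rule prob_space.real_distribution_distr[OF N Rm])
    have "prob_space \<Gamma>" using \<Gamma>(1) by (simp add: real_distribution_def)
    then show "(\<lambda>n. char (distr (N n) borel (R n)) t) \<longlonglongrightarrow> char \<Gamma> t" for t
      unfolding R_def \<Gamma>_def by (intro q_gamma_char_tendsto[OF \<mu> qs(2,1,3) N G])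
  qed (rule \<Gamma>(1))
  moreover have "weak_conv_m (\<lambda>n. distr (N n) borel (U n)) (return borel 1)"
    unfolding U_def[abs_def] by (rule scaled_I_q_weak_conv[OF qs(2,1,3) N \<epsilon>])
  ultimately show "(\<lambda>n. cdf (distr (M (q n)) borel (\<lambda>\<omega>. (1 - q n)\<^sup>2 * exp_functional (q n) (Pp (q n)) (Pm (q n)) \<omega>)) x)
      \<longlonglongrightarrow> cdf (distr Q borel (\<lambda>\<omega>. 1 / \<gamma> \<omega>)) x"
    unfolding law \<Gamma>(3) by (intro ratio_cdf_tendsto[OF N Um Rm Rpos _ _ \<Gamma>(1,2)])
qed simp

theorem corollary2p2:
  fixes \<mu> :: real
  assumes "0 < \<mu>"
  shows
    "(\<forall>q z (M :: 'a measure) Pp Pm.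
        0 < q \<and> q < 1 \<and> z = q powr \<mu> \<and>
        prob_space M \<and> prob_space.indep_poisson_pair M 1 z Pp Pm \<longrightarrow>
          exp_functional q Pp Pm \<in> borel_measurable M \<and>
          (AE \<omega> in M. set_integrable lborel {0..} (\<lambda>s. q powi zeta Pp Pm s \<omega>)) \<and>
          (\<forall>(N :: 'b measure) \<epsilon> G.
             prob_space N \<and> prob_space.iid_std_exponential N \<epsilon> \<and>
             prob_space.indep_geometric_seq N q z G \<and>
             prob_space.indep_var N borel (I_q q \<epsilon>) borel (q_gamma q G) \<longrightarrow>
               (AE \<omega> in N. summable (\<lambda>n. q ^ n * \<epsilon> n \<omega>)) \<and>
               (AE \<omega> in N. summable (\<lambda>n. G n \<omega>)) \<and>
               distr M borel (exp_functional q Pp Pm) =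
                 distr N borel (\<lambda>\<omega>. q powi (- int (\<Sum>n. G n \<omega>)) * I_q q \<epsilon> \<omega>) \<and>
               (\<forall>\<omega>\<in>space N. q powi (- int (\<Sum>n. G n \<omega>)) * I_q q \<epsilon> \<omega> =
                  inverse (1 - q) * I_q q \<epsilon> \<omega> / q_gamma q G \<omega>)))
     \<and>
     (\<forall>(M :: real \<Rightarrow> 'a measure) Pp Pm (Q :: 'c measure) \<gamma>.
        (\<forall>q\<in>{0<..<1}. prob_space (M q) \<and>
           prob_space.indep_poisson_pair (M q) 1 (q powr \<mu>) (Pp q) (Pm q)) \<and>
        prob_space Q \<and> distributed Q lborel \<gamma> (gamma_density \<mu>) \<longrightarrow>
          weak_conv_along
            (\<lambda>q. distr (M q) borel (\<lambda>\<omega>. (1 - q)\<^sup>2 * exp_functional q (Pp q) (Pm q) \<omega>))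
            (distr Q borel (\<lambda>\<omega>. 1 / \<gamma> \<omega>))
            (at_left 1))"
proof (intro conjI allI impI)
  fix q z and M :: "'a measure" and Pp Pm
  assume asm: "0 < q \<and> q < 1 \<and> z = q powr \<mu> \<and> prob_space M \<and> prob_space.indep_poisson_pair M 1 z Pp Pm"
  then interpret poisson_pair_functional M q \<mu> Pp Pm
    using assms by (auto simp: poisson_pair_functional_def poisson_pair_functional_axioms_def)
  have zq: "z = q powr \<mu>" using asm by simp
  have a: "0 \<le> q powr \<mu>" "q powr \<mu> < 1" using q \<mu> powr_less_mono2[of \<mu> q 1] by auto
  show "exp_functional q Pp Pm \<in> borel_measurable M"
    unfolding exp_functional_eq by (rule measurable_X)
  show "AE \<omega> in M. set_integrable lborel {0..} (\<lambda>s. q powi zeta Pp Pm s \<omega>)"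
    unfolding powi_zeta by (rule AE_set_integrable)
  fix N :: "'b measure" and \<epsilon> G
  assume N: "prob_space N \<and> prob_space.iid_std_exponential N \<epsilon> \<and>
    prob_space.indep_geometric_seq N q z G \<and> prob_space.indep_var N borel (I_q q \<epsilon>) borel (q_gamma q G)"
  show "AE \<omega> in N. summable (\<lambda>n. q ^ n * \<epsilon> n \<omega>)"
    using N q by (intro prob_space.exponential_series_summable) auto
  show "AE \<omega> in N. summable (\<lambda>n. G n \<omega>)"
    using N q a zq by (intro prob_space.geometric_series_summable[of N q "q powr \<mu>"]) auto
  show "distr M borel (exp_functional q Pp Pm) = distr N borel (\<lambda>\<omega>. q powi (- int (\<Sum>n. G n \<omega>)) * I_q q \<epsilon> \<omega>)"
    unfolding exp_functional_eq using N zq by (intro exp_functional_law) auto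
  show "\<forall>\<omega>\<in>space N. q powi (- int (\<Sum>n. G n \<omega>)) * I_q q \<epsilon> \<omega> = inverse (1 - q) * I_q q \<epsilon> \<omega> / q_gamma q G \<omega>"
    by (intro ballI quotient_eq_q_gamma q)
next
  fix M :: "real \<Rightarrow> 'a measure" and Pp Pm and Q :: "'c measure" and \<gamma>
  assume asm: "(\<forall>q\<in>{0<..<1}. prob_space (M q) \<and> prob_space.indep_poisson_pair (M q) 1 (q powr \<mu>) (Pp q) (Pm q)) \<and>
    prob_space Q \<and> distributed Q lborel \<gamma> (gamma_density \<mu>)"
  show "weak_conv_along (\<lambda>q. distr (M q) borel (\<lambda>\<omega>. (1 - q)\<^sup>2 * exp_functional q (Pp q) (Pm q) \<omega>))
    (distr Q borel (\<lambda>\<omega>. 1 / \<gamma> \<omega>)) (at_left 1)"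
    using asm by (intro exp_functional_scaling_limit[OF assms]) auto
qed

end
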